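(* Let $U$ be a non-degenerate space of quasi-exponentials with data $\{m, M_a, m_{ab}, z_a, n, N_i, n_{ij}, \lambda_i\}$ (where $a=1,\dots,m$, $b=1,\dots,M_a$, $i=1,\dots,n$, $j=1,\dots,N_i$), and let $V$ be the space bispectral dual to $U$, i.e. the complex vector space spanned by all functions $$\hat f_i(x)=\int_{\gamma_i}x^u f(u)\,du,\qquad i=1,\dots,n,\ f\in U^\ddagger .$$ Then: (i) $V$ is a non-degenerate space of quasi-polynomials with data $\{n, N_i, n_{ij}, \lambda_i-N_i, m, M_a, m_{ab}, z_a\}$. (ii) Let $D_U=\sum_{i=0}^N\sum_{j=0}^M A_{ij}\,u^i\tau_u^j$, with $A_{ij}\in\mathbb C$, be the regularized fundamental difference operator of $U$. Then $\sum_{i=0}^N\sum_{j=0}^M A_{ij}\,x^j(x\partial_x)^i$ is the regularized fundamental differential operator of $V$.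
   Context: **Quasi-exponentials.** $(\tau_uf)(u)=f(u+1)$. For a nonzero complex number $z$ with fixed argument, $z^u=e^{u\ln z}$. Let $z_1,\dots,z_m$ be distinct nonzero complex numbers with fixed arguments, $M_1,\dots,M_m$ positive integers, $M=\sum_aM_a$; for each $a$ let $0<m_{a1}<\dots<m_{aM_a}$ be integers and $q_{ab}\in\mathbb C[u]$ of degree $m_{ab}$. The span $U$ of the functions $z_a^uq_{ab}(u)$ is called a space of quasi-exponentials; $\dim U=M$. The discrete exponents of $U$ at $\lambda\in\mathbb C$ are the unique nonnegative integers $c_1<\dots<c_M$ for which there is a basis $f_1,\dots,f_M$ of $U$ with $f_i(\lambda+j)=0$ for $0\le j\le c_i-1$ and $f_i(\lambda+c_i)\ne0$. Let $\lambda_1,\dots,\lambda_n\in\mathbb C$, $\lambda_i-\lambda_j\notin\mathbb Z$ for $i\ne j$, be such that the discrete exponents of $U$ at $\lambda_i$ are $0<\dots<M-N_i-1<M-N_i+n_{i1}<\dots<M-N_i+n_{iN_i}$ with $1\le N_i\le M$, $0<n_{i1}<\dots<n_{iN_i}$; put $N=\sum_iN_i$. Then $U$ is a space of quasi-exponentials with data $\{m,M_a,m_{ab},z_a,n,N_i,n_{ij},\lambda_i\}$. It is *numerically non-degenerate* if $\sum_{a,b}(m_{ab}+1-b)=\sum_{i,j}(n_{ij}+1-j)$. The regularized fundamental difference operator of $U$ is the operator $D_U=B_0(u)\tau_u^M+B_1(u)\tau_u^{M-1}+\dots+B_M(u)$ of order $M$ with polynomial coefficients annihilating $U$ such that $B_0$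 is monic of minimal possible degree. $U$ with data $\{m,M_a,m_{ab},z_a,n,N_i,n_{ij},\lambda_i\}$ is *non-degenerate* if it is numerically non-degenerate and $\deg B_0=N$; then all $B_k$ have degree at most $N$. $\mathrm{Wr}^{(d)}(f_1,\dots,f_i)$ is the determinant of the $i\times i$ matrix whose $j$-th row is $f_j(u),f_j(u+1),\dots,f_j(u+i-1)$; $\mathrm{Wr}^{(d)}_U$ is the discrete Wronskian of a basis of $U$. The regularized conjugate space $U^\ddagger$ is the span of all functions $\dfrac{\tau_u(\mathrm{Wr}^{(d)}(f_1,\dots,f_{M-1}))}{B_M(u)\,\mathrm{Wr}^{(d)}_U(u)}$ with $f_1,\dots,f_{M-1}\in U$. For $i=1,\dots,n$ let $S_i=\{\lambda_i-N_i,\lambda_i-N_i+1,\dots,\lambda_i-N_i+n_{iN_i}\}$, and let $\gamma_i$ be a non-self-intersecting closed connected curve in $\mathbb C$, oriented counterclockwise, such that the points of $S_i$ are inside $\gamma_i$ and the points of $S_j$, $j\neq i$, are outside $\gamma_i$. **Quasi-polynomials.** Let $N_1,\dots,N_n$ be positive integers, $N=N_1+\dots+N_n$. For each $i$ let $0<n_{i1}<\dots<n_{iN_i}$ be integers and $p_{ij}\in\mathbb C[x]$ of degree $n_{ij}$. Let $\mu_1,\dots,\mu_n\in\mathbb C$ with $\mu_i-\mu_j\notin\mathbb Z$ for $i\ne j$. The span $V$ of the multivalued functions $x^{\mu_i}p_{ij}(x)$ is called a space of quasi-polynomials; $\dim V=N$ (branches differ by nonzero constant factors). $V$ is *non-degenerate*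 if for all $i$ and $j=1,\dots,N_i$: there is a linear combination of $p_{i1},\dots,p_{iN_i}$ with a root at $x=0$ of multiplicity exactly $j-1$, and $x^{\mu_i+n_{ij}}\notin V$. The exponents of $V$ at $z\in\mathbb C^*$ are the unique integers $e_1<\dots<e_N$ such that for each $i$ some $f\in V$ has a root at $z$ of multiplicity $e_i$; $z$ is singular if $\{e_i\}\neq\{0,\dots,N-1\}$. If $z_1,\dots,z_m$ are all the singular points in $\mathbb C^*$ and the exponents at $z_a$ are $0<\dots<N-M_a-1<N-M_a+m_{a1}<\dots<N-M_a+m_{aM_a}$ with $1\le M_a\le N$, $0<m_{a1}<\dots<m_{aM_a}$, then $V$ is a space of quasi-polynomials with data $\{n,N_i,n_{ij},\mu_i,m,M_a,m_{ab},z_a\}$. $\bar D_V$ is the unique monic linear differential operator of order $N$ annihilating $V$, and $D_V=x^N\prod_{a=1}^m(x-z_a)^{M_a}\,\bar D_V$ is the regularized fundamental differential operator of $V$; here $\partial_x=d/dx$. *)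

theory Defs
  imports
    "HOL-Complex_Analysis.Complex_Analysis"
    "HOL-Library.Function_Algebras"
    "Jordan_Normal_Form.Determinant"
begin

text \<open>
  Families \<open>x\<^sub>1, \<dots>, x\<^sub>k\<close> are functions on \<^typ>\<open>nat\<close> of which only the values on \<open>{1..k}\<close>
  matter; \<open>Ms a\<close>, \<open>ms a b\<close>, \<open>Ns i\<close>, \<open>ns i j\<close> stand for
  \<open>M\<^sub>a\<close>, \<open>m\<^sub>a\<^sub>b\<close>, \<open>N\<^sub>i\<close>, \<open>n\<^sub>i\<^sub>j\<close>.
\<close>

interpretation cfun: vector_space
  "\<lambda>(c::complex) (f::complex \<Rightarrow> complex) (u::complex). c * f u"
  by unfold_locales (auto simp: fun_eq_iff algebra_simps)

definition is_basis :: "(complex \<Rightarrow> complex) list \<Rightarrow> (complex \<Rightarrow> complex) set \<Rightarrow> bool" where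
  "is_basis fs W \<longleftrightarrow> distinct fs \<and> cfun.independent (set fs) \<and> cfun.span (set fs) = W"

definition rank_sum :: "nat \<Rightarrow> (nat \<Rightarrow> nat) \<Rightarrow> nat" where
  "rank_sum k r = (\<Sum>i=1..k. r i)"

definition increasing_positive :: "nat \<Rightarrow> (nat \<Rightarrow> nat) \<Rightarrow> (nat \<Rightarrow> nat \<Rightarrow> nat) \<Rightarrow> bool" where
  "increasing_positive k r s \<longleftrightarrow>
     (\<forall>i\<in>{1..k}. 0 < r i \<and> (\<forall>j\<in>{1..r i}. 0 < s i j) \<and> strict_mono_on {1..r i} (s i))"

text \<open>The sequence \<open>0 < \<dots> < d-r-1 < d-r+s\<^sub>1 < \<dots> < d-r+s\<^sub>r\<close>, indexed by \<open>{1..d}\<close> (for \<open>r \<le> d\<close>).\<close>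

definition gap_exponents :: "nat \<Rightarrow> nat \<Rightarrow> (nat \<Rightarrow> nat) \<Rightarrow> nat \<Rightarrow> nat" where
  "gap_exponents d r s k = (if k \<le> d - r then k - 1 else (d - r) + s (k - (d - r)))"

section \<open>Spaces of quasi-exponentials\<close>

text \<open>\<open>z\<^sup>u\<close> for \<open>z \<noteq> 0\<close> with the fixed argument \<open>\<theta>\<close>, that is \<open>ln z = ln \<bar>z\<bar> + \<i>\<theta>\<close>.\<close>

definition zpow :: "complex \<Rightarrow> real \<Rightarrow> complex \<Rightarrow> complex" where
  "zpow z \<theta> u = exp (u * (of_real (ln (cmod z)) + \<i> * of_real \<theta>))"

definition quasi_exponentials ::
  "nat \<Rightarrow> (nat \<Rightarrow> nat) \<Rightarrow> (nat \<Rightarrow> nat \<Rightarrow> nat) \<Rightarrow> (nat \<Rightarrow> complex) \<Rightarrow> (nat \<Rightarrow> real)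
     \<Rightarrow> (complex \<Rightarrow> complex) set \<Rightarrow> bool" where
  "quasi_exponentials m Ms ms z \<theta> U \<longleftrightarrow>
     (\<forall>a\<in>{1..m}. z a \<noteq> 0 \<and> z a = rcis (cmod (z a)) (\<theta> a)) \<and> inj_on z {1..m} \<and>
     increasing_positive m Ms ms \<and>
     (\<exists>q :: nat \<Rightarrow> nat \<Rightarrow> complex poly.
        (\<forall>a\<in>{1..m}. \<forall>b\<in>{1..Ms a}. degree (q a b) = ms a b) \<and>
        U = cfun.span {\<lambda>u. zpow (z a) (\<theta> a) u * poly (q a b) u | a b.
                         a \<in> {1..m} \<and> b \<in> {1..Ms a}})"

definition discrete_exponents ::
  "(complex \<Rightarrow> complex) set \<Rightarrow> nat \<Rightarrow> complex \<Rightarrow> (nat \<Rightarrow> nat) \<Rightarrow> bool" where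
  "discrete_exponents U M l c \<longleftrightarrow> strict_mono_on {1..M} c \<and>
     (\<exists>fs. is_basis fs U \<and> length fs = M \<and>
        (\<forall>i\<in>{1..M}. (\<forall>j<c i. (fs ! (i - 1)) (l + of_nat j) = 0) \<and>
                    (fs ! (i - 1)) (l + of_nat (c i)) \<noteq> 0))"

definition quasi_exponentials_data ::
  "nat \<Rightarrow> (nat \<Rightarrow> nat) \<Rightarrow> (nat \<Rightarrow> nat \<Rightarrow> nat) \<Rightarrow> (nat \<Rightarrow> complex) \<Rightarrow> (nat \<Rightarrow> real)
     \<Rightarrow> nat \<Rightarrow> (nat \<Rightarrow> nat) \<Rightarrow> (nat \<Rightarrow> nat \<Rightarrow> nat) \<Rightarrow> (nat \<Rightarrow> complex)
     \<Rightarrow> (complex \<Rightarrow> complex) set \<Rightarrow> bool" where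
  "quasi_exponentials_data m Ms ms z \<theta> n Ns ns l U \<longleftrightarrow>
     quasi_exponentials m Ms ms z \<theta> U \<and>
     (\<forall>i\<in>{1..n}. \<forall>j\<in>{1..n}. i \<noteq> j \<longrightarrow> l i - l j \<notin> \<int>) \<and>
     increasing_positive n Ns ns \<and>
     (\<forall>i\<in>{1..n}. Ns i \<le> rank_sum m Ms \<and>
        discrete_exponents U (rank_sum m Ms) (l i)
          (gap_exponents (rank_sum m Ms) (Ns i) (ns i)))"

text \<open>The operator \<open>B\<^sub>0(u) \<tau>\<^sup>M + B\<^sub>1(u) \<tau>\<^sup>M\<^sup>-\<^sup>1 + \<dots> + B\<^sub>M(u)\<close>, where \<open>(\<tau> f)(u) = f(u + 1)\<close>.\<close>

definition difference_operator ::
  "nat \<Rightarrow> (nat \<Rightarrow> complex poly) \<Rightarrow> (complex \<Rightarrow> complex) \<Rightarrow> complex \<Rightarrow> complex" where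
  "difference_operator M B f u = (\<Sum>k\<le>M. poly (B k) u * f (u + of_nat (M - k)))"

definition annihilating_difference_operator ::
  "(complex \<Rightarrow> complex) set \<Rightarrow> nat \<Rightarrow> (nat \<Rightarrow> complex poly) \<Rightarrow> bool" where
  "annihilating_difference_operator U M B \<longleftrightarrow>
     B 0 \<noteq> 0 \<and> (\<forall>f\<in>U. \<forall>u. difference_operator M B f u = 0)"

definition regularized_difference_operator ::
  "(complex \<Rightarrow> complex) set \<Rightarrow> nat \<Rightarrow> (nat \<Rightarrow> complex poly) \<Rightarrow> bool" where
  "regularized_difference_operator U M B \<longleftrightarrow>
     annihilating_difference_operator U M B \<and> lead_coeff (B 0) = 1 \<and>
     (\<forall>B'. annihilating_difference_operator U M B' \<longrightarrow> degree (B 0) \<le> degree (B' 0))"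

definition numerically_nondegenerate ::
  "nat \<Rightarrow> (nat \<Rightarrow> nat) \<Rightarrow> (nat \<Rightarrow> nat \<Rightarrow> nat) \<Rightarrow> nat \<Rightarrow> (nat \<Rightarrow> nat) \<Rightarrow> (nat \<Rightarrow> nat \<Rightarrow> nat) \<Rightarrow> bool" where
  "numerically_nondegenerate m Ms ms n Ns ns \<longleftrightarrow>
     (\<Sum>a=1..m. \<Sum>b=1..Ms a. int (ms a b) + 1 - int b) =
     (\<Sum>i=1..n. \<Sum>j=1..Ns i. int (ns i j) + 1 - int j)"

definition nondegenerate_quasi_exponentials ::
  "nat \<Rightarrow> (nat \<Rightarrow> nat) \<Rightarrow> (nat \<Rightarrow> nat \<Rightarrow> nat) \<Rightarrow> (nat \<Rightarrow> complex) \<Rightarrow> (nat \<Rightarrow> real)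
     \<Rightarrow> nat \<Rightarrow> (nat \<Rightarrow> nat) \<Rightarrow> (nat \<Rightarrow> nat \<Rightarrow> nat) \<Rightarrow> (nat \<Rightarrow> complex)
     \<Rightarrow> (complex \<Rightarrow> complex) set \<Rightarrow> bool" where
  "nondegenerate_quasi_exponentials m Ms ms z \<theta> n Ns ns l U \<longleftrightarrow>
     quasi_exponentials_data m Ms ms z \<theta> n Ns ns l U \<and>
     numerically_nondegenerate m Ms ms n Ns ns \<and>
     (\<exists>B. regularized_difference_operator U (rank_sum m Ms) B \<and>
          degree (B 0) = rank_sum n Ns)"

section \<open>The bispectral dual space\<close>

definition discrete_wronskian :: "(complex \<Rightarrow> complex) list \<Rightarrow> complex \<Rightarrow> complex" where
  "discrete_wronskian fs u =
     Determinant.det (Matrix.mat (length fs) (length fs) (\<lambda>(j, k). (fs ! j) (u + of_nat k)))"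

text \<open>
  The Wronskian of a basis is determined by \<open>U\<close> up to a nonzero constant, so letting the basis
  \<open>gs\<close> vary does not change the span. The last coefficient of the operator of \<open>U\<close> is \<open>B M\<close>.
\<close>

definition regularized_conjugate ::
  "(complex \<Rightarrow> complex) set \<Rightarrow> nat \<Rightarrow> (nat \<Rightarrow> complex poly) \<Rightarrow> (complex \<Rightarrow> complex) set" where
  "regularized_conjugate U M B =
     cfun.span {\<lambda>u. discrete_wronskian fs (u + 1) / (poly (B M) u * discrete_wronskian gs u) | fs gs.
                  set fs \<subseteq> U \<and> length fs = M - 1 \<and> is_basis gs U}"

definition pole_string :: "(nat \<Rightarrow> nat) \<Rightarrow> (nat \<Rightarrow> nat \<Rightarrow> nat) \<Rightarrow> (nat \<Rightarrow> complex) \<Rightarrow> nat \<Rightarrow> complex set" where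
  "pole_string Ns ns l i = {l i - of_nat (Ns i) + of_nat k | k. k \<le> ns i (Ns i)}"

text \<open>Piecewise smooth Jordan curves; winding number \<open>1\<close> encodes the counterclockwise orientation.\<close>

definition counterclockwise_jordan_curve :: "(real \<Rightarrow> complex) \<Rightarrow> bool" where
  "counterclockwise_jordan_curve g \<longleftrightarrow>
     valid_path g \<and> simple_path g \<and> pathfinish g = pathstart g \<and>
     (\<forall>w\<in>inside (path_image g). winding_number g w = 1)"

definition separating_contours ::
  "nat \<Rightarrow> (nat \<Rightarrow> nat) \<Rightarrow> (nat \<Rightarrow> nat \<Rightarrow> nat) \<Rightarrow> (nat \<Rightarrow> complex) \<Rightarrow> (nat \<Rightarrow> real \<Rightarrow> complex) \<Rightarrow> bool" where
  "separating_contours n Ns ns l \<gamma> \<longleftrightarrow>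
     (\<forall>i\<in>{1..n}. counterclockwise_jordan_curve (\<gamma> i) \<and>
        pole_string Ns ns l i \<subseteq> inside (path_image (\<gamma> i)) \<and>
        (\<forall>j\<in>{1..n}. j \<noteq> i \<longrightarrow> pole_string Ns ns l j \<subseteq> outside (path_image (\<gamma> i))))"

text \<open>
  A multivalued function of \<open>x \<in> \<complex>\<^sup>*\<close> is represented by a function on the universal cover
  of \<open>\<complex>\<^sup>*\<close>, which is the complex plane with coordinate \<open>t = ln x\<close> and covering map \<open>x = exp t\<close>.
  In particular \<open>x\<^sup>u\<close> is \<open>exp (u * t)\<close>, and the points \<open>t\<close> over a given \<open>x\<close> correspond to the branches at \<open>x\<close>.
\<close>

definition bispectral_dual ::
  "(complex \<Rightarrow> complex) set \<Rightarrow> nat \<Rightarrow> (nat \<Rightarrow> complex poly) \<Rightarrow> nat \<Rightarrow> (nat \<Rightarrow> real \<Rightarrow> complex)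
     \<Rightarrow> (complex \<Rightarrow> complex) set" where
  "bispectral_dual U M B n \<gamma> =
     cfun.span {\<lambda>t. contour_integral (\<gamma> i) (\<lambda>u. exp (u * t) * f u) | i f.
                  i \<in> {1..n} \<and> f \<in> regularized_conjugate U M B}"

section \<open>Spaces of quasi-polynomials\<close>

definition quasi_polynomials_basis ::
  "nat \<Rightarrow> (nat \<Rightarrow> nat) \<Rightarrow> (nat \<Rightarrow> nat \<Rightarrow> nat) \<Rightarrow> (nat \<Rightarrow> complex) \<Rightarrow> (nat \<Rightarrow> nat \<Rightarrow> complex poly)
     \<Rightarrow> (complex \<Rightarrow> complex) set \<Rightarrow> bool" where
  "quasi_polynomials_basis n Ns ns \<mu> p V \<longleftrightarrow>
     increasing_positive n Ns ns \<and>
     (\<forall>i\<in>{1..n}. \<forall>j\<in>{1..n}. i \<noteq> j \<longrightarrow> \<mu> i - \<mu> j \<notin> \<int>) \<and>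
     (\<forall>i\<in>{1..n}. \<forall>j\<in>{1..Ns i}. degree (p i j) = ns i j) \<and>
     V = cfun.span {\<lambda>t. exp (\<mu> i * t) * poly (p i j) (exp t) | i j.
                      i \<in> {1..n} \<and> j \<in> {1..Ns i}}"

text \<open>The polynomials \<open>p i 1, \<dots>, p i (Ns i)\<close> are not unique, but their span is determined by \<open>V\<close>.\<close>

definition nondegenerate_quasi_polynomials ::
  "nat \<Rightarrow> (nat \<Rightarrow> nat) \<Rightarrow> (nat \<Rightarrow> nat \<Rightarrow> nat) \<Rightarrow> (nat \<Rightarrow> complex) \<Rightarrow> (complex \<Rightarrow> complex) set \<Rightarrow> bool" where
  "nondegenerate_quasi_polynomials n Ns ns \<mu> V \<longleftrightarrow>
     (\<exists>p. quasi_polynomials_basis n Ns ns \<mu> p V \<and>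
        (\<forall>i\<in>{1..n}. \<forall>j\<in>{1..Ns i}.
           (\<exists>c :: nat \<Rightarrow> complex. \<exists>r. r = (\<Sum>k=1..Ns i. Polynomial.smult (c k) (p i k)) \<and>
              r \<noteq> 0 \<and> Polynomial.order 0 r = j - 1) \<and>
           (\<lambda>t. exp ((\<mu> i + of_nat (ns i j)) * t)) \<notin> V))"

text \<open>The derivation \<open>\<partial>\<^sub>x\<close>, written in the coordinate \<open>t = ln x\<close>.\<close>

definition dx :: "(complex \<Rightarrow> complex) \<Rightarrow> complex \<Rightarrow> complex" where
  "dx F t = deriv F t / exp t"

definition has_root_of_multiplicity :: "(complex \<Rightarrow> complex) \<Rightarrow> complex \<Rightarrow> nat \<Rightarrow> bool" where
  "has_root_of_multiplicity F t k \<longleftrightarrow> (\<forall>j<k. (dx ^^ j) F t = 0) \<and> (dx ^^ k) F t \<noteq> 0"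

text \<open>
  The set \<open>{e\<^sub>1, \<dots>, e\<^sub>N}\<close>; as \<open>V\<close> is invariant under monodromy, every point \<open>t\<close> over \<open>x\<close>
  contributes the same multiplicities.
\<close>

definition exponents :: "(complex \<Rightarrow> complex) set \<Rightarrow> complex \<Rightarrow> nat set" where
  "exponents V x = {e. \<exists>F\<in>V. \<exists>t. exp t = x \<and> has_root_of_multiplicity F t e}"

definition singular_points :: "(complex \<Rightarrow> complex) set \<Rightarrow> nat \<Rightarrow> complex set" where
  "singular_points V N = {x. x \<noteq> 0 \<and> exponents V x \<noteq> {..<N}}"

definition quasi_polynomials_data ::
  "nat \<Rightarrow> (nat \<Rightarrow> nat) \<Rightarrow> (nat \<Rightarrow> nat \<Rightarrow> nat) \<Rightarrow> (nat \<Rightarrow> complex)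
     \<Rightarrow> nat \<Rightarrow> (nat \<Rightarrow> nat) \<Rightarrow> (nat \<Rightarrow> nat \<Rightarrow> nat) \<Rightarrow> (nat \<Rightarrow> complex)
     \<Rightarrow> (complex \<Rightarrow> complex) set \<Rightarrow> bool" where
  "quasi_polynomials_data n Ns ns \<mu> m Ms ms z V \<longleftrightarrow>
     (\<exists>p. quasi_polynomials_basis n Ns ns \<mu> p V) \<and>
     inj_on z {1..m} \<and> z ` {1..m} = singular_points V (rank_sum n Ns) \<and>
     increasing_positive m Ms ms \<and>
     (\<forall>a\<in>{1..m}. Ms a \<le> rank_sum n Ns \<and>
        exponents V (z a) = gap_exponents (rank_sum n Ns) (Ms a) (ms a) ` {1..rank_sum n Ns})"

text \<open>
  \<open>b 0, \<dots>, b N\<close> are the coefficients of \<open>1, \<partial>\<^sub>x, \<dots>, \<partial>\<^sub>x\<^sup>N\<close>. Away from the singular points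
  the Wronskian of \<open>V\<close> does not vanish, so there the coefficients of the monic operator of order
  \<open>N = dim V\<close> annihilating \<open>V\<close> are uniquely determined.
\<close>

definition differential_operator ::
  "nat \<Rightarrow> (nat \<Rightarrow> complex \<Rightarrow> complex) \<Rightarrow> (complex \<Rightarrow> complex) \<Rightarrow> complex \<Rightarrow> complex" where
  "differential_operator N b F t = (\<Sum>k\<le>N. b k (exp t) * (dx ^^ k) F t)"

definition fundamental_differential_operator ::
  "(complex \<Rightarrow> complex) set \<Rightarrow> nat \<Rightarrow> (nat \<Rightarrow> complex \<Rightarrow> complex) \<Rightarrow> bool" where
  "fundamental_differential_operator V N b \<longleftrightarrow>
     (\<forall>k\<le>N. b k holomorphic_on - ({0} \<union> singular_points V N)) \<and> b N = (\<lambda>x. 1) \<and>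
     (\<forall>F\<in>V. \<forall>t. exp t \<notin> singular_points V N \<longrightarrow> differential_operator N b F t = 0)"

text \<open>
  \<open>T\<close> is the operator \<open>x\<^sup>N \<Prod>\<^sub>a (x - z\<^sub>a)\<^bsup>M\<^sub>a\<^esup>\<close> times the monic fundamental operator. Equality of
  differential operators is equality of their action on all holomorphic germs off the singular points.
\<close>

definition regularized_differential_operator ::
  "(complex \<Rightarrow> complex) set \<Rightarrow> nat \<Rightarrow> nat \<Rightarrow> (nat \<Rightarrow> nat) \<Rightarrow> (nat \<Rightarrow> complex)
     \<Rightarrow> ((complex \<Rightarrow> complex) \<Rightarrow> complex \<Rightarrow> complex) \<Rightarrow> bool" where
  "regularized_differential_operator V N m Ms z T \<longleftrightarrow>
     (\<exists>b. fundamental_differential_operator V N b \<and>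
        (\<forall>F t. exp t \<notin> singular_points V N \<and> F analytic_on {t} \<longrightarrow>
           T F t = exp t ^ N * (\<Prod>a=1..m. (exp t - z a) ^ Ms a) * differential_operator N b F t))"

definition xdx :: "(complex \<Rightarrow> complex) \<Rightarrow> complex \<Rightarrow> complex" where
  "xdx F t = exp t * dx F t"

text \<open>The operator \<open>\<Sum>\<^sub>i\<^sub>j A\<^sub>i\<^sub>j x\<^sup>j (x\<partial>\<^sub>x)\<^sup>i\<close>.\<close>

definition dual_differential_operator ::
  "nat \<Rightarrow> nat \<Rightarrow> (nat \<Rightarrow> nat \<Rightarrow> complex) \<Rightarrow> (complex \<Rightarrow> complex) \<Rightarrow> complex \<Rightarrow> complex" where
  "dual_differential_operator N M A F t = (\<Sum>i\<le>N. \<Sum>j\<le>M. A i j * exp t ^ j * (xdx ^^ i) F t)"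

end

theory Submission
  imports Defs "HOL-Computational_Algebra.Fundamental_Theorem_Algebra" "HOL-Combinatorics.Stirling"
begin

text \<open>
  Write the operator of \<open>U\<close> by powers of \<open>u\<close> instead of powers of \<open>\<tau>\<close>,
  \<open>D\<^sub>U = \<Sum>\<^sub>i u\<^sup>i p\<^sub>i(\<tau>)\<close> with polynomials \<open>p\<^sub>i\<close> of degree at most \<open>M\<close>. The dual
  operator is \<open>\<Sum>\<^sub>i p\<^sub>i(x) (x d/dx)\<^sup>i\<close>. The proof reads off its local behaviour at the points
  \<open>z\<^sub>a\<close> from the growth of the elements of \<open>U\<close>, and its solutions from the poles of the elements
  of the conjugate space.

  \<^bold>\<open>The points \<open>z\<^sub>a\<close>.\<close> Applying \<open>D\<^sub>U\<close> to \<open>z\<^sup>u q(u)\<close> and comparing the leading powers of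
  \<open>u\<close> gives relations among the numbers \<open>((x d/dx)\<^sup>k p\<^sub>i)(z)\<close>, in which \<open>deg q\<close> enters through
  binomial coefficients (\<open>indicial_equation\<close>). Such a relation is a polynomial equation for
  \<open>deg q\<close>, and at \<open>z\<^sub>a\<close> it has the \<open>M\<^sub>a\<close> roots \<open>m\<^sub>a\<^sub>b\<close>. The relations of degree less than
  \<open>M\<^sub>a\<close> are therefore trivial, so that the top \<open>p\<^sub>i\<close> is divisible by \<open>\<Prod>\<^sub>a (x - z\<^sub>a)\<^bsup>Ms a\<^esup>\<close>,
  which has degree \<open>M\<close>. Hence the top index is \<open>N = deg B\<^sub>0\<close> and the top polynomial is exactly this
  product (\<open>col_top\<close>). The relation of degree \<open>M\<^sub>a\<close> is the indicial equation of the dual operator at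
  \<open>z\<^sub>a\<close>, its roots being exactly the \<open>m\<^sub>a\<^sub>b\<close> (\<open>indicial_zero_iff\<close>); the subleading coefficients
  of all these equations together give a relation of Fuchs type between \<open>B\<^sub>0\<close> and \<open>B\<^sub>M\<close>
  (\<open>fuchs_relation\<close>).

  \<^bold>\<open>The roots of \<open>B\<^sub>0\<close> and \<open>B\<^sub>M\<close>.\<close> The Casoratian \<open>W\<close> of \<open>U\<close> is an exponential times a
  polynomial and satisfies \<open>B\<^sub>0(u) W(u + 1) = \<plusminus> B\<^sub>M(u) W(u)\<close>. Comparing the two top coefficients and
  using the Fuchs relation, the degree of the polynomial is \<open>\<Sum>\<^sub>a\<^sub>b (m\<^sub>a\<^sub>b + 1 - b)\<close>. The
  discrete exponents force zeros of \<open>W\<close> at the points of the strings \<open>\<lambda>\<^sub>i - N\<^sub>i + r\<close>, and their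
  forced orders add up to \<open>\<Sum>\<^sub>i\<^sub>j (n\<^sub>i\<^sub>j + 1 - j)\<close>. By numerical non-degeneracy there is no room
  for further zeros (\<open>wronskian_orders\<close>). Since the coefficients \<open>B\<^sub>k\<close> have no common root, this
  bounds the order of \<open>B\<^sub>0\<close> everywhere, and \<open>deg B\<^sub>0 = N\<close> then determines its roots, the points
  \<open>\<lambda>\<^sub>i - N\<^sub>i + n\<^sub>i\<^sub>j\<close>, all simple (\<open>B0_roots\<close>). The equation for \<open>W\<close> finally
  yields the roots of \<open>B\<^sub>M\<close>, the points \<open>\<lambda>\<^sub>i - N\<^sub>i, \<dots>, \<lambda>\<^sub>i - 1\<close>, again simple
  (\<open>BM_order_string\<close>).

  \<^bold>\<open>The space \<open>V\<close>.\<close> The conjugate space is spanned by entries of the inverse Casorati matrix divided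
  by \<open>B\<^sub>M\<close>. Its elements solve the adjoint difference equation \<open>\<Sum>\<^sub>j B\<^bsub>M-j\<^esub>(u - j) f(u - j) = 0\<close>
  (\<open>conjugate_adjoint\<close>), and the orders found above show that their only singularities are simple poles on
  the finite strings \<open>S\<^sub>i\<close> (\<open>phi_simple_pole\<close>). By the residue theorem \<open>f\<close> contributes to \<open>V\<close> the
  functions \<open>2\<pi>\<i> x\<^bsup>\<mu>\<^esup> R(x)\<close>, where \<open>\<mu> = \<lambda>\<^sub>i - N\<^sub>i\<close> and the coefficients of \<open>R\<close> are the residues of
  \<open>f\<close> on \<open>S\<^sub>i\<close>. The residues satisfy the same difference equation as \<open>f\<close>, which says precisely that
  the dual operator kills \<open>V\<close> (\<open>dual_op_residue_poly\<close>). Its top term shows that \<open>deg R\<close> is one of the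
  \<open>n\<^sub>i\<^sub>j\<close> (\<open>degree_residue_poly\<close>), and suitable elements \<open>f\<close> realise the orders
  \<open>0, \<dots>, N\<^sub>i - 1\<close> of \<open>R\<close> at \<open>0\<close> (\<open>triangular_element\<close>). Hence the polynomials \<open>R\<close> have a
  basis with degrees \<open>n\<^sub>i\<^sub>j\<close>, \<open>1 \<le> j \<le> N\<^sub>i\<close>, and \<open>dim V = N\<close>.

  \<^bold>\<open>Conclusion.\<close> An exponent of \<open>V\<close> at \<open>x\<close> is an exponent of the dual operator, and those lie in
  an explicit set of \<open>N\<close> elements: \<open>{0, \<dots>, N - 1}\<close> for \<open>x \<noteq> z\<^sub>a\<close>, and the set prescribed by
  the indicial equation for \<open>x = z\<^sub>a\<close>. As \<open>dim V = N\<close>, all of these occur (\<open>exponents_eq\<close>).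
  Finally \<open>x\<^sup>c \<notin> V\<close> for every \<open>c\<close>, because the dual operator maps \<open>x\<^sup>c\<close> to
  \<open>\<Sum>\<^sub>j B\<^bsub>M-j\<^esub>(c) x\<^bsup>c+j\<^esup>\<close> and the \<open>B\<^sub>k\<close> have no common root.

  Functions on the universal cover of \<open>\<complex>\<^sup>*\<close> are written in the coordinate \<open>t = ln x\<close>, in which
  \<open>x d/dx\<close> is \<open>d/dt\<close>.
\<close>

section \<open>Linear systems and independence of exponentials\<close>

lemma nontrivial_solution:
  fixes a :: "'e \<Rightarrow> 'j \<Rightarrow> 'k::field"
  assumes "finite E" "finite J" "card E < card J"
  shows "\<exists>x. (\<exists>j\<in>J. x j \<noteq> 0) \<and> (\<forall>e\<in>E. (\<Sum>j\<in>J. a e j * x j) = 0)"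
  using assms
proof (induction E arbitrary: J a rule: finite_induct)
  case empty
  then obtain j where "j \<in> J" by fastforce
  then show ?case by (intro exI[of _ "\<lambda>_. 1"]) auto
next
  case (insert e E)
  show ?case
  proof (cases "\<forall>j\<in>J. a e j = 0")
    case True
    have "card E < card J" using insert by simp
    from insert.IH[OF insert.prems(1) this, of a] obtain x
      where "\<exists>j\<in>J. x j \<noteq> 0" "\<forall>e\<in>E. (\<Sum>j\<in>J. a e j * x j) = 0" by blast
    with True show ?thesis by (intro exI[of _ x]) auto
  next
    case False
    then obtain j0 where j0: "j0 \<in> J" "a e j0 \<noteq> 0" by blast
    (* Eliminate the unknown j0, whose coefficient in the equation e is invertible. *)
    define J' where "J' = J - {j0}"
    have J': "finite J'" "card E < card J'" using insert j0 by (auto simp: J'_def)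
    from insert.IH[OF J', of "\<lambda>e' j. a e' j - a e' j0 * a e j / a e j0"] obtain x
      where x: "\<exists>j\<in>J'. x j \<noteq> 0"
        "\<forall>e'\<in>E. (\<Sum>j\<in>J'. (a e' j - a e' j0 * a e j / a e j0) * x j) = 0" by blast
    define y where "y = x(j0 := - (\<Sum>j\<in>J'. a e j * x j) / a e j0)"
    have sumJ: "(\<Sum>j\<in>J. a e' j * y j) = a e' j0 * y j0 + (\<Sum>j\<in>J'. a e' j * x j)" for e'
    proof -
      have "(\<Sum>j\<in>J'. a e' j * y j) = (\<Sum>j\<in>J'. a e' j * x j)"
        by (intro sum.cong) (auto simp: y_def J'_def)
      then show ?thesis
        using sum.remove[OF insert.prems(1) j0(1), of "\<lambda>j. a e' j * y j"] by (simp add: J'_def)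
    qed
    have "(\<Sum>j\<in>J. a e j * y j) = 0"
      unfolding sumJ using j0 by (simp add: y_def)
    moreover have "(\<Sum>j\<in>J. a e' j * y j) = 0" if "e' \<in> E" for e'
    proof -
      have "0 = (\<Sum>j\<in>J'. a e' j * x j - (a e' j0 / a e j0) * (a e j * x j))"
        using x(2) that by (simp add: algebra_simps)
      also have "\<dots> = (\<Sum>j\<in>J'. a e' j * x j) - (a e' j0 / a e j0) * (\<Sum>j\<in>J'. a e j * x j)"
        by (simp add: sum_subtractf sum_distrib_left)
      finally show ?thesis unfolding sumJ using j0 by (simp add: y_def)
    qed
    moreover have "\<exists>j\<in>J. y j \<noteq> 0" using x(1) by (auto simp: y_def J'_def)
    ultimately show ?thesis by (intro exI[of _ y]) auto
  qed
qed

text \<open>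
  If the equations \<open>E\<close> have only the zero solution, dropping the equation \<open>e0\<close> leaves fewer
  equations than unknowns; a nonzero solution of the remaining ones cannot satisfy \<open>e0\<close>, and is
  rescaled. This is the form in which a count of dimensions is used below: once for the residues on a
  string, once for the exponents of the dual space.
\<close>

lemma dual_solution:
  fixes a :: "'e \<Rightarrow> 'j \<Rightarrow> 'k::field"
  assumes "finite E" "finite J" "card E \<le> card J" and e0: "e0 \<in> E"
    and inj: "\<And>x. (\<And>e. e \<in> E \<Longrightarrow> (\<Sum>j\<in>J. a e j * x j) = 0) \<Longrightarrow> \<forall>j\<in>J. x j = 0"
  shows "\<exists>x. \<forall>e\<in>E. (\<Sum>j\<in>J. a e j * x j) = (if e = e0 then 1 else 0)"
proof -
  have "card (E - {e0}) < card J"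
    using assms(1,3) e0 card_gt_0_iff[of E] by (auto simp: card_Diff_singleton)
  from nontrivial_solution[OF _ assms(2) this, of a] assms(1) obtain x
    where x: "\<exists>j\<in>J. x j \<noteq> 0" "\<And>e. e \<in> E - {e0} \<Longrightarrow> (\<Sum>j\<in>J. a e j * x j) = 0"
    by auto
  define c where "c = (\<Sum>j\<in>J. a e0 j * x j)"
  have "c \<noteq> 0"
  proof
    assume "c = 0"
    then have "(\<Sum>j\<in>J. a e j * x j) = 0" if "e \<in> E" for e
      using x(2) that by (cases "e = e0") (auto simp: c_def)
    then show False using inj[of x] x(1) by blast
  qed
  have "(\<Sum>j\<in>J. a e j * (x j / c)) = (if e = e0 then 1 else 0)" if "e \<in> E" for e
  proof -
    have "(\<Sum>j\<in>J. a e j * (x j / c)) = (\<Sum>j\<in>J. a e j * x j) / c"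
      by (simp add: sum_divide_distrib)
    then show ?thesis using x(2)[of e] that \<open>c \<noteq> 0\<close> by (auto simp: c_def)
  qed
  then show ?thesis by (intro exI[of _ "\<lambda>j. x j / c"] ballI)
qed

lemma coeff_pcompose_shift_degree:
  fixes p :: "complex poly"
  shows "coeff (p \<circ>\<^sub>p [:1, 1:]) (degree p) = lead_coeff p" "degree (p \<circ>\<^sub>p [:1, 1:]) = degree p"
proof -
  show d: "degree (p \<circ>\<^sub>p [:1, 1:]) = degree p" by (simp add: degree_pcompose)
  show "coeff (p \<circ>\<^sub>p [:1, 1:]) (degree p) = lead_coeff p"
    using lead_coeff_comp[of "[:1,1::complex:]" p] d by simp
qed

text \<open>
  The sequence \<open>k \<mapsto> \<Sum>\<^sub>a z\<^sub>a\<^sup>k P\<^sub>a(k)\<close> stays zero when the shift minus \<open>z a0\<close> is applied. This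
  operation lowers the degree of \<open>P a0\<close> and keeps the degree of every other \<open>P a\<close>, which gives an
  induction on the total degree.
\<close>

lemma exp_poly_independent:
  fixes P :: "'a \<Rightarrow> complex poly"
  assumes A: "finite A" and z: "inj_on z A" "\<And>a. a \<in> A \<Longrightarrow> z a \<noteq> 0"
    and zero: "\<And>k::nat. (\<Sum>a\<in>A. z a ^ k * poly (P a) (of_nat k)) = 0"
  shows "\<forall>a\<in>A. P a = 0"
  using zero
proof (induction "\<Sum>a\<in>A. if P a = 0 then 0 else Suc (degree (P a))" arbitrary: P rule: less_induct)
  case less
  show ?case
  proof (rule ccontr)
    assume "\<not> ?thesis"
    then obtain a0 where a0: "a0 \<in> A" "P a0 \<noteq> 0" by blast
    (* The coefficients after applying the shift minus z a0. *)
    define Q where "Q a = Polynomial.smult (z a) (P a \<circ>\<^sub>p [:1, 1:]) - Polynomial.smult (z a0) (P a)" for a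
    have Qc: "coeff (Q a) (degree (P a)) = (z a - z a0) * lead_coeff (P a)" for a
      unfolding Q_def by (simp add: coeff_pcompose_shift_degree algebra_simps)
    have Qd: "degree (Q a) \<le> degree (P a)" for a
      unfolding Q_def by (intro degree_diff_le) (auto simp: coeff_pcompose_shift_degree)
    have Qz: "Q a = 0" if "P a = 0" for a using that by (simp add: Q_def)
    have Q0: "Q a0 = 0 \<or> degree (Q a0) < degree (P a0)"
    proof (rule ccontr)
      assume "\<not> ?thesis"
      then have "degree (Q a0) = degree (P a0)" "Q a0 \<noteq> 0" using Qd[of a0] by auto
      then show False using Qc[of a0] leading_coeff_0_iff[of "Q a0"] by simp
    qed
    have "(\<Sum>a\<in>A. z a ^ k * poly (Q a) (of_nat k)) = 0" for k :: nat
    proof -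
      have "(\<Sum>a\<in>A. z a ^ k * poly (Q a) (of_nat k)) =
        (\<Sum>a\<in>A. z a ^ Suc k * poly (P a) (of_nat (Suc k))) - z a0 * (\<Sum>a\<in>A. z a ^ k * poly (P a) (of_nat k))"
        unfolding sum_distrib_left sum_subtractf[symmetric]
        by (intro sum.cong) (auto simp: Q_def poly_pcompose algebra_simps)
      then show ?thesis by (simp only: less.prems) simp
    qed
    moreover have "(\<Sum>a\<in>A. if Q a = 0 then 0 else Suc (degree (Q a))) <
       (\<Sum>a\<in>A. if P a = 0 then 0 else Suc (degree (P a)))"
      by (rule sum_strict_mono_ex1[OF A]) (use Qd Qz Q0 a0 in auto)
    ultimately have Q: "\<forall>a\<in>A. Q a = 0" using less.hyps by blast
    have Pz: "P a = 0" if "a \<in> A" "a \<noteq> a0" for a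
      using Q Qc[of a] that a0 z(1) by (auto simp: inj_on_def)
    have "poly (P a0) (of_nat k) = 0" for k :: nat
    proof -
      have "(\<Sum>a\<in>A. z a ^ k * poly (P a) (of_nat k)) = z a0 ^ k * poly (P a0) (of_nat k)"
        using sum.remove[OF A a0(1), of "\<lambda>a. z a ^ k * poly (P a) (of_nat k)"] Pz by simp
      then show ?thesis using less.prems[of k] z(2)[OF a0(1)] by simp
    qed
    then have "range (of_nat :: nat \<Rightarrow> complex) \<subseteq> {x. poly (P a0) x = 0}" by auto
    then have "finite (range (of_nat :: nat \<Rightarrow> complex))"
      using poly_roots_finite[OF a0(2)] by (rule finite_subset)
    moreover have "inj (of_nat :: nat \<Rightarrow> complex)" by (simp add: inj_def)
    ultimately show False using finite_imageD[of "of_nat :: nat \<Rightarrow> complex" UNIV] infinite_UNIV_nat by blast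
  qed
qed

lemma exponentials_independent:
  fixes c :: "complex \<Rightarrow> complex"
  assumes "finite E" "\<And>t. (\<Sum>e\<in>E. c e * exp (e * t)) = 0"
  shows "\<forall>e\<in>E. c e = 0"
  using assms
proof (induction E arbitrary: c rule: finite_induct)
  case (insert e0 E)
  (* Applying d/dt - e0 removes the exponential with exponent e0. *)
  have "(\<Sum>e\<in>E. (c e * (e - e0)) * exp (e * t)) = 0" for t
  proof -
    have "((\<lambda>t. \<Sum>e\<in>insert e0 E. c e * exp (e * t)) has_field_derivative
        (\<Sum>e\<in>insert e0 E. c e * (e * exp (e * t)))) (at t)"
      by (intro DERIV_sum) (auto intro!: derivative_eq_intros)
    moreover have "((\<lambda>t. \<Sum>e\<in>insert e0 E. c e * exp (e * t)) has_field_derivative 0) (at t)"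
      using insert.prems by simp
    ultimately have "(\<Sum>e\<in>insert e0 E. c e * (e * exp (e * t))) = 0" by (rule DERIV_unique)
    then have "(\<Sum>e\<in>insert e0 E. c e * (e * exp (e * t))) - e0 * (\<Sum>e\<in>insert e0 E. c e * exp (e * t)) = 0"
      using insert.prems by simp
    moreover have "(\<Sum>e\<in>insert e0 E. c e * (e * exp (e * t))) - e0 * (\<Sum>e\<in>insert e0 E. c e * exp (e * t))
       = (\<Sum>e\<in>insert e0 E. (c e * (e - e0)) * exp (e * t))"
      unfolding sum_distrib_left sum_subtractf[symmetric] by (intro sum.cong) (auto simp: algebra_simps)
    ultimately show ?thesis using insert.hyps by simp
  qed
  from insert.IH[of "\<lambda>e. c e * (e - e0)", OF this] have z: "\<forall>e\<in>E. c e = 0" using insert.hyps by auto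
  with insert.prems[of 0] insert.hyps show ?case by simp
qed auto

section \<open>Binomial sums as polynomials\<close>

lemma prod_linear_factors:
  fixes c :: "'a \<Rightarrow> complex"
  assumes "finite A"
  shows "degree (\<Prod>i\<in>A. [:- c i, 1:]) = card A" "coeff (\<Prod>i\<in>A. [:- c i, 1:]) (card A) = 1"
    "card A > 0 \<Longrightarrow> coeff (\<Prod>i\<in>A. [:- c i, 1:]) (card A - 1) = - (\<Sum>i\<in>A. c i)"
proof -
  have 1: "degree (\<Prod>i\<in>A. [:- c i, 1:]) = card A" if "finite A" for A
    using degree_prod_eq_sum_degree[of A "\<lambda>i. [:- c i, 1:]"] by simp
  have 2: "coeff (\<Prod>i\<in>A. [:- c i, 1:]) (card A) = 1" if "finite A" for A
    using 1[OF that] lead_coeff_prod[of "\<lambda>i. [:- c i, 1:]" A] by simp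
  show "card A > 0 \<Longrightarrow> coeff (\<Prod>i\<in>A. [:- c i, 1:]) (card A - 1) = - (\<Sum>i\<in>A. c i)"
    using assms
  proof (induction A rule: finite_induct)
    case (insert a A)
    show ?case
    proof (cases "A = {}")
      case False
      then obtain k where k: "card A = Suc k" using insert by (metis card_0_eq not0_implies_Suc)
      then show ?thesis using insert 2[of A] by (simp add: coeff_pCons)
    qed simp
  qed simp
  show "degree (\<Prod>i\<in>A. [:- c i, 1:]) = card A" "coeff (\<Prod>i\<in>A. [:- c i, 1:]) (card A) = 1"
    using 1 2 assms by auto
qed

definition falling_poly :: "nat \<Rightarrow> complex poly" where
  "falling_poly k = (\<Prod>i<k. [:- of_nat i, 1:])"

lemma poly_falling_poly: "poly (falling_poly k) (of_nat s) = fact k * of_nat (s choose k)"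
proof -
  have "poly (falling_poly k) (of_nat s) = (\<Prod>i=0..<k. of_nat s - of_nat i)"
    by (simp add: falling_poly_def poly_prod atLeast0LessThan)
  also have "\<dots> = fact k * ((of_nat s :: complex) gchoose k)"
    by (simp add: gbinomial_prod_rev)
  finally show ?thesis by (simp add: binomial_gbinomial)
qed

text \<open>
  A sum \<open>\<Sum>\<^sub>k C\<^sub>k binom(s, k)\<close> with \<open>k \<le> e\<close> is a polynomial in \<open>s\<close> of degree at most \<open>e\<close>. Its
  two top coefficients are recorded, because they carry the sum of its roots.
\<close>

lemma binomial_sum_poly:
  fixes C :: "nat \<Rightarrow> complex"
  defines "qq \<equiv> (\<lambda>e. \<Sum>k\<le>e. Polynomial.smult (C k / fact k) (falling_poly k))"
  shows "poly (qq e) (of_nat s) = (\<Sum>k\<le>e. C k * of_nat (s choose k))"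
    "degree (qq e) \<le> e" "coeff (qq e) e = C e / fact e"
    "e > 0 \<Longrightarrow> coeff (qq e) (e - 1) = C (e - 1) / fact (e - 1) - (C e / fact e) * of_nat (e * (e - 1) div 2)"
    "qq e = 0 \<Longrightarrow> k \<le> e \<Longrightarrow> C k = 0"
proof -
  have deg: "degree (falling_poly k) = k" "coeff (falling_poly k) k = 1" for k
    using prod_linear_factors(1,2)[of "{..<k}" "of_nat :: nat \<Rightarrow> complex"] by (auto simp: falling_poly_def)
  show ev: "poly (qq e) (of_nat s) = (\<Sum>k\<le>e. C k * of_nat (s choose k))" for e s
    unfolding qq_def by (simp add: poly_sum poly_falling_poly)
  show d: "degree (qq e) \<le> e" for e
    unfolding qq_def by (intro degree_sum_le) (auto simp: deg intro: order_trans[OF degree_smult_le])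
  show c: "coeff (qq e) e = C e / fact e" for e
  proof -
    have "coeff (qq e) e = (\<Sum>k\<le>e. C k / fact k * coeff (falling_poly k) e)"
      unfolding qq_def by (simp add: coeff_sum)
    also have "\<dots> = (\<Sum>k\<le>e. if k = e then C e / fact e else 0)"
      by (intro sum.cong) (auto simp: deg coeff_eq_0)
    finally show ?thesis by simp
  qed
  show "coeff (qq e) (e - 1) = C (e - 1) / fact (e - 1) - (C e / fact e) * of_nat (e * (e - 1) div 2)"
    if "e > 0"
  proof -
    obtain e' where e': "e = Suc e'" using \<open>e > 0\<close> by (cases e) auto
    have "coeff (falling_poly (Suc e')) e' = - (\<Sum>i<Suc e'. of_nat i)"
      using prod_linear_factors(3)[of "{..<Suc e'}" "of_nat :: nat \<Rightarrow> complex"]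
      by (simp add: falling_poly_def del: sum.lessThan_Suc)
    also have "(\<Sum>i<Suc e'. (of_nat i :: complex)) = of_nat (\<Sum>i<Suc e'. i)" by (simp only: of_nat_sum)
    also have "(\<Sum>i<Suc e'. i) = Suc e' * e' div 2"
      using gauss_sum_nat[of e'] by (simp add: lessThan_Suc_atMost atLeast0AtMost mult.commute del: sum.lessThan_Suc mult_Suc mult_Suc_right)
    finally have s: "coeff (falling_poly (Suc e')) e' = - of_nat (Suc e' * e' div 2)" .
    have "coeff (qq (Suc e')) e' = coeff (qq e') e' + C (Suc e') / fact (Suc e') * coeff (falling_poly (Suc e')) e'"
      unfolding qq_def by simp
    then show ?thesis unfolding e' s using c[of e'] by simp
  qed
  show "C k = 0" if z: "qq e = 0" and k: "k \<le> e"
    using k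
  proof (induction k rule: less_induct)
    case (less k)
    have "0 = (\<Sum>j\<le>e. C j * of_nat (k choose j))" using ev[of e k] z by simp
    also have "\<dots> = (\<Sum>j\<le>e. if j = k then C k else 0)"
    proof (intro sum.cong refl)
      fix j assume "j \<in> {..e}"
      then show "C j * of_nat (k choose j) = (if j = k then C k else 0)"
        using less.IH[of j] by (cases j k rule: linorder_cases) auto
    qed
    finally show ?case using less.prems by simp
  qed
qed

lemma binomial_sum_vanish:
  fixes C :: "nat \<Rightarrow> complex"
  assumes "finite S" "card S > e" "\<And>s. s \<in> S \<Longrightarrow> (\<Sum>k\<le>e. C k * of_nat (s choose k)) = 0" "k \<le> e"
  shows "C k = 0"
proof -
  let ?qq = "\<Sum>k\<le>e. Polynomial.smult (C k / fact k) (falling_poly k)"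
  have "?qq = 0"
  proof (rule ccontr)
    assume nz: "?qq \<noteq> 0"
    have "card ((of_nat :: nat \<Rightarrow> complex) ` S) \<le> card {x. poly ?qq x = 0}"
      using assms(3) binomial_sum_poly(1)[where C = C and e = e] by (intro card_mono poly_roots_finite nz) auto
    also have "\<dots> \<le> degree ?qq" by (rule card_poly_roots_bound[OF nz])
    also have "\<dots> \<le> e" by (rule binomial_sum_poly(2))
    finally show False using assms(2) by (simp add: card_image inj_on_def)
  qed
  then show ?thesis using binomial_sum_poly(5)[where C = C and e = e] assms(4) by blast
qed

text \<open>
  With \<open>e\<close> known roots \<open>S\<close> the polynomial is a multiple of \<open>\<Prod>\<^sub>s (u - s)\<close>. So it has no other roots,
  and its subleading coefficient is given by the sum of \<open>S\<close>.
\<close>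

lemma binomial_sum_factor:
  fixes C :: "nat \<Rightarrow> complex"
  assumes S: "finite S" "card S = e" and z: "\<And>s. s \<in> S \<Longrightarrow> (\<Sum>k\<le>e. C k * of_nat (s choose k)) = 0"
    and Ce: "C e \<noteq> 0"
  shows "(\<Sum>k\<le>e. C k * of_nat (s choose k)) = 0 \<Longrightarrow> s \<in> S"
    "e > 0 \<Longrightarrow> C (e - 1) / fact (e - 1) =
        - (C e / fact e) * (of_nat (\<Sum>S) - of_nat (e * (e - 1) div 2))"
proof -
  define qq where "qq = (\<Sum>k\<le>e. Polynomial.smult (C k / fact k) (falling_poly k))"
  define \<pi> where "\<pi> = (\<Prod>s\<in>S. [:- of_nat s, 1::complex:])"
  note pl = prod_linear_factors[OF S(1), of "of_nat :: nat \<Rightarrow> complex", folded \<pi>_def]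
  note bs = binomial_sum_poly[where C = C and e = e, folded qq_def]
  (* The difference has degree less than e, but the e roots S. *)
  have "qq - Polynomial.smult (C e / fact e) \<pi> = 0"
  proof (rule ccontr)
    let ?d = "qq - Polynomial.smult (C e / fact e) \<pi>"
    assume nz: "?d \<noteq> 0"
    have "card ((of_nat :: nat \<Rightarrow> complex) ` S) \<le> card {x. poly ?d x = 0}"
    proof (intro card_mono poly_roots_finite nz subsetI)
      fix x :: complex assume "x \<in> of_nat ` S"
      then obtain s where s: "s \<in> S" "x = of_nat s" by blast
      have "poly \<pi> x = 0" using s S by (auto simp: \<pi>_def poly_prod)
      then show "x \<in> {x. poly ?d x = 0}" using s z bs(1)[of s] by simp
    qed
    also have "\<dots> \<le> degree ?d" by (rule card_poly_roots_bound[OF nz])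
    finally have le: "e \<le> degree ?d" using S by (simp add: card_image inj_on_def)
    have "degree ?d \<le> e" using bs(2) pl(1) S by (intro degree_diff_le) (auto intro: order_trans[OF degree_smult_le])
    with le have "degree ?d = e" by simp
    moreover have "coeff ?d e = 0" using bs(3) pl(2) S by simp
    ultimately show False using nz leading_coeff_0_iff[of "qq - Polynomial.smult (C e / fact e) \<pi>"] by simp
  qed
  then have eq: "qq = Polynomial.smult (C e / fact e) \<pi>" by simp
  show "s \<in> S" if "(\<Sum>k\<le>e. C k * of_nat (s choose k)) = 0"
  proof -
    have "poly \<pi> (of_nat s) = 0" using that bs(1)[of s] eq Ce by simp
    then show ?thesis using S by (auto simp: \<pi>_def poly_prod)
  qed
  show "C (e - 1) / fact (e - 1) = - (C e / fact e) * (of_nat (\<Sum>S) - of_nat (e * (e - 1) div 2))" if "e > 0"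
  proof -
    have "coeff qq (e - 1) = (C e / fact e) * - (\<Sum>s\<in>S. of_nat s)"
      using eq pl(3) S that by simp
    then have "C (e - 1) / fact (e - 1) - (C e / fact e) * of_nat (e * (e - 1) div 2)
        = (C e / fact e) * - of_nat (\<Sum>S)" using bs(4)[OF that] by (simp only: of_nat_sum)
    moreover have rearrange: "x = - y * (t - g)" if "x - y * g = y * - t" for x y g t :: complex
      using that by (simp add: algebra_simps)
    ultimately show ?thesis by (intro rearrange)
  qed
qed

section \<open>The operator x d/dx on polynomials\<close>

text \<open>
  The operator \<open>x d/dx\<close>.
\<close>

definition euler :: "complex poly \<Rightarrow> complex poly" where
  "euler p = pCons 0 (pderiv p)"

lemma coeff_euler_power: "coeff ((euler ^^ k) p) j = of_nat j ^ k * coeff p j"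
  by (induction k arbitrary: j) (auto simp: euler_def coeff_pCons coeff_pderiv split: nat.splits)

lemma euler_power_linear:
  "(euler ^^ k) (p + q) = (euler ^^ k) p + (euler ^^ k) q"
  "(euler ^^ k) (p - q) = (euler ^^ k) p - (euler ^^ k) q"
  "(euler ^^ k) (Polynomial.smult c p) = Polynomial.smult c ((euler ^^ k) p)"
  "(euler ^^ k) (sum f A) = (\<Sum>a\<in>A. (euler ^^ k) (f a))"
  by (auto intro!: poly_eqI simp: coeff_euler_power coeff_sum sum_distrib_left algebra_simps)

text \<open>
  Away from \<open>0\<close> the operators \<open>x d/dx\<close> and \<open>d/dx\<close> detect the order of a root equally well.
\<close>

lemma euler_power_root_order:
  assumes "z \<noteq> 0" "p \<noteq> 0" "\<And>k. k < K \<Longrightarrow> poly ((euler ^^ k) p) z = 0"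
  shows "K \<le> Polynomial.order z p"
  using assms(2,3)
proof (induction K arbitrary: p)
  case (Suc K)
  have root: "poly p z = 0" using Suc.prems(2)[of 0] by simp
  have d0: "pderiv p \<noteq> 0"
  proof
    assume "pderiv p = 0"
    then have "degree p = 0" by (simp add: pderiv_eq_0_iff)
    then obtain c where "p = [:c:]" by (metis degree_eq_zeroE)
    then show False using root Suc.prems(1) by simp
  qed
  have t: "euler p = [:0, 1:] * pderiv p" by (simp add: euler_def)
  have "euler p \<noteq> 0" using d0 by (simp add: euler_def)
  moreover have "poly ((euler ^^ k) (euler p)) z = 0" if "k < K" for k
    using Suc.prems(2)[of "Suc k"] that by (simp only: funpow_Suc_right o_def)
  ultimately have "K \<le> Polynomial.order z (euler p)" by (rule Suc.IH)
  also have "\<dots> = Polynomial.order z [:0, 1:] + Polynomial.order z (pderiv p)"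
    unfolding t using d0 by (intro order_mult) auto
  also have "Polynomial.order z [:0, 1:] = 0" using assms(1) by (intro order_0I) auto
  finally show ?case using order_pderiv[OF Suc.prems(1) root] by simp
qed simp

lemma euler_linear_power: "euler ([:- z, 1:] ^ Suc k * P) =
    [:- z, 1:] ^ k * (Polynomial.smult (of_nat (Suc k)) (pCons 0 P) + [:- z, 1:] * euler P)"
proof -
  have t: "euler p = [:0, 1:] * pderiv p" for p by (simp add: euler_def)
  show ?thesis unfolding t pderiv_mult pderiv_power_Suc
    by (simp add: pderiv_pCons algebra_simps smult_add_right)
qed

lemma euler_power_dvd_root:
  assumes "[:- z, 1:] ^ K dvd p" "k < K"
  shows "poly ((euler ^^ k) p) z = 0"
  using assms
proof (induction k arbitrary: K p)
  case 0
  then show ?case by (cases K) (auto simp: dvd_def)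
next
  case (Suc k)
  obtain K' where "K = Suc K'" using Suc.prems(2) by (cases K) auto
  moreover obtain P where "p = [:- z, 1:] ^ K * P" using Suc.prems(1) by (rule dvdE)
  ultimately have K': "K = Suc K'" "p = [:- z, 1:] ^ Suc K' * P" by auto
  have "[:- z, 1:] ^ K' dvd euler p" unfolding K'(2) euler_linear_power by (rule dvd_triv_left)
  moreover have "k < K'" using Suc \<open>K = Suc K'\<close> by simp
  ultimately show ?case using Suc.IH by (simp add: funpow_Suc_right del: funpow.simps)
qed

lemma euler_power_leading: "poly ((euler ^^ k) ([:- z, 1:] ^ k * P)) z = fact k * z ^ k * poly P z"
proof (induction k arbitrary: P)
  case (Suc k)
  show ?case
    by (simp only: funpow_Suc_right o_def euler_linear_power Suc.IH) (simp add: algebra_simps)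
qed simp

lemma poly_altdef_le:
  fixes p :: "complex poly"
  assumes "degree p \<le> n"
  shows "poly p x = (\<Sum>i\<le>n. coeff p i * x ^ i)"
  unfolding poly_altdef using assms by (intro sum.mono_neutral_left) (auto simp: coeff_eq_0)

text \<open>
  The polynomial \<open>p\<^sub>i\<close> with \<open>D = \<Sum>\<^sub>i u\<^sup>i p\<^sub>i(\<tau>)\<close> for
  \<open>D = B\<^sub>0(u) \<tau>\<^sup>M + \<dots> + B\<^sub>M(u)\<close>, in a variable \<open>x\<close> in place of \<open>\<tau>\<close>.
\<close>

definition column_poly :: "nat \<Rightarrow> (nat \<Rightarrow> complex poly) \<Rightarrow> nat \<Rightarrow> complex poly" where
  "column_poly M B i = (\<Sum>j\<le>M. Polynomial.monom (coeff (B (M - j)) i) j)"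

lemma coeff_column_poly: "coeff (column_poly M B i) j = (if j \<le> M then coeff (B (M - j)) i else 0)"
  by (simp add: column_poly_def coeff_sum)

lemma poly_euler_column_poly:
  "poly ((euler ^^ k) (column_poly M B i)) z = (\<Sum>j\<le>M. coeff (B (M - j)) i * of_nat j ^ k * z ^ j)"
proof -
  have "degree ((euler ^^ k) (column_poly M B i)) \<le> M"
    by (rule degree_le) (auto simp: coeff_euler_power coeff_column_poly)
  then have "poly ((euler ^^ k) (column_poly M B i)) z
      = (\<Sum>j\<le>M. coeff ((euler ^^ k) (column_poly M B i)) j * z ^ j)"
    by (rule poly_altdef_le)
  then show ?thesis by (simp add: coeff_euler_power coeff_column_poly mult_ac)
qed

text \<open>
  The function \<open>D(z\<^sup>u q(u)) / z\<^sup>u\<close>, expanded in powers of \<open>u\<close>: the powers \<open>j\<^sup>k\<close> from the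
  binomial expansion of \<open>(u + j)\<^sup>t\<close> turn \<open>p\<^sub>i\<close> into \<open>(x d/dx)\<^sup>k p\<^sub>i\<close>.
\<close>

lemma annihilated_expansion:
  assumes H: "\<And>u. (\<Sum>j\<le>M. z ^ j * poly (B (M - j)) u * poly q (u + of_nat j)) = 0"
    and d: "\<And>k. k \<le> M \<Longrightarrow> degree (B k) \<le> d"
  shows "(\<Sum>i\<le>d. \<Sum>t\<le>degree q. \<Sum>k\<le>t. Polynomial.monom
      (poly ((euler ^^ k) (column_poly M B i)) z * coeff q t * of_nat (t choose k)) (i + t - k)) = 0"
    (is "?X = 0")
proof -
  have "poly ?X u = 0" for u
  proof -
    have Bp: "poly (B (M - j)) u = (\<Sum>i\<le>d. coeff (B (M - j)) i * u ^ i)" for j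
      using d[of "M - j"] by (intro poly_altdef_le) auto
    have qp: "poly q (u + of_nat j) = (\<Sum>t\<le>degree q. \<Sum>k\<le>t. coeff q t * of_nat (t choose k) * of_nat j ^ k * u ^ (t - k))" for j
    proof -
      have "poly q (u + of_nat j) = (\<Sum>t\<le>degree q. coeff q t * (of_nat j + u) ^ t)"
        by (simp add: poly_altdef add.commute)
      then show ?thesis by (simp add: binomial_ring sum_distrib_left mult_ac)
    qed
    let ?f = "\<lambda>i t k j. ((coeff (B (M - j)) i * of_nat j ^ k * z ^ j) * (coeff q t * of_nat (t choose k) * (u ^ i * u ^ (t - k))))"
    have "0 = (\<Sum>j\<le>M. z ^ j * (\<Sum>i\<le>d. coeff (B (M - j)) i * u ^ i) *
        (\<Sum>t\<le>degree q. \<Sum>k\<le>t. coeff q t * of_nat (t choose k) * of_nat j ^ k * u ^ (t - k)))"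
      using H[of u] by (simp only: Bp qp)
    also have "\<dots> = (\<Sum>j\<le>M. \<Sum>t\<le>degree q. \<Sum>k\<le>t. \<Sum>i\<le>d. ?f i t k j)"
      by (simp add: sum_distrib_left sum_distrib_right mult_ac)
    also have "\<dots> = (\<Sum>t\<le>degree q. \<Sum>k\<le>t. \<Sum>j\<le>M. \<Sum>i\<le>d. ?f i t k j)"
      by (rule trans[OF sum.swap], rule sum.cong[OF refl], rule sum.swap)
    also have "\<dots> = (\<Sum>t\<le>degree q. \<Sum>i\<le>d. \<Sum>k\<le>t. \<Sum>j\<le>M. ?f i t k j)"
      by (rule sum.cong[OF refl], rule trans[OF _ sum.swap], rule sum.cong[OF refl], rule sum.swap)
    also have "\<dots> = (\<Sum>i\<le>d. \<Sum>t\<le>degree q. \<Sum>k\<le>t. \<Sum>j\<le>M. ?f i t k j)"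
      by (rule sum.swap)
    also have "\<dots> = (\<Sum>i\<le>d. \<Sum>t\<le>degree q. \<Sum>k\<le>t.
        poly ((euler ^^ k) (column_poly M B i)) z * (coeff q t * of_nat (t choose k) * (u ^ i * u ^ (t - k))))"
      by (simp add: poly_euler_column_poly sum_distrib_right)
    also have "\<dots> = poly ?X u"
      unfolding poly_sum poly_monom
      by (intro sum.cong refl) (simp add: mult_ac flip: power_add)
    finally show ?thesis by simp
  qed
  then show ?thesis using poly_all_0_iff_0 by blast
qed

text \<open>
  The value \<open>((x d/dx)\<^sup>k p\<^sub>i)(z)\<close> on the diagonal \<open>i + e = d + k\<close>. These are the values that meet in
  the coefficient of \<open>u\<^bsup>deg q + d - e\<^esup>\<close> of \<open>D(z\<^sup>u q(u)) / z\<^sup>u\<close>.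
\<close>

definition indicial_coeff :: "nat \<Rightarrow> (nat \<Rightarrow> complex poly) \<Rightarrow> complex \<Rightarrow> nat \<Rightarrow> nat \<Rightarrow> nat \<Rightarrow> complex" where
  "indicial_coeff M B z d e k =
     (if e \<le> d + k then poly ((euler ^^ k) (column_poly M B (d + k - e))) z else 0)"

text \<open>
  The coefficient of \<open>u\<^bsup>deg q + d - e\<^esup>\<close> of \<open>D(z\<^sup>u q(u)) / z\<^sup>u\<close>. If the values on the
  diagonals before the \<open>e\<close>-th vanish, only the leading coefficient of \<open>q\<close> contributes to it, and
  what remains is an equation for the degree of \<open>q\<close>.
\<close>

lemma indicial_equation:
  assumes H: "\<And>u. (\<Sum>j\<le>M. z ^ j * poly (B (M - j)) u * poly q (u + of_nat j)) = 0"
    and d: "\<And>k. k \<le> M \<Longrightarrow> degree (B k) \<le> d"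
    and q: "q \<noteq> 0"
    and low: "\<And>i k e'. e' < e \<Longrightarrow> i + e' = d + k \<Longrightarrow> poly ((euler ^^ k) (column_poly M B i)) z = 0"
  shows "(\<Sum>k\<le>e. indicial_coeff M B z d e k * of_nat (degree q choose k)) = 0"
proof (cases "e \<le> d + degree q")
  case False
  then have "indicial_coeff M B z d e k * of_nat (degree q choose k) = 0" for k
    by (cases "k \<le> degree q") (auto simp: indicial_coeff_def)
  then show ?thesis by (intro sum.neutral) blast
next
  case True
  let ?c = "\<lambda>i k. poly ((euler ^^ k) (column_poly M B i)) z"
  let ?s = "degree q"
  let ?g = "\<lambda>k. ?c (d + k - e) k * lead_coeff q * of_nat (?s choose k)"
  have "0 = coeff (\<Sum>i\<le>d. \<Sum>t\<le>?s. \<Sum>k\<le>t. Polynomial.monom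
      (?c i k * coeff q t * of_nat (t choose k)) (i + t - k)) (d + ?s - e)"
    using annihilated_expansion[where M = M and z = z and B = B and q = q and d = d, OF H d] by simp
  also have "\<dots> = (\<Sum>i\<le>d. \<Sum>t\<le>?s. \<Sum>k\<le>t. if i + t - k = d + ?s - e then ?c i k * coeff q t * of_nat (t choose k) else 0)"
    by (simp add: coeff_sum)
  also have "\<dots> = (\<Sum>i\<le>d. \<Sum>t\<le>?s. if t = ?s then (\<Sum>k\<le>?s. if i + e = d + k then ?g k else 0) else 0)"
  proof (intro sum.cong refl)
    fix i t assume it: "i \<in> {..d}" "t \<in> {..?s}"
    show "(\<Sum>k\<le>t. if i + t - k = d + ?s - e then ?c i k * coeff q t * of_nat (t choose k) else 0)
      = (if t = ?s then (\<Sum>k\<le>?s. if i + e = d + k then ?g k else 0) else 0)"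
    proof (cases "t = ?s")
      case True
      have iff: "i + ?s - k = d + ?s - e \<longleftrightarrow> i + e = d + k" if "k \<le> ?s" for k
        using \<open>e \<le> d + ?s\<close> that by auto
      have "(if i + ?s - k = d + ?s - e then ?c i k * lead_coeff q * of_nat (?s choose k) else 0)
        = (if i + e = d + k then ?g k else 0)" if "k \<in> {..?s}" for k
      proof (cases "i + e = d + k")
        case eq: True
        then have "i = d + k - e" by simp
        then show ?thesis using iff[of k] that eq by simp
      next
        case False
        then show ?thesis using iff[of k] that by simp
      qed
      then have "(\<Sum>k\<le>?s. if i + ?s - k = d + ?s - e then ?c i k * lead_coeff q * of_nat (?s choose k) else 0)
        = (\<Sum>k\<le>?s. if i + e = d + k then ?g k else 0)"
        by (intro sum.cong refl) blast
      then show ?thesis by (simp only: True if_True simp_thms)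
    next
      case False
      have "(if i + t - k = d + ?s - e then ?c i k * coeff q t * of_nat (t choose k) else 0) = 0" if "k \<in> {..t}" for k
      proof (cases "i + t - k = d + ?s - e")
        case eq: True
        (* A lower coefficient of q meets an earlier diagonal. *)
        have "e - (?s - t) < e" "i + (e - (?s - t)) = d + k"
          using eq it False that \<open>e \<le> d + ?s\<close> by auto
        then show ?thesis using low by simp
      qed simp
      then have "(\<Sum>k\<le>t. if i + t - k = d + ?s - e then ?c i k * coeff q t * of_nat (t choose k) else 0) = 0"
        by (intro sum.neutral) blast
      then show ?thesis by (simp only: False if_False)
    qed
  qed
  also have "\<dots> = (\<Sum>i\<le>d. \<Sum>k\<le>?s. if i + e = d + k then ?g k else 0)" by simp
  also have "\<dots> = (\<Sum>k\<le>?s. \<Sum>i\<le>d. if i + e = d + k then ?g k else 0)" by (rule sum.swap)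
  also have "\<dots> = (\<Sum>k\<le>?s. if k \<le> e \<and> e \<le> d + k then ?g k else 0)"
  proof (intro sum.cong refl)
    fix k
    show "(\<Sum>i\<le>d. if i + e = d + k then ?g k else 0) = (if k \<le> e \<and> e \<le> d + k then ?g k else 0)"
    proof (cases "k \<le> e \<and> e \<le> d + k")
      case True
      then have "(\<Sum>i\<le>d. if i + e = d + k then ?g k else 0) = (\<Sum>i\<le>d. if i = d + k - e then ?g k else 0)"
        by (intro sum.cong) auto
      moreover have "d + k - e \<le> d" using True by linarith
      ultimately show ?thesis using True by simp
    next
      case False
      then show ?thesis by (auto intro!: sum.neutral)
    qed
  qed
  also have "\<dots> = (\<Sum>k\<le>?s + e. if k \<le> e \<and> e \<le> d + k then ?g k else 0)"
    by (intro sum.mono_neutral_left) auto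
  also have "\<dots> = (\<Sum>k\<le>e. if k \<le> e \<and> e \<le> d + k then ?g k else 0)"
    by (intro sum.mono_neutral_right) auto
  also have "\<dots> = lead_coeff q * (\<Sum>k\<le>e. indicial_coeff M B z d e k * of_nat (?s choose k))"
    unfolding sum_distrib_left by (intro sum.cong) (auto simp: indicial_coeff_def)
  finally show ?thesis using q by simp
qed

section \<open>Operators annihilating quasi-exponentials\<close>

lemma linear_power_prod_dvd:
  fixes z :: "'a \<Rightarrow> complex"
  assumes "finite A" "inj_on z A" "\<And>a. a \<in> A \<Longrightarrow> [:- z a, 1:] ^ K a dvd p"
  shows "(\<Prod>a\<in>A. [:- z a, 1:] ^ K a) dvd p"
proof (cases "p = 0")
  case False
  have o: "Polynomial.order (z a) (\<Prod>b\<in>S. [:- z b, 1:] ^ K b) = 0"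
    if "finite S" "S \<subseteq> A" "a \<in> A - S" for S a
    using that assms(2) by (intro order_0I) (auto simp: poly_prod inj_on_def)
  show ?thesis
    using assms(1) subset_refl[of A]
  proof (induction A rule: finite_subset_induct')
    case (insert a S)
    then obtain r where r: "p = (\<Prod>b\<in>S. [:- z b, 1:] ^ K b) * r" by (auto elim: dvdE)
    have "K a \<le> Polynomial.order (z a) p" using assms(3) insert False by (simp add: order_divides)
    also have "\<dots> = Polynomial.order (z a) r"
      using o[of S a] insert False unfolding r by (subst order_mult) auto
    finally have "[:- z a, 1:] ^ K a dvd r" by (simp add: order_divides)
    then have "[:- z a, 1:] ^ K a * (\<Prod>b\<in>S. [:- z b, 1:] ^ K b) dvd p"
      unfolding r by (subst mult.commute) (intro mult_dvd_mono dvd_refl)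
    then show ?case using insert by simp
  qed simp
qed simp

lemma index_le_strict_mono:
  fixes s :: "nat \<Rightarrow> nat"
  assumes mono: "strict_mono_on {1..k} s" and pos: "\<And>j. j \<in> {1..k} \<Longrightarrow> 0 < s j"
  shows "j \<in> {1..k} \<Longrightarrow> j \<le> s j"
proof (induction j)
  case (Suc j)
  show ?case
  proof (cases "j = 0")
    case True
    then show ?thesis using pos[of 1] Suc.prems by simp
  next
    case False
    then have j: "j \<in> {1..k}" using Suc.prems by simp
    then have "s j < s (Suc j)" using mono Suc.prems by (auto simp: strict_mono_on_def)
    then show ?thesis using Suc.IH[OF j] by simp
  qed
qed simp

text \<open>
  The last assumption says that \<open>D\<close> annihilates \<open>z\<^sub>a\<^sup>u q\<^sub>a\<^sub>b(u)\<close>, after division by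
  \<open>z\<^sub>a\<^sup>u\<close>, so that no branch of the power has to be chosen.
\<close>

locale annihilated_exponentials =
  fixes m M N :: nat and Ms :: "nat \<Rightarrow> nat" and ms :: "nat \<Rightarrow> nat \<Rightarrow> nat" and z :: "nat \<Rightarrow> complex"
    and B :: "nat \<Rightarrow> complex poly" and q :: "nat \<Rightarrow> nat \<Rightarrow> complex poly"
  assumes z_nonzero: "\<And>a. a \<in> {1..m} \<Longrightarrow> z a \<noteq> 0"
    and z_inj: "inj_on z {1..m}"
    and incr: "increasing_positive m Ms ms"
    and M_eq: "M = rank_sum m Ms"
    and monic: "lead_coeff (B 0) = 1"
    and N_eq: "N = degree (B 0)"
    and deg_q: "\<And>a b. a \<in> {1..m} \<Longrightarrow> b \<in> {1..Ms a} \<Longrightarrow> degree (q a b) = ms a b"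
    and ann: "\<And>a b u. a \<in> {1..m} \<Longrightarrow> b \<in> {1..Ms a} \<Longrightarrow>
        (\<Sum>j\<le>M. z a ^ j * poly (B (M - j)) u * poly (q a b) (u + of_nat j)) = 0"
begin

lemma ms_pos: "a \<in> {1..m} \<Longrightarrow> b \<in> {1..Ms a} \<Longrightarrow> 0 < ms a b"
  and ms_mono: "a \<in> {1..m} \<Longrightarrow> strict_mono_on {1..Ms a} (ms a)"
  and Ms_pos: "a \<in> {1..m} \<Longrightarrow> 0 < Ms a"
  using incr unfolding increasing_positive_def by blast+

lemma card_ms: "a \<in> {1..m} \<Longrightarrow> card (ms a ` {1..Ms a}) = Ms a"
  using strict_mono_on_imp_inj_on[OF ms_mono] by (simp add: card_image)

lemma q_nonzero: "a \<in> {1..m} \<Longrightarrow> b \<in> {1..Ms a} \<Longrightarrow> q a b \<noteq> 0"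
  using deg_q ms_pos by fastforce

abbreviation col :: "nat \<Rightarrow> complex poly" where "col \<equiv> column_poly M B"

text \<open>
  For \<open>e < M\<^sub>a\<close> the polynomial of the indicial equation has degree at most \<open>e\<close> but the \<open>M\<^sub>a\<close>
  roots \<open>m\<^sub>a\<^sub>b\<close>, so all its coefficients are zero. The induction over the diagonals supplies the
  hypothesis of \<open>indicial_equation\<close>.
\<close>

lemma high_columns_vanish:
  assumes a: "a \<in> {1..m}" and d: "\<And>k. k \<le> M \<Longrightarrow> degree (B k) \<le> d"
    and e: "e < Ms a" "i + e = d + k"
  shows "poly ((euler ^^ k) (col i)) (z a) = 0"
  using e
proof (induction e arbitrary: i k rule: less_induct)
  case (less e)
  show ?case
  proof (cases "i \<le> d")
    case True
    have "indicial_coeff M B (z a) d e k = 0"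
    proof (rule binomial_sum_vanish)
      show "finite (ms a ` {1..Ms a})" by simp
      show "e < card (ms a ` {1..Ms a})" using card_ms[OF a] less.prems by simp
      show "k \<le> e" using True less.prems by simp
      fix s assume "s \<in> ms a ` {1..Ms a}"
      then obtain b where b: "b \<in> {1..Ms a}" "s = ms a b" by blast
      show "(\<Sum>k\<le>e. indicial_coeff M B (z a) d e k * of_nat (s choose k)) = 0"
        using indicial_equation[where q = "q a b" and M = M and B = B and z = "z a" and d = d and e = e,
            OF ann[OF a b(1)] d q_nonzero[OF a b(1)]]
          less.IH less.prems(1) unfolding b(2) deg_q[OF a b(1), symmetric]
        by (meson order.strict_trans)
    qed
    moreover have "d + k - e = i" "e \<le> d + k" using less.prems(2) True by linarith+
    ultimately show ?thesis by (simp add: indicial_coeff_def)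
  next
    case False
    have "coeff (B (M - j)) i = 0" for j
      using d[of "M - j"] False by (intro coeff_eq_0) auto
    then have "col i = 0" by (intro poly_eqI) (simp add: coeff_column_poly)
    then show ?thesis using euler_power_linear(3)[of k 0 0] by simp
  qed
qed

lemma linear_power_dvd_top:
  assumes a: "a \<in> {1..m}" and d: "\<And>k. k \<le> M \<Longrightarrow> degree (B k) \<le> d"
  shows "[:- z a, 1:] ^ Ms a dvd col d"
proof (cases "col d = 0")
  case False
  have "Ms a \<le> Polynomial.order (z a) (col d)"
    using z_nonzero[OF a] False
    by (rule euler_power_root_order) (use high_columns_vanish[OF a d] in auto)
  then show ?thesis by (simp add: order_divides)
qed simp

definition top_poly :: "complex poly" where
  "top_poly = (\<Prod>a\<in>{1..m}. [:- z a, 1:] ^ Ms a)"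

lemma degree_top_poly: "degree top_poly = M" "lead_coeff top_poly = 1" "top_poly \<noteq> 0"
proof -
  have nz: "[:- z a, 1:] ^ Ms a \<noteq> 0" for a by simp
  show "degree top_poly = M"
    unfolding top_poly_def M_eq rank_sum_def
    by (subst degree_prod_eq_sum_degree) (auto simp: degree_power_eq)
  show "lead_coeff top_poly = 1" unfolding top_poly_def lead_coeff_prod by (simp add: lead_coeff_power)
  then show "top_poly \<noteq> 0" by auto
qed

lemma degree_col: "degree (col i) \<le> M"
  by (rule degree_le) (auto simp: coeff_column_poly)

text \<open>
  Let \<open>d\<close> be the largest degree of the \<open>B\<^sub>k\<close>. Then \<open>p\<^sub>d \<noteq> 0\<close> is divisible by a polynomial of degree
  \<open>M\<close>, hence has degree \<open>M\<close>; its coefficient of \<open>x\<^sup>M\<close> comes from \<open>B\<^sub>0\<close>.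
\<close>

lemma degree_B: assumes "k \<le> M" shows "degree (B k) \<le> N"
proof -
  define d where "d = Max ((\<lambda>k. degree (B k)) ` {..M})"
  have d: "degree (B k) \<le> d" if "k \<le> M" for k
    unfolding d_def using that by (intro Max_ge) auto
  have "d \<in> (\<lambda>k. degree (B k)) ` {..M}" unfolding d_def by (intro Max_in) auto
  then obtain k0 where k0: "k0 \<le> M" "degree (B k0) = d" by auto
  have "d \<le> N"
  proof (cases "d = 0")
    case False
    then have "coeff (B k0) d \<noteq> 0" using k0 leading_coeff_0_iff[of "B k0"] by auto
    then have "coeff (col d) (M - k0) \<noteq> 0" using k0 by (simp add: coeff_column_poly)
    then have nz: "col d \<noteq> 0" by auto
    have "top_poly dvd col d"
      unfolding top_poly_def by (intro linear_power_prod_dvd z_inj linear_power_dvd_top d) auto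
    then have "M \<le> degree (col d)" using nz degree_top_poly(1) dvd_imp_degree_le by metis
    then have "degree (col d) = M" using degree_col[of d] by simp
    then have "coeff (col d) M \<noteq> 0" using nz by (metis leading_coeff_0_iff)
    then have "coeff (B 0) d \<noteq> 0" by (simp add: coeff_column_poly)
    then show ?thesis unfolding N_eq by (rule le_degree)
  qed simp
  then show ?thesis using d[OF assms] by simp
qed

lemma col_top: "col N = top_poly"
proof -
  have "coeff (col N) M = 1" using monic by (simp add: coeff_column_poly N_eq)
  then have nz: "col N \<noteq> 0" by auto
  have "top_poly dvd col N"
    unfolding top_poly_def by (intro linear_power_prod_dvd z_inj linear_power_dvd_top degree_B) auto
  then obtain r where r: "col N = top_poly * r" by (rule dvdE)
  have "r \<noteq> 0" using r nz by auto
  then have "degree (col N) = M + degree r"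
    unfolding r using degree_top_poly by (subst degree_mult_eq) auto
  then have "degree r = 0" "degree (col N) = M" using degree_col[of N] by auto
  then obtain c where c: "r = [:c:]" by (metis degree_eq_zeroE)
  have "c = 1" using \<open>coeff (col N) M = 1\<close> r c degree_top_poly by simp
  then show ?thesis using r c by simp
qed

lemma coeff_last_nonzero: "coeff (B M) N \<noteq> 0"
proof -
  have "coeff (B M) N = poly (col N) 0"
    by (simp add: poly_0_coeff_0 coeff_column_poly)
  also have "\<dots> \<noteq> 0" unfolding col_top top_poly_def using z_nonzero by (auto simp: poly_prod)
  finally show ?thesis .
qed

definition cofactor_poly :: "nat \<Rightarrow> complex poly" where
  "cofactor_poly a = (\<Prod>a'\<in>{1..m} - {a}. [:- z a', 1:] ^ Ms a')"

lemma top_poly_split: "a \<in> {1..m} \<Longrightarrow> top_poly = [:- z a, 1:] ^ Ms a * cofactor_poly a"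
  unfolding top_poly_def cofactor_poly_def by (subst prod.remove[of _ a]) auto

lemma cofactor_poly_nonzero: "a \<in> {1..m} \<Longrightarrow> poly (cofactor_poly a) (z a) \<noteq> 0"
  by (auto simp: cofactor_poly_def poly_prod dest: inj_onD[OF z_inj])

text \<open>
  The indicial polynomial at \<open>z\<^sub>a\<close>. The same expression will appear as the indicial polynomial of the
  dual differential operator.
\<close>

definition indicial :: "nat \<Rightarrow> nat \<Rightarrow> complex" where
  "indicial a s = (\<Sum>k\<le>Ms a. indicial_coeff M B (z a) N (Ms a) k * of_nat (s choose k))"

lemma indicial_top:
  assumes a: "a \<in> {1..m}"
  shows "indicial_coeff M B (z a) N (Ms a) (Ms a) = fact (Ms a) * z a ^ Ms a * poly (cofactor_poly a) (z a)"
  unfolding indicial_coeff_def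
  by (simp only: add_diff_cancel_right' col_top top_poly_split[OF a] if_True le_add2 euler_power_leading)

lemma indicial_root:
  assumes a: "a \<in> {1..m}" and b: "b \<in> {1..Ms a}"
  shows "indicial a (ms a b) = 0"
proof -
  have low: "poly ((euler ^^ k) (col i)) (z a) = 0" if "e < Ms a" "i + e = N + k" for i k e
    using high_columns_vanish[OF a degree_B that] .
  show ?thesis
    unfolding indicial_def deg_q[OF a b, symmetric]
    by (rule indicial_equation[OF ann[OF a b] degree_B q_nonzero[OF a b] low])
qed

lemma indicial_zero_iff:
  assumes a: "a \<in> {1..m}"
  shows "indicial a s = 0 \<longleftrightarrow> s \<in> ms a ` {1..Ms a}"
proof
  have nz: "indicial_coeff M B (z a) N (Ms a) (Ms a) \<noteq> 0"
    using indicial_top[OF a] z_nonzero[OF a] cofactor_poly_nonzero[OF a] by simp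
  assume "indicial a s = 0"
  then show "s \<in> ms a ` {1..Ms a}"
    unfolding indicial_def
  proof (rule binomial_sum_factor(1)[where C = "indicial_coeff M B (z a) N (Ms a)", OF _ card_ms[OF a] _ nz, rotated 2])
    fix s assume "s \<in> ms a ` {1..Ms a}"
    then obtain b where "b \<in> {1..Ms a}" "s = ms a b" by blast
    then show "(\<Sum>k\<le>Ms a. indicial_coeff M B (z a) N (Ms a) k * of_nat (s choose k)) = 0"
      using indicial_root[OF a] unfolding indicial_def by blast
  qed simp_all
qed (use indicial_root[OF a] in auto)

text \<open>
  Otherwise the diagonal \<open>e = M\<^sub>a\<close> would start below \<open>p\<^sub>0\<close>, which would make \<open>0\<close> a root of
  the indicial polynomial; but all \<open>m\<^sub>a\<^sub>b\<close> are positive.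
\<close>

lemma Ms_le_N:
  assumes a: "a \<in> {1..m}"
  shows "Ms a \<le> N"
proof (rule ccontr)
  assume "\<not> ?thesis"
  then have "indicial_coeff M B (z a) N (Ms a) 0 = 0" by (simp add: indicial_coeff_def)
  moreover have "indicial a 0 = (\<Sum>k\<le>Ms a. if k = 0 then indicial_coeff M B (z a) N (Ms a) 0 else 0)"
    unfolding indicial_def by (intro sum.cong) auto
  ultimately have "indicial a 0 = 0" by simp
  then have "0 \<in> ms a ` {1..Ms a}" using indicial_zero_iff[OF a] by blast
  then obtain b where "b \<in> {1..Ms a}" "ms a b = 0" by auto
  then show False using ms_pos[OF a] by fastforce
qed

text \<open>
  This is \<open>\<Sum>\<^sub>b (m\<^sub>a\<^sub>b + 1 - b)\<close>.
\<close>

definition excess :: "nat \<Rightarrow> complex" where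
  "excess a = of_nat (\<Sum>b=1..Ms a. ms a b) - of_nat (Ms a * (Ms a - 1) div 2)"

text \<open>
  The sum of the roots of the indicial polynomial, read off from its two top coefficients; these are
  derivatives of \<open>p\<^sub>N\<close> and \<open>p\<^bsub>N-1\<^esub>\<close> at \<open>z\<^sub>a\<close>.
\<close>

lemma subleading_relation:
  assumes a: "a \<in> {1..m}"
  shows "poly ((euler ^^ (Ms a - 1)) (col (N - 1))) (z a) =
    - fact (Ms a - 1) * z a ^ Ms a * poly (cofactor_poly a) (z a) * excess a"
proof -
  have inj: "inj_on (ms a) {1..Ms a}" by (rule strict_mono_on_imp_inj_on[OF ms_mono[OF a]])
  have sum: "\<Sum>(ms a ` {1..Ms a}) = (\<Sum>b=1..Ms a. ms a b)"
    by (subst sum.reindex[OF inj]) (rule sum.cong[OF refl], rule o_apply)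
  have nz: "indicial_coeff M B (z a) N (Ms a) (Ms a) \<noteq> 0"
    using indicial_top[OF a] z_nonzero[OF a] cofactor_poly_nonzero[OF a] by simp
  have "indicial_coeff M B (z a) N (Ms a) (Ms a - 1) / fact (Ms a - 1) =
      - (indicial_coeff M B (z a) N (Ms a) (Ms a) / fact (Ms a)) * excess a"
    unfolding excess_def sum[symmetric]
  proof (rule binomial_sum_factor(2)[where C = "indicial_coeff M B (z a) N (Ms a)", OF _ card_ms[OF a] _ nz Ms_pos[OF a]])
    fix s assume "s \<in> ms a ` {1..Ms a}"
    then obtain b where "b \<in> {1..Ms a}" "s = ms a b" by blast
    then show "(\<Sum>k\<le>Ms a. indicial_coeff M B (z a) N (Ms a) k * of_nat (s choose k)) = 0"
      using indicial_root[OF a] unfolding indicial_def by blast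
  qed simp
  moreover have "indicial_coeff M B (z a) N (Ms a) (Ms a - 1) = poly ((euler ^^ (Ms a - 1)) (col (N - 1))) (z a)"
  proof -
    have "N + (Ms a - 1) - Ms a = N - 1" "Ms a \<le> N + (Ms a - 1)"
      using Ms_pos[OF a] Ms_le_N[OF a] by auto
    then show ?thesis unfolding indicial_coeff_def by simp
  qed
  ultimately show ?thesis unfolding indicial_top[OF a] by (simp add: field_simps)
qed

definition deflated :: "nat \<Rightarrow> complex poly" where
  "deflated a = [:- z a, 1:] ^ (Ms a - 1) * cofactor_poly a"

lemma top_poly_deflated:
  assumes a: "a \<in> {1..m}"
  shows "top_poly = [:- z a, 1:] * deflated a"
proof -
  obtain k where "Ms a = Suc k" using Ms_pos[OF a] gr0_implies_Suc by blast
  then have "[:- z a, 1:] ^ Ms a = [:- z a, 1:] * [:- z a, 1:] ^ (Ms a - 1)"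
    by (simp only: power_Suc diff_Suc_1)
  then show ?thesis unfolding top_poly_split[OF a] deflated_def by (simp only: mult.assoc)
qed

lemma deflated_dvd: "a \<in> {1..m} \<Longrightarrow> a' \<in> {1..m} \<Longrightarrow> a' \<noteq> a \<Longrightarrow> [:- z a, 1:] ^ Ms a dvd deflated a'"
  unfolding deflated_def cofactor_poly_def by (intro dvd_mult dvd_prodI) auto

text \<open>
  The partial fraction decomposition
  \<open>p\<^bsub>N-1\<^esub> / p\<^sub>N = b - \<Sum>\<^sub>a z\<^sub>a excess\<^sub>a / (x - z\<^sub>a)\<close>, in which \<open>deflated a\<close> is
  \<open>p\<^sub>N / (x - z\<^sub>a)\<close>. At \<open>z\<^sub>a\<close> the polynomial \<open>p\<^bsub>N-1\<^esub>\<close> vanishes to order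
  \<open>M\<^sub>a - 1\<close>, so the poles are simple, and \<open>subleading_relation\<close> gives the residues.
\<close>

lemma subleading_partial_fractions:
  "col (N - 1) = Polynomial.smult (coeff (col (N - 1)) M) top_poly
     - (\<Sum>a\<in>{1..m}. Polynomial.smult (z a * excess a) (deflated a))" (is "_ = ?R")
proof -
  define T where "T = col (N - 1) - Polynomial.smult (coeff (col (N - 1)) M) top_poly
     + (\<Sum>a\<in>{1..m}. Polynomial.smult (z a * excess a) (deflated a))"
  have dd: "degree (deflated a) < M" if a: "a \<in> {1..m}" for a
  proof -
    have "deflated a \<noteq> 0" using top_poly_deflated[OF a] degree_top_poly(3) by auto
    then have "M = 1 + degree (deflated a)"
      using degree_mult_eq[of "[:- z a, 1:]" "deflated a"] top_poly_deflated[OF a] degree_top_poly(1)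
      by (simp del: mult_pCons_left)
    then show ?thesis by simp
  qed
  (* T has degree less than M, but a root of order Ms a at every z a. *)
  have "T = 0"
  proof (rule ccontr)
    assume nz: "T \<noteq> 0"
    have "degree T \<le> M"
      unfolding T_def using degree_col dd degree_top_poly
      by (intro degree_add_le degree_diff_le degree_sum_le) (auto intro!: order_trans[OF degree_smult_le] less_imp_le)
    moreover have "coeff T M = 0"
      unfolding T_def using degree_top_poly dd by (simp add: coeff_sum coeff_eq_0)
    ultimately have dT: "degree T < M" using nz by (metis leading_coeff_0_iff le_neq_implies_less)
    have "Ms a \<le> Polynomial.order (z a) T" if a: "a \<in> {1..m}" for a
      using z_nonzero[OF a] nz
    proof (rule euler_power_root_order)
      fix k assume k: "k < Ms a"
      have top0: "poly ((euler ^^ k) top_poly) (z a) = 0"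
        using top_poly_split[OF a] k by (intro euler_power_dvd_root[of _ "Ms a"]) auto
      have "(\<Sum>a'\<in>{1..m}. poly ((euler ^^ k) (Polynomial.smult (z a' * excess a') (deflated a'))) (z a))
        = (\<Sum>a'\<in>{1..m}. if a' = a then z a * excess a * poly ((euler ^^ k) (deflated a)) (z a) else 0)"
        using deflated_dvd[OF a] k
        by (intro sum.cong refl) (auto simp: euler_power_linear intro!: euler_power_dvd_root[of _ "Ms a"])
      then have T: "poly ((euler ^^ k) T) (z a) = poly ((euler ^^ k) (col (N - 1))) (z a)
          + z a * excess a * poly ((euler ^^ k) (deflated a)) (z a)"
        using a unfolding T_def by (simp add: euler_power_linear poly_sum top0)
      show "poly ((euler ^^ k) T) (z a) = 0"
      proof (cases "k = Ms a - 1")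
        case True
        have "poly ((euler ^^ k) (deflated a)) (z a) = fact k * z a ^ k * poly (cofactor_poly a) (z a)"
          unfolding deflated_def True by (rule euler_power_leading)
        moreover have "z a ^ Ms a = z a * z a ^ k" using True k by (simp flip: power_Suc)
        ultimately show ?thesis
          using subleading_relation[OF a] unfolding T True[symmetric] by simp
      next
        case False
        then have "poly ((euler ^^ k) (deflated a)) (z a) = 0"
          using k unfolding deflated_def by (intro euler_power_dvd_root[of _ "Ms a - 1"]) auto
        moreover have "poly ((euler ^^ k) (col (N - 1))) (z a) = 0"
          using False k Ms_le_N[OF a] by (intro high_columns_vanish[OF a degree_B, of "Suc k"]) auto
        ultimately show ?thesis unfolding T by simp
      qed
    qed
    then have "M \<le> (\<Sum>a\<in>{1..m}. Polynomial.order (z a) T)"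
      unfolding M_eq rank_sum_def by (intro sum_mono) auto
    also have "\<dots> = (\<Sum>x\<in>z ` {1..m}. Polynomial.order x T)"
      using z_inj by (simp add: sum.reindex)
    also have "\<dots> \<le> (\<Sum>x | poly T x = 0. Polynomial.order x T)"
    proof (rule sum_mono2)
      show "finite {x. poly T x = 0}" using nz by (rule poly_roots_finite)
      show "z ` {1..m} \<subseteq> {x. poly T x = 0}"
        using \<open>\<And>a. a \<in> {1..m} \<Longrightarrow> Ms a \<le> Polynomial.order (z a) T\<close> Ms_pos nz
        by (fastforce simp: order_root)
    qed auto
    also have "\<dots> \<le> degree T" using nz by (rule sum_order_le_degree)
    finally show False using dT by simp
  qed
  then show ?thesis unfolding T_def by (simp add: algebra_simps)
qed

text \<open>
  Compare the values of \<open>p\<^bsub>N-1\<^esub> / p\<^sub>N\<close> at \<open>0\<close>, where the coefficients of \<open>B\<^sub>M\<close> appear, and at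
  infinity, where those of \<open>B\<^sub>0\<close> appear; the difference is the sum of the excesses.
\<close>

lemma fuchs_relation:
  assumes "N > 0"
  shows "coeff (B M) (N - 1) = coeff (B M) N * (coeff (B 0) (N - 1) + (\<Sum>a=1..m. excess a))"
proof -
  have d0: "- z a * poly (deflated a) 0 = poly top_poly 0" if "a \<in> {1..m}" for a
    using top_poly_deflated[OF that] by simp
  have "coeff (B M) (N - 1) = poly (col (N - 1)) 0" by (simp add: poly_0_coeff_0 coeff_column_poly)
  also have "\<dots> = coeff (col (N - 1)) M * poly top_poly 0 + (\<Sum>a\<in>{1..m}. excess a * (- z a * poly (deflated a) 0))"
    by (subst subleading_partial_fractions) (simp add: poly_sum sum_negf mult_ac)
  also have "(\<Sum>a\<in>{1..m}. excess a * (- z a * poly (deflated a) 0)) = (\<Sum>a\<in>{1..m}. excess a * poly top_poly 0)"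
    by (intro sum.cong refl) (simp only: d0)
  also have "\<dots> = poly top_poly 0 * (\<Sum>a\<in>{1..m}. excess a)"
    by (simp add: sum_distrib_left mult.commute)
  also have "poly top_poly 0 = coeff (B M) N"
    unfolding col_top[symmetric] by (simp add: poly_0_coeff_0 coeff_column_poly)
  also have "coeff (col (N - 1)) M = coeff (B 0) (N - 1)" by (simp add: coeff_column_poly)
  finally show ?thesis by (simp add: algebra_simps)
qed

end

section \<open>Orders of vanishing of Casorati determinants\<close>

definition vanishes_to :: "nat \<Rightarrow> complex \<Rightarrow> (complex \<Rightarrow> complex) \<Rightarrow> bool" where
  "vanishes_to d s F \<longleftrightarrow> (\<exists>h. h holomorphic_on UNIV \<and> (\<forall>u. F u = (u - s) ^ d * h u))"

lemma vanishes_toI: "h holomorphic_on UNIV \<Longrightarrow> (\<And>u. F u = (u - s) ^ d * h u) \<Longrightarrow> vanishes_to d s F"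
  unfolding vanishes_to_def by blast

lemma vanishes_to_0_iff: "vanishes_to 0 s F \<longleftrightarrow> F holomorphic_on UNIV"
proof
  assume "vanishes_to 0 s F"
  then obtain h where "h holomorphic_on UNIV" "\<And>u. F u = h u" unfolding vanishes_to_def by auto
  then show "F holomorphic_on UNIV" by (metis ext)
qed (auto intro!: vanishes_toI[of F])

lemma vanishes_to_mono:
  assumes "vanishes_to d s F" "d' \<le> d"
  shows "vanishes_to d' s F"
proof -
  obtain h where h: "h holomorphic_on UNIV" "\<And>u. F u = (u - s) ^ d * h u"
    using assms(1) unfolding vanishes_to_def by blast
  show ?thesis
    by (rule vanishes_toI[of "\<lambda>u. (u - s) ^ (d - d') * h u"])
       (use h assms(2) in \<open>auto intro!: holomorphic_intros simp flip: power_add mult.assoc\<close>)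
qed

lemma vanishes_to_holomorphic: "vanishes_to d s F \<Longrightarrow> F holomorphic_on UNIV"
  using vanishes_to_mono[of d s F 0] by (simp add: vanishes_to_0_iff)

lemma vanishes_to_zero: "vanishes_to d s (\<lambda>u. 0)"
  by (rule vanishes_toI[of "\<lambda>u. 0"]) auto

lemma vanishes_to_add:
  assumes "vanishes_to d s F" "vanishes_to d s G"
  shows "vanishes_to d s (\<lambda>u. F u + G u)"
proof -
  obtain h k where "h holomorphic_on UNIV" "\<And>u. F u = (u - s) ^ d * h u"
    "k holomorphic_on UNIV" "\<And>u. G u = (u - s) ^ d * k u"
    using assms unfolding vanishes_to_def by blast
  then show ?thesis
    by (intro vanishes_toI[of "\<lambda>u. h u + k u"]) (auto intro!: holomorphic_intros simp: algebra_simps)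
qed

lemma vanishes_to_mult:
  assumes "vanishes_to d s F" "vanishes_to e s G"
  shows "vanishes_to (d + e) s (\<lambda>u. F u * G u)"
proof -
  obtain h k where "h holomorphic_on UNIV" "\<And>u. F u = (u - s) ^ d * h u"
    "k holomorphic_on UNIV" "\<And>u. G u = (u - s) ^ e * k u"
    using assms unfolding vanishes_to_def by blast
  then show ?thesis
    by (intro vanishes_toI[of "\<lambda>u. h u * k u"]) (auto intro!: holomorphic_intros simp: power_add)
qed

lemma vanishes_to_sum:
  assumes "\<And>i. i \<in> A \<Longrightarrow> vanishes_to d s (F i)"
  shows "vanishes_to d s (\<lambda>u. \<Sum>i\<in>A. F i u)"
  using assms
  by (induction A rule: infinite_finite_induct) (auto intro: vanishes_to_zero vanishes_to_add)

lemma vanishes_to_1: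
  assumes "F holomorphic_on UNIV" "F s = 0"
  shows "vanishes_to 1 s F"
proof (rule vanishes_toI)
  show "(\<lambda>u. if u = s then deriv F s else (F u - F s) / (u - s)) holomorphic_on UNIV"
    using assms(1) by (intro pole_lemma) auto
qed (use assms in auto)

lemma vanishes_to_prod:
  assumes "finite A" "\<And>i. i \<in> A \<Longrightarrow> F i holomorphic_on UNIV"
  shows "vanishes_to (card {i \<in> A. F i s = 0}) s (\<lambda>u. \<Prod>i\<in>A. F i u)"
  using assms
proof (induction A rule: finite_induct)
  case empty
  then show ?case by (simp add: vanishes_to_0_iff)
next
  case (insert a A)
  have IH: "vanishes_to (card {i \<in> A. F i s = 0}) s (\<lambda>u. \<Prod>i\<in>A. F i u)" using insert by auto
  show ?case
  proof (cases "F a s = 0")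
    case True
    have "{i \<in> insert a A. F i s = 0} = insert a {i \<in> A. F i s = 0}" using True by auto
    then have "card {i \<in> insert a A. F i s = 0} = 1 + card {i \<in> A. F i s = 0}" using insert by simp
    then show ?thesis
      using vanishes_to_mult[OF vanishes_to_1[of "F a" s] IH] insert True by simp
  next
    case False
    then have "{i \<in> insert a A. F i s = 0} = {i \<in> A. F i s = 0}" by auto
    then show ?thesis
      using vanishes_to_mult[OF _ IH, of 0 "F a"] insert by (simp add: vanishes_to_0_iff)
  qed
qed

text \<open>
  In the Leibniz expansion every product that is not identically zero has at least \<open>d\<close> factors that
  vanish at \<open>s\<close>.
\<close>

lemma det_vanishes_to:
  fixes f :: "nat \<Rightarrow> nat \<Rightarrow> complex \<Rightarrow> complex"
  assumes hol: "\<And>i k. i < m \<Longrightarrow> k < m \<Longrightarrow> f i k holomorphic_on UNIV"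
    and d: "\<And>p. p permutes {0..<m} \<Longrightarrow>
      (\<exists>i<m. \<forall>u. f i (p i) u = 0) \<or> d \<le> card {i \<in> {0..<m}. f i (p i) s = 0}"
  shows "vanishes_to d s (\<lambda>u. Determinant.det (Matrix.mat m m (\<lambda>(i, k). f i k u)))"
proof -
  have eq: "Determinant.det (Matrix.mat m m (\<lambda>(i, k). f i k u)) =
      (\<Sum>p | p permutes {0..<m}. signof p * (\<Prod>i\<in>{0..<m}. f i (p i) u))" for u
    by (subst det_def'[of _ m]) (auto intro!: sum.cong prod.cong simp: permutes_in_image)
  show ?thesis unfolding eq
  proof (rule vanishes_to_sum)
    fix p assume "p \<in> {p. p permutes {0..<m}}"
    then have p: "p permutes {0..<m}" by simp
    show "vanishes_to d s (\<lambda>u. signof p * (\<Prod>i\<in>{0..<m}. f i (p i) u))"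
    proof (cases "\<exists>i<m. \<forall>u. f i (p i) u = 0")
      case True
      then obtain i where i: "i < m" "\<And>u. f i (p i) u = 0" by blast
      have "(\<Prod>i\<in>{0..<m}. f i (p i) u) = 0" for u using i by (intro prod_zero bexI[of _ i]) auto
      then have "(\<lambda>u. signof p * (\<Prod>i\<in>{0..<m}. f i (p i) u)) = (\<lambda>u. 0)" by (simp add: fun_eq_iff)
      then show ?thesis using vanishes_to_zero by simp
    next
      case False
      then have c: "d \<le> card {i \<in> {0..<m}. f i (p i) s = 0}" using d[OF p] by blast
      have "vanishes_to (card {i \<in> {0..<m}. f i (p i) s = 0}) s (\<lambda>u. \<Prod>i\<in>{0..<m}. f i (p i) u)"
        using hol permutes_in_image[OF p] by (intro vanishes_to_prod) auto
      then have "vanishes_to d s (\<lambda>u. \<Prod>i\<in>{0..<m}. f i (p i) u)" using c by (rule vanishes_to_mono)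
      from vanishes_to_mult[OF _ this, of 0 "\<lambda>_. signof p"] show ?thesis
        by (simp add: vanishes_to_0_iff)
    qed
  qed
qed

text \<open>
  Apart from the columns in \<open>J'\<close>, an injective choice of columns has to leave \<open>J\<close>.
\<close>

lemma card_permutes_avoid:
  assumes "finite I" "finite J" "inj_on p I" "p ` I \<inter> J \<subseteq> J'" "J' \<subseteq> J"
  shows "card I - card J' \<le> card {i \<in> I. p i \<notin> J}"
proof -
  have "card {i \<in> I. p i \<in> J} \<le> card J'"
    using assms by (intro card_inj_on_le[of p]) (auto intro: finite_subset inj_on_subset)
  moreover have "card I = card {i \<in> I. p i \<in> J} + card {i \<in> I. p i \<notin> J}"
    using assms(1) by (subst card_Un_disjoint[symmetric]) (auto intro!: arg_cong[of _ _ card])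
  ultimately show ?thesis by linarith
qed

definition casorati :: "nat \<Rightarrow> (nat \<Rightarrow> complex \<Rightarrow> complex) \<Rightarrow> complex \<Rightarrow> complex Matrix.mat" where
  "casorati M g u = Matrix.mat M M (\<lambda>(i, k). g i (u + of_nat k))"

definition casoratian :: "nat \<Rightarrow> (nat \<Rightarrow> complex \<Rightarrow> complex) \<Rightarrow> complex \<Rightarrow> complex" where
  "casoratian M g u = Determinant.det (casorati M g u)"

definition casorati_cofactor :: "nat \<Rightarrow> (nat \<Rightarrow> complex \<Rightarrow> complex) \<Rightarrow> nat \<Rightarrow> nat \<Rightarrow> complex \<Rightarrow> complex" where
  "casorati_cofactor M g i k u = cofactor (casorati M g u) i k"

lemma casorati_carrier [simp]: "casorati M g u \<in> carrier_mat M M"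
  "dim_row (casorati M g u) = M" "dim_col (casorati M g u) = M"
  by (auto simp: casorati_def)

text \<open>
  As a determinant of the full size a cofactor is subject to \<open>det_vanishes_to\<close>, without any
  renumbering of rows and columns.
\<close>

lemma cofactor_unit_row:
  assumes A: "(A :: complex Matrix.mat) \<in> carrier_mat n n" and i: "i0 < n" and k: "k0 < n"
  shows "cofactor A i0 k0 = Determinant.det (Matrix.mat n n
    (\<lambda>(i, k). if i = i0 then (if k = k0 then 1 else 0) else A $$ (i, k)))"
proof -
  let ?B = "Matrix.mat n n (\<lambda>(i, k). if i = i0 then (if k = k0 then 1 else 0) else A $$ (i, k))"
  have "Determinant.det ?B = (\<Sum>j<n. ?B $$ (i0, j) * cofactor ?B i0 j)"
    by (rule laplace_expansion_row) (use i in auto)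
  also have "\<dots> = (\<Sum>j<n. if j = k0 then cofactor ?B i0 k0 else 0)"
    using i by (intro sum.cong) auto
  also have "\<dots> = cofactor ?B i0 k0" using k by simp
  also have "mat_delete ?B i0 k0 = mat_delete A i0 k0"
    using A i k unfolding mat_delete_def by (intro eq_matI) auto
  then have "cofactor ?B i0 k0 = cofactor A i0 k0" by (simp add: cofactor_def)
  finally show ?thesis by simp
qed

lemma sum_casorati_cofactor_column:
  assumes "j < M" "k < M"
  shows "(\<Sum>i<M. casorati_cofactor M g i j u * g i (u + of_nat k)) = (if j = k then casoratian M g u else 0)"
proof -
  have "(adj_mat (casorati M g u) * casorati M g u) $$ (j, k) =
      (casoratian M g u \<cdot>\<^sub>m 1\<^sub>m M) $$ (j, k)"
    by (simp only: adj_mat(3)[OF casorati_carrier(1)] casoratian_def)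
  moreover have "(adj_mat (casorati M g u) * casorati M g u) $$ (j, k) =
      (\<Sum>i<M. casorati_cofactor M g i j u * g i (u + of_nat k))"
    using assms by (simp add: adj_mat_def scalar_prod_def casorati_cofactor_def atLeast0LessThan)
       (simp add: casorati_def)
  ultimately show ?thesis using assms by simp
qed

lemma sum_casorati_cofactor_row:
  assumes "i < M" "i' < M"
  shows "(\<Sum>k<M. g i (u + of_nat k) * casorati_cofactor M g i' k u) = (if i = i' then casoratian M g u else 0)"
proof -
  have "(casorati M g u * adj_mat (casorati M g u)) $$ (i, i') =
      (casoratian M g u \<cdot>\<^sub>m 1\<^sub>m M) $$ (i, i')"
    by (simp only: adj_mat(2)[OF casorati_carrier(1)] casoratian_def)
  moreover have "(casorati M g u * adj_mat (casorati M g u)) $$ (i, i') =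
      (\<Sum>k<M. g i (u + of_nat k) * casorati_cofactor M g i' k u)"
    using assms by (simp add: adj_mat_def scalar_prod_def casorati_cofactor_def atLeast0LessThan)
       (simp add: casorati_def)
  ultimately show ?thesis using assms by simp
qed

text \<open>
  Deleting the last column at \<open>u + 1\<close> leaves the same columns as deleting the first one at \<open>u\<close>.
\<close>

lemma casorati_cofactor_shift:
  assumes "M > 0" "i < M"
  shows "casorati_cofactor M g i (M - 1) (u + 1) = (- 1) ^ (M - 1) * casorati_cofactor M g i 0 u"
proof -
  have "mat_delete (casorati M g (u + 1)) i (M - 1) = mat_delete (casorati M g u) i 0"
    unfolding mat_delete_def casorati_def
    using assms by (intro eq_matI) (auto simp: add_ac)
  then show ?thesis unfolding casorati_cofactor_def cofactor_def by (simp add: power_add)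
qed

lemma casoratian_change_of_basis:
  assumes "\<And>i u. i < M \<Longrightarrow> f i u = (\<Sum>k<M. C i k * g k u)"
  shows "casoratian M f u = Determinant.det (Matrix.mat M M (\<lambda>(i, k). C i k)) * casoratian M g u"
proof -
  have "casorati M f u = Matrix.mat M M (\<lambda>(i, k). C i k) * casorati M g u"
    using assms by (intro eq_matI)
      (auto simp: scalar_prod_def casorati_def atLeast0LessThan intro!: sum.cong)
  then show ?thesis unfolding casoratian_def by (simp add: det_mult[of _ M])
qed

lemma casoratian_exp_poly:
  assumes "\<And>i u. i < M \<Longrightarrow> g i u = exp (\<alpha> i * u) * poly (Q i) u"
  shows "\<exists>P. \<forall>u. casoratian M g u = exp ((\<Sum>i<M. \<alpha> i) * u) * poly P u"
proof -
  define P where "P = (\<Sum>p | p permutes {0..<M}. [:signof p:] *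
     (\<Prod>i\<in>{0..<M}. Polynomial.smult (exp (\<alpha> i * of_nat (p i))) (Q i \<circ>\<^sub>p [:of_nat (p i), 1:])))"
  have "casoratian M g u = exp ((\<Sum>i<M. \<alpha> i) * u) * poly P u" for u
  proof -
    have "casoratian M g u =
      (\<Sum>p | p permutes {0..<M}. signof p * (\<Prod>i\<in>{0..<M}. g i (u + of_nat (p i))))"
      unfolding casoratian_def by (subst det_def'[of _ M])
        (auto intro!: sum.cong prod.cong simp: permutes_in_image casorati_def)
    also have "\<dots> = (\<Sum>p | p permutes {0..<M}. exp ((\<Sum>i<M. \<alpha> i) * u) * (signof p * (\<Prod>i\<in>{0..<M}.
        exp (\<alpha> i * of_nat (p i)) * poly (Q i) (u + of_nat (p i)))))"
    proof (intro sum.cong refl)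
      fix p
      have "(\<Prod>i\<in>{0..<M}. g i (u + of_nat (p i))) =
          (\<Prod>i\<in>{0..<M}. exp (\<alpha> i * u) * (exp (\<alpha> i * of_nat (p i)) * poly (Q i) (u + of_nat (p i))))"
        using assms by (intro prod.cong) (auto simp: algebra_simps exp_add)
      also have "\<dots> = (\<Prod>i\<in>{0..<M}. exp (\<alpha> i * u)) *
          (\<Prod>i\<in>{0..<M}. exp (\<alpha> i * of_nat (p i)) * poly (Q i) (u + of_nat (p i)))"
        by (rule prod.distrib)
      also have "(\<Prod>i\<in>{0..<M}. exp (\<alpha> i * u)) = exp ((\<Sum>i<M. \<alpha> i) * u)"
        by (simp add: exp_sum sum_distrib_right atLeast0LessThan)
      finally show "signof p * (\<Prod>i\<in>{0..<M}. g i (u + of_nat (p i))) = exp ((\<Sum>i<M. \<alpha> i) * u) *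
        (signof p * (\<Prod>i\<in>{0..<M}. exp (\<alpha> i * of_nat (p i)) * poly (Q i) (u + of_nat (p i))))"
        by simp
    qed
    also have "\<dots> = exp ((\<Sum>i<M. \<alpha> i) * u) * poly P u"
      unfolding P_def poly_sum sum_distrib_left
      by (intro sum.cong refl) (simp add: poly_prod poly_pcompose add.commute)
    finally show ?thesis .
  qed
  then show ?thesis by blast
qed

lemma holomorphic_shift:
  assumes "F holomorphic_on UNIV" shows "(\<lambda>u. F (u + c)) holomorphic_on UNIV"
proof -
  have "(F \<circ> (\<lambda>u. u + c)) holomorphic_on UNIV"
    by (rule holomorphic_on_compose_gen[OF _ assms]) (auto intro!: holomorphic_intros)
  then show ?thesis by (simp add: o_def)
qed

text \<open>
  At \<open>s\<close> the rows \<open>I\<close> are supported in the columns \<open>J\<close>. A permutation can place at most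
  \<open>card J\<close> of these rows inside \<open>J\<close>, and each of the others contributes a zero.
\<close>

lemma casoratian_vanishes_to:
  assumes hol: "\<And>i. i < M \<Longrightarrow> g i holomorphic_on UNIV"
    and I: "I \<subseteq> {..<M}" and J: "J \<subseteq> {..<M}"
    and z: "\<And>i k. i \<in> I \<Longrightarrow> k < M \<Longrightarrow> k \<notin> J \<Longrightarrow> g i (s + of_nat k) = 0"
  shows "vanishes_to (card I - card J) s (casoratian M g)"
proof -
  have "vanishes_to (card I - card J) s (\<lambda>u. Determinant.det (Matrix.mat M M (\<lambda>(i, k). g i (u + of_nat k))))"
  proof (rule det_vanishes_to)
    fix p assume p: "p permutes {0..<M}"
    have fin: "finite I" "finite J" using I J finite_subset by blast+
    have "card I - card J \<le> card {i \<in> I. p i \<notin> J}"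
      using permutes_inj_on[OF p] fin by (intro card_permutes_avoid) auto
    also have "\<dots> \<le> card {i \<in> {0..<M}. g i (s + of_nat (p i)) = 0}"
      using I z permutes_in_image[OF p] by (intro card_mono) (auto simp: subset_iff)
    finally show "(\<exists>i<M. \<forall>u. g i (u + of_nat (p i)) = 0) \<or>
        card I - card J \<le> card {i \<in> {0..<M}. g i (s + of_nat (p i)) = 0}" ..
  qed (use hol holomorphic_shift in auto)
  then show ?thesis unfolding casoratian_def[abs_def] casorati_def .
qed

lemma casorati_cofactor_vanishes_to:
  assumes hol: "\<And>i. i < M \<Longrightarrow> g i holomorphic_on UNIV"
    and I: "I \<subseteq> {..<M}" and J: "J \<subseteq> {..<M}" and ik: "i0 < M" "k0 < M"
    and z: "\<And>i k. i \<in> I \<Longrightarrow> k < M \<Longrightarrow> k \<notin> J \<Longrightarrow> g i (s + of_nat k) = 0"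
  shows "vanishes_to (card (I - {i0}) - card (J - {k0})) s (casorati_cofactor M g i0 k0)"
proof -
  let ?f = "\<lambda>i k u. if i = i0 then (if k = k0 then 1 else 0) else g i (u + of_nat k)"
  let ?d = "card (I - {i0}) - card (J - {k0})"
  have "vanishes_to ?d s (\<lambda>u. Determinant.det (Matrix.mat M M (\<lambda>(i, k). ?f i k u)))"
  proof (rule det_vanishes_to)
    fix p assume p: "p permutes {0..<M}"
    have fin: "finite I" "finite J" using I J finite_subset by blast+
    show "(\<exists>i<M. \<forall>u. ?f i (p i) u = 0) \<or> ?d \<le> card {i \<in> {0..<M}. ?f i (p i) s = 0}"
    proof (cases "p i0 = k0")
      case False
      then show ?thesis using ik by auto
    next
      case True
      have "k0 \<notin> p ` (I - {i0})" using permutes_inj[OF p] True by (auto dest: injD)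
      then have "?d \<le> card {i \<in> I - {i0}. p i \<notin> J}"
        using permutes_inj_on[OF p] fin by (intro card_permutes_avoid) auto
      also have "\<dots> \<le> card {i \<in> {0..<M}. ?f i (p i) s = 0}"
        using I z permutes_in_image[OF p] by (intro card_mono) (auto simp: subset_iff)
      finally show ?thesis ..
    qed
  next
    fix i k assume "i < M" "k < M"
    then show "?f i k holomorphic_on UNIV"
      using hol[of i] holomorphic_shift[of "g i" "of_nat k"] by (cases "i = i0"; cases "k = k0") auto
  qed
  moreover have "casorati_cofactor M g i0 k0 = (\<lambda>u. Determinant.det (Matrix.mat M M (\<lambda>(i, k). ?f i k u)))"
    unfolding fun_eq_iff casorati_cofactor_def cofactor_unit_row[OF casorati_carrier(1) ik]
    by (intro allI arg_cong[of _ _ Determinant.det] eq_matI) (auto simp: casorati_def)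
  ultimately show ?thesis by (simp only:)
qed

section \<open>The Casoratian of a space of quasi-exponentials\<close>

lemma sum_functions_apply: "(\<Sum>v\<in>S. f v) u = (\<Sum>v\<in>S. f v u)"
  for f :: "'a \<Rightarrow> complex \<Rightarrow> complex"
  by (induction S rule: infinite_finite_induct) auto

lemma span_family:
  assumes "finite A"
  shows "cfun.span (f ` A) = {F. \<exists>x. F = (\<lambda>u. \<Sum>a\<in>A. x a * f a u)}"
proof (intro equalityI subsetI)
  fix F assume "F \<in> cfun.span (f ` A)"
  then show "F \<in> {F. \<exists>x. F = (\<lambda>u. \<Sum>a\<in>A. x a * f a u)}"
  proof (induction rule: cfun.span_induct_alt)
    case base
    show ?case by (auto intro!: exI[of _ "\<lambda>_. 0"] simp: fun_eq_iff)
  next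
    case (step c F G)
    then obtain a x where a: "a \<in> A" "F = f a" "G = (\<lambda>u. \<Sum>a\<in>A. x a * f a u)" by blast
    have "(\<lambda>u. c * F u) + G = (\<lambda>u. \<Sum>b\<in>A. ((if b = a then c else 0) + x b) * f b u)"
    proof
      fix u
      have "(\<Sum>b\<in>A. ((if b = a then c else 0) + x b) * f b u) =
          (\<Sum>b\<in>A. if b = a then c * f a u else 0) + (\<Sum>b\<in>A. x b * f b u)"
        unfolding sum.distrib[symmetric] by (intro sum.cong) (auto simp: algebra_simps)
      then show "((\<lambda>u. c * F u) + G) u = (\<Sum>b\<in>A. ((if b = a then c else 0) + x b) * f b u)"
        using a assms by simp
    qed
    then show ?case unfolding mem_Collect_eq by (rule exI[of _ "\<lambda>b. (if b = a then c else 0) + x b"])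
  qed
next
  fix F assume "F \<in> {F. \<exists>x. F = (\<lambda>u. \<Sum>a\<in>A. x a * f a u)}"
  then obtain x where F: "F = (\<lambda>u. \<Sum>a\<in>A. x a * f a u)" by blast
  have "F = (\<Sum>a\<in>A. (\<lambda>u. x a * f a u))" unfolding F by (simp add: fun_eq_iff sum_functions_apply)
  also have "\<dots> \<in> cfun.span (f ` A)"
    by (intro cfun.span_sum cfun.span_scale cfun.span_base) auto
  finally show "F \<in> cfun.span (f ` A)" .
qed

text \<open>
  A basis enumerated by \<open>{..<M}\<close>; linear combinations are then sums over an index.
\<close>

definition family_basis :: "nat \<Rightarrow> (nat \<Rightarrow> complex \<Rightarrow> complex) \<Rightarrow> (complex \<Rightarrow> complex) set \<Rightarrow> bool" where
  "family_basis M g W \<longleftrightarrow> W = {F. \<exists>x. F = (\<lambda>u. \<Sum>i<M. x i * g i u)} \<and>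
     (\<forall>x. (\<forall>u. (\<Sum>i<M. x i * g i u) = 0) \<longrightarrow> (\<forall>i<M. x i = 0))"

lemma family_basisD:
  assumes "family_basis M g W"
  shows "F \<in> W \<Longrightarrow> \<exists>x. F = (\<lambda>u. \<Sum>i<M. x i * g i u)"
    "(\<lambda>u. \<Sum>i<M. x i * g i u) \<in> W" "i < M \<Longrightarrow> g i \<in> W"
    "(\<And>u. (\<Sum>i<M. x i * g i u) = 0) \<Longrightarrow> i < M \<Longrightarrow> x i = 0"
proof -
  have comb: "(\<lambda>u. \<Sum>i<M. x i * g i u) \<in> W" for x
    using assms unfolding family_basis_def by blast
  then show "(\<lambda>u. \<Sum>i<M. x i * g i u) \<in> W" .
  show "F \<in> W \<Longrightarrow> \<exists>x. F = (\<lambda>u. \<Sum>i<M. x i * g i u)"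
    "(\<And>u. (\<Sum>i<M. x i * g i u) = 0) \<Longrightarrow> i < M \<Longrightarrow> x i = 0"
    using assms unfolding family_basis_def by blast+
  show "g i \<in> W" if "i < M"
  proof -
    have eq: "g i = (\<lambda>u. \<Sum>j<M. (if j = i then 1 else 0) * g j u)"
    proof
      fix u
      have "(\<Sum>j<M. (if j = i then 1 else 0) * g j u) = (\<Sum>j<M. if j = i then g i u else 0)"
        by (intro sum.cong) auto
      then show "g i u = (\<Sum>j<M. (if j = i then 1 else 0) * g j u)" using that by simp
    qed
    show ?thesis by (subst eq) (rule comb)
  qed
qed

lemma is_basis_family:
  assumes "is_basis fs W"
  shows "family_basis (length fs) (\<lambda>i. fs ! i) W"
proof -
  let ?M = "length fs"
  have d: "distinct fs" and ind: "cfun.independent (set fs)" and sp: "cfun.span (set fs) = W"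
    using assms unfolding is_basis_def by auto
  have set: "set fs = (\<lambda>i. fs ! i) ` {..<?M}" by (auto simp: set_conv_nth)
  have inj: "inj_on (\<lambda>i. fs ! i) {..<?M}" using d by (auto simp: inj_on_def nth_eq_iff_index_eq)
  have "W = {F. \<exists>x. F = (\<lambda>u. \<Sum>i<?M. x i * (fs ! i) u)}"
    unfolding sp[symmetric] set by (rule span_family) simp
  moreover have "x i = 0" if z: "\<forall>u. (\<Sum>i<?M. x i * (fs ! i) u) = 0" and i: "i < ?M" for x i
  proof -
    define c where "c v = x (inv_into {..<?M} (\<lambda>i. fs ! i) v)" for v
    have c: "c (fs ! i) = x i" if "i < ?M" for i
      unfolding c_def using inv_into_f_f[OF inj] that by simp
    have zero: "(\<Sum>v\<in>set fs. (\<lambda>u. c v * v u)) = 0"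
    proof
      fix u
      have "(\<Sum>v\<in>set fs. (\<lambda>u. c v * v u)) u = (\<Sum>v\<in>set fs. c v * v u)" by (rule sum_functions_apply)
      also have "\<dots> = (\<Sum>i<?M. c (fs ! i) * (fs ! i) u)"
        unfolding set by (subst sum.reindex[OF inj]) (simp add: o_def)
      also have "\<dots> = (\<Sum>i<?M. x i * (fs ! i) u)" using c by (intro sum.cong) auto
      finally show "(\<Sum>v\<in>set fs. (\<lambda>u. c v * v u)) u = 0 u" using z by simp
    qed
    have "c (fs ! i) = 0"
      by (rule cfun.independentD[OF ind _ _ zero]) (use i in auto)
    then show ?thesis using c i by simp
  qed
  ultimately show ?thesis unfolding family_basis_def by blast
qed

lemma casoratian_zero_imp:
  assumes "casoratian M g u = 0"
  shows "\<exists>x. (\<exists>i<M. x i \<noteq> 0) \<and> (\<forall>k<M. (\<Sum>i<M. x i * g i (u + of_nat k)) = 0)"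
proof -
  let ?A = "transpose_mat (casorati M g u)"
  have A: "?A \<in> carrier_mat M M" by simp
  have "Determinant.det ?A = 0"
    using assms det_transpose[OF casorati_carrier(1)] by (simp add: casoratian_def)
  then obtain v where v: "v \<in> carrier_vec M" "v \<noteq> 0\<^sub>v M" "?A *\<^sub>v v = 0\<^sub>v M"
    using det_0_iff_vec_prod_zero_field[OF A] by blast
  have "\<exists>i<M. vec_index v i \<noteq> 0"
  proof (rule ccontr)
    assume "\<not> ?thesis"
    then have "v = 0\<^sub>v M" using v(1) by (intro eq_vecI) auto
    then show False using v(2) by simp
  qed
  moreover have "(\<Sum>i<M. vec_index v i * g i (u + of_nat k)) = 0" if "k < M" for k
  proof -
    have "0 = vec_index (?A *\<^sub>v v) k" using v(3) that by simp
    also have "\<dots> = (\<Sum>i<M. g i (u + of_nat k) * vec_index v i)"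
      using that v(1) by (simp add: scalar_prod_def atLeast0LessThan casorati_def)
    finally show ?thesis by (simp add: mult.commute)
  qed
  ultimately show ?thesis by blast
qed

lemma poly_nonzero_ray:
  fixes p :: "complex poly"
  assumes "p \<noteq> 0"
  shows "\<exists>u0. \<forall>k::nat. poly p (u0 + of_nat k) \<noteq> 0"
proof -
  have fin: "finite (Re ` {x. poly p x = 0})" using poly_roots_finite[OF assms] by simp
  obtain r where r: "\<And>x. poly p x = 0 \<Longrightarrow> Re x < r"
  proof -
    have "bdd_above (Re ` {x. poly p x = 0})" using fin by simp
    then obtain b where "\<And>x. poly p x = 0 \<Longrightarrow> Re x \<le> b" by (auto simp: bdd_above_def)
    then show ?thesis using that[of "b + 1"] by fastforce
  qed
  have "poly p (of_real r + of_nat k) \<noteq> 0" for k :: nat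
    using r[of "of_real r + of_nat k"] by force
  then show ?thesis by blast
qed

lemma zpow_shift:
  assumes "z \<noteq> 0" "z = rcis (cmod z) \<theta>"
  shows "zpow z \<theta> (u + of_nat k) = zpow z \<theta> u * z ^ k"
proof -
  let ?a = "of_real (ln (cmod z)) + \<i> * of_real \<theta> :: complex"
  have "exp ?a = of_real (cmod z) * cis \<theta>"
    using assms(1) by (simp add: exp_add cis_conv_exp exp_of_real)
  also have "\<dots> = z" using assms(2) by (simp add: rcis_def)
  finally have "exp ?a = z" .
  then have "exp (of_nat k * ?a) = z ^ k" by (simp add: exp_of_nat_mult)
  then show ?thesis by (simp add: zpow_def distrib_right exp_add)
qed

text \<open>
  The hypotheses on \<open>U\<close> together with its regularized operator. Non-degeneracy enters as \<open>numeric\<close> and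
  as the equality \<open>N_sum\<close> of the degree of \<open>B\<^sub>0\<close> with \<open>\<Sum>\<^sub>i N\<^sub>i\<close>; minimality of the
  degree of \<open>B\<^sub>0\<close> enters as \<open>no_common\<close>.
\<close>

locale bispectral_setup = annihilated_exponentials m M N Ms ms z B q
  for m M N :: nat and Ms :: "nat \<Rightarrow> nat" and ms :: "nat \<Rightarrow> nat \<Rightarrow> nat" and z :: "nat \<Rightarrow> complex"
    and B :: "nat \<Rightarrow> complex poly" and q :: "nat \<Rightarrow> nat \<Rightarrow> complex poly" +
  fixes n :: nat and Ns :: "nat \<Rightarrow> nat" and ns :: "nat \<Rightarrow> nat \<Rightarrow> nat" and l :: "nat \<Rightarrow> complex"
    and \<theta> :: "nat \<Rightarrow> real" and U :: "(complex \<Rightarrow> complex) set"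
  assumes z_arg: "\<And>a. a \<in> {1..m} \<Longrightarrow> z a = rcis (cmod (z a)) (\<theta> a)"
    and U_span: "U = cfun.span {\<lambda>u. zpow (z a) (\<theta> a) u * poly (q a b) u | a b.
                         a \<in> {1..m} \<and> b \<in> {1..Ms a}}"
    and l_distinct: "\<And>i j. i \<in> {1..n} \<Longrightarrow> j \<in> {1..n} \<Longrightarrow> i \<noteq> j \<Longrightarrow> l i - l j \<notin> \<int>"
    and incr_n: "increasing_positive n Ns ns"
    and N_sum: "N = rank_sum n Ns"
    and Ns_le: "\<And>i. i \<in> {1..n} \<Longrightarrow> Ns i \<le> M"
    and exps: "\<And>i. i \<in> {1..n} \<Longrightarrow> discrete_exponents U M (l i) (gap_exponents M (Ns i) (ns i))"
    and numeric: "numerically_nondegenerate m Ms ms n Ns ns"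
    and no_common: "\<And>s. \<exists>k\<le>M. poly (B k) s \<noteq> 0"
    and annU: "\<And>f u. f \<in> U \<Longrightarrow> (\<Sum>j\<le>M. poly (B (M - j)) u * f (u + of_nat j)) = 0"
begin

definition pair_index :: "nat \<Rightarrow> nat \<times> nat" where
  "pair_index = (SOME h. bij_betw h {..<M} (Sigma {1..m} (\<lambda>a. {1..Ms a})))"

lemma pair_index: "bij_betw pair_index {..<M} (Sigma {1..m} (\<lambda>a. {1..Ms a}))"
proof -
  have "card (Sigma {1..m} (\<lambda>a. {1..Ms a})) = M"
    by (simp add: M_eq rank_sum_def)
  moreover have "finite (Sigma {1..m} (\<lambda>a. {1..Ms a}))" by auto
  ultimately have "\<exists>h. bij_betw h {..<M} (Sigma {1..m} (\<lambda>a. {1..Ms a}))"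
    using ex_bij_betw_nat_finite[of "Sigma {1..m} (\<lambda>a. {1..Ms a})"] by (simp add: atLeast0LessThan)
  then show ?thesis unfolding pair_index_def by (rule someI_ex)
qed

definition quasi_exp :: "nat \<Rightarrow> complex \<Rightarrow> complex" where
  "quasi_exp k u = (case pair_index k of (a, b) \<Rightarrow> zpow (z a) (\<theta> a) u * poly (q a b) u)"

lemma U_family: "U = {F. \<exists>x. F = (\<lambda>u. \<Sum>k<M. x k * quasi_exp k u)}"
proof -
  let ?P = "Sigma {1..m} (\<lambda>a. {1..Ms a})"
  have "{\<lambda>u. zpow (z a) (\<theta> a) u * poly (q a b) u | a b. a \<in> {1..m} \<and> b \<in> {1..Ms a}}
    = (\<lambda>(a, b). \<lambda>u. zpow (z a) (\<theta> a) u * poly (q a b) u) ` ?P" by force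
  also have "\<dots> = (\<lambda>(a, b). \<lambda>u. zpow (z a) (\<theta> a) u * poly (q a b) u) ` (pair_index ` {..<M})"
    using pair_index by (simp add: bij_betw_def)
  also have "\<dots> = quasi_exp ` {..<M}"
    unfolding image_image quasi_exp_def[abs_def] by (intro image_cong refl) (auto split: prod.splits)
  finally show ?thesis unfolding U_span using span_family[of "{..<M}" quasi_exp] by simp
qed

lemma quasi_exp_form:
  assumes "k < M"
  obtains a Q where "a \<in> {1..m}" "\<And>u. quasi_exp k u = zpow (z a) (\<theta> a) u * poly Q u"
proof -
  obtain a b where ab: "pair_index k = (a, b)" by fastforce
  have "pair_index k \<in> Sigma {1..m} (\<lambda>a. {1..Ms a})"
    using pair_index assms by (auto simp: bij_betw_def)
  then show thesis using that[of a "q a b"] ab by (auto simp: quasi_exp_def)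
qed

lemma U_exp_poly:
  assumes "f \<in> U"
  shows "\<exists>P. \<forall>u. f u = (\<Sum>a\<in>{1..m}. zpow (z a) (\<theta> a) u * poly (P a) u)"
  using assms unfolding U_span
proof (induction rule: cfun.span_induct_alt)
  case base
  show ?case by (rule exI[of _ "\<lambda>_. 0"]) simp
next
  case (step c F G)
  obtain a b where a: "a \<in> {1..m}" "F = (\<lambda>u. zpow (z a) (\<theta> a) u * poly (q a b) u)"
    using step by blast
  obtain P where P: "\<And>u. G u = (\<Sum>a\<in>{1..m}. zpow (z a) (\<theta> a) u * poly (P a) u)" using step by blast
  have "((\<lambda>u. c * F u) + G) u = (\<Sum>a'\<in>{1..m}. zpow (z a') (\<theta> a') u *
      poly (P a' + (if a' = a then Polynomial.smult c (q a b) else 0)) u)" for u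
  proof -
    have "(\<Sum>a'\<in>{1..m}. zpow (z a') (\<theta> a') u * poly (P a' + (if a' = a then Polynomial.smult c (q a b) else 0)) u)
      = (\<Sum>a'\<in>{1..m}. zpow (z a') (\<theta> a') u * poly (P a') u) +
        (\<Sum>a'\<in>{1..m}. if a' = a then zpow (z a) (\<theta> a) u * (c * poly (q a b) u) else 0)"
      unfolding sum.distrib[symmetric] by (intro sum.cong) (auto simp: algebra_simps)
    then show ?thesis using a P by (simp add: mult_ac)
  qed
  then show ?case
    by (intro exI[of _ "\<lambda>a'. P a' + (if a' = a then Polynomial.smult c (q a b) else 0)"] allI)
qed

text \<open>
  On \<open>u0 + \<nat>\<close> an element of \<open>U\<close> is an exponential polynomial sequence with the distinct bases
  \<open>z\<^sub>a\<close>.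
\<close>

lemma U_vanish_on_ray:
  assumes f: "f \<in> U" and z0: "\<And>k::nat. f (u0 + of_nat k) = 0"
  shows "f = (\<lambda>u. 0)"
proof -
  obtain P where P: "\<And>u. f u = (\<Sum>a\<in>{1..m}. zpow (z a) (\<theta> a) u * poly (P a) u)"
    using U_exp_poly[OF f] by blast
  define P' where "P' a = Polynomial.smult (zpow (z a) (\<theta> a) u0) (P a \<circ>\<^sub>p [:u0, 1:])" for a
  have "(\<Sum>a\<in>{1..m}. z a ^ k * poly (P' a) (of_nat k)) = 0" for k
  proof -
    have "(\<Sum>a\<in>{1..m}. z a ^ k * poly (P' a) (of_nat k)) = f (u0 + of_nat k)"
      unfolding P using zpow_shift[OF z_nonzero z_arg]
      by (intro sum.cong) (auto simp: P'_def poly_pcompose)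
    then show ?thesis using z0 by simp
  qed
  then have z': "\<forall>a\<in>{1..m}. P' a = 0"
    by (intro exp_poly_independent[of _ z] z_inj z_nonzero) auto
  have "P a = 0" if "a \<in> {1..m}" for a
  proof -
    have "P a \<circ>\<^sub>p [:u0, 1:] = 0" using z' that by (auto simp: P'_def zpow_def)
    then show ?thesis by (rule pcompose_eq_0) simp
  qed
  then show ?thesis using P by (simp add: fun_eq_iff)
qed

lemma B0_nonzero: "B 0 \<noteq> 0" using monic by auto

text \<open>
  If \<open>W\<close> vanishes at \<open>u0\<close>, some nonzero \<open>f \<in> U\<close> vanishes at \<open>u0, \<dots>, u0 + M - 1\<close>. When \<open>B\<^sub>0\<close>
  has no root in \<open>u0 + \<nat>\<close>, the difference equation propagates the zeros to all of \<open>u0 + \<nat>\<close>.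
\<close>

lemma casoratian_nonzero:
  assumes g: "family_basis M g U"
  shows "\<exists>u. casoratian M g u \<noteq> 0"
proof -
  obtain u0 where u0: "\<And>k::nat. poly (B 0) (u0 + of_nat k) \<noteq> 0"
    using poly_nonzero_ray[OF B0_nonzero] by blast
  have "casoratian M g u0 \<noteq> 0"
  proof
    assume "casoratian M g u0 = 0"
    then obtain x where x: "\<exists>i<M. x i \<noteq> 0" "\<And>k. k < M \<Longrightarrow> (\<Sum>i<M. x i * g i (u0 + of_nat k)) = 0"
      using casoratian_zero_imp by blast
    define f where "f = (\<lambda>u. \<Sum>i<M. x i * g i u)"
    have fU: "f \<in> U" unfolding f_def by (rule family_basisD(2)[OF g])
    have "f (u0 + of_nat k) = 0" for k :: nat
    proof (induction k rule: less_induct)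
      case (less k)
      show ?case
      proof (cases "k < M")
        case True
        then show ?thesis using x(2) by (simp add: f_def)
      next
        case False
        define k' where "k' = k - M"
        have k: "k = k' + M" using False by (simp add: k'_def)
        have "0 = (\<Sum>j\<le>M. poly (B (M - j)) (u0 + of_nat k') * f (u0 + of_nat k' + of_nat j))"
          using annU[OF fU] by simp
        also have "\<dots> = (\<Sum>j\<le>M. if j = M then poly (B 0) (u0 + of_nat k') * f (u0 + of_nat k) else 0)"
        proof (intro sum.cong refl)
          fix j assume "j \<in> {..M}"
          then show "poly (B (M - j)) (u0 + of_nat k') * f (u0 + of_nat k' + of_nat j) =
            (if j = M then poly (B 0) (u0 + of_nat k') * f (u0 + of_nat k) else 0)"
            using less.IH[of "k' + j"] k by (cases "j = M") (auto simp: add.assoc)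
        qed
        finally show ?thesis using u0 by simp
      qed
    qed
    then have "f = (\<lambda>u. 0)" by (rule U_vanish_on_ray[OF fU])
    then have "(\<Sum>i<M. x i * g i u) = 0" for u by (simp add: f_def fun_eq_iff)
    then show False using family_basisD(4)[OF g, of x] x(1) by blast
  qed
  then show ?thesis by blast
qed

lemma casoratian_form_exists:
  "\<exists>\<alpha> P. \<forall>g. family_basis M g U \<longrightarrow> P \<noteq> 0 \<and> (\<exists>c. c \<noteq> 0 \<and> (\<forall>u. casoratian M g u = c * exp (\<alpha> * u) * poly P u))"
proof -
  have "\<exists>\<beta> Q. \<forall>k<M. \<forall>u. quasi_exp k u = exp (\<beta> k * u) * poly (Q k) u"
  proof -
    have "\<exists>\<beta> Q. \<forall>u. quasi_exp k u = exp (\<beta> * u) * poly Q u" if k: "k < M" for k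
    proof -
      obtain a Q where "a \<in> {1..m}" "\<And>u. quasi_exp k u = zpow (z a) (\<theta> a) u * poly Q u"
        using quasi_exp_form[OF k] by blast
      then show ?thesis
        by (intro exI[of _ "of_real (ln (cmod (z a))) + \<i> * of_real (\<theta> a)"] exI[of _ Q])
           (simp add: zpow_def mult.commute)
    qed
    then show ?thesis by metis
  qed
  then obtain \<beta> Q where "\<And>k u. k < M \<Longrightarrow> quasi_exp k u = exp (\<beta> k * u) * poly (Q k) u" by blast
  from casoratian_exp_poly[where M = M and g = quasi_exp and \<alpha> = \<beta> and Q = Q, OF this] obtain P
    where P: "\<And>u. casoratian M quasi_exp u = exp ((\<Sum>i<M. \<beta> i) * u) * poly P u" by blast
  show ?thesis
  proof (intro exI allI impI)
    fix g assume g: "family_basis M g U"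
    have "\<forall>i<M. \<exists>x. \<forall>u. g i u = (\<Sum>k<M. x k * quasi_exp k u)"
    proof (intro allI impI)
      fix i assume "i < M"
      then have "g i \<in> U" by (rule family_basisD(3)[OF g])
      then show "\<exists>x. \<forall>u. g i u = (\<Sum>k<M. x k * quasi_exp k u)" unfolding U_family by (auto simp: fun_eq_iff)
    qed
    then obtain C where C: "\<And>i u. i < M \<Longrightarrow> g i u = (\<Sum>k<M. C i k * quasi_exp k u)" by metis
    define c where "c = Determinant.det (Matrix.mat M M (\<lambda>(i, k). C i k))"
    have eq: "casoratian M g u = c * exp ((\<Sum>i<M. \<beta> i) * u) * poly P u" for u
      using casoratian_change_of_basis[of M g C quasi_exp u, OF C] P unfolding c_def by (simp add: mult.assoc)
    obtain u where "casoratian M g u \<noteq> 0" using casoratian_nonzero[OF g] by blast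
    then have "c \<noteq> 0" "P \<noteq> 0" using eq by auto
    then show "P \<noteq> 0 \<and> (\<exists>c. c \<noteq> 0 \<and> (\<forall>u. casoratian M g u = c * exp ((\<Sum>i<M. \<beta> i) * u) * poly P u))"
      using eq by blast
  qed
qed

text \<open>
  The polynomial part of the Casoratian. It is fixed once for all bases of \<open>U\<close>, whose Casoratians differ by
  constant factors.
\<close>

definition wronskian_poly :: "complex poly" where
  "wronskian_poly = (SOME P. \<exists>\<alpha>. \<forall>g. family_basis M g U \<longrightarrow> P \<noteq> 0 \<and>
     (\<exists>c. c \<noteq> 0 \<and> (\<forall>u. casoratian M g u = c * exp (\<alpha> * u) * poly P u)))"

lemma casoratian_form:
  assumes "family_basis M g U"
  obtains c \<alpha> where "c \<noteq> 0" "\<And>u. casoratian M g u = c * exp (\<alpha> * u) * poly wronskian_poly u"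
    "wronskian_poly \<noteq> 0"
proof -
  have "\<exists>P. \<exists>\<alpha>. \<forall>g. family_basis M g U \<longrightarrow> P \<noteq> 0 \<and>
     (\<exists>c. c \<noteq> 0 \<and> (\<forall>u. casoratian M g u = c * exp (\<alpha> * u) * poly P u))"
    using casoratian_form_exists by metis
  from someI_ex[OF this, folded wronskian_poly_def] assms show thesis using that by blast
qed

lemma U_holomorphic:
  assumes "f \<in> U" shows "f holomorphic_on UNIV"
proof -
  obtain P where P: "\<And>u. f u = (\<Sum>a\<in>{1..m}. zpow (z a) (\<theta> a) u * poly (P a) u)"
    using U_exp_poly[OF assms] by blast
  have "(\<lambda>u. \<Sum>a\<in>{1..m}. zpow (z a) (\<theta> a) u * poly (P a) u) holomorphic_on UNIV"
    unfolding zpow_def by (intro holomorphic_intros)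
  moreover have "f = (\<lambda>u. \<Sum>a\<in>{1..m}. zpow (z a) (\<theta> a) u * poly (P a) u)" using P by (rule ext)
  ultimately show ?thesis by simp
qed

text \<open>
  Cramer's rule for \<open>B\<^sub>k / B\<^sub>0\<close>, obtained from the equations \<open>D g\<^sub>i = 0\<close>; written without
  division, so that it can be used at the zeros of \<open>B\<^sub>0\<close> and of the Casoratian.
\<close>

lemma operator_cofactor_relation:
  assumes g: "\<And>i. i < M \<Longrightarrow> g i \<in> U" and j: "j < M"
  shows "poly (B (M - j)) u * casoratian M g u =
    - poly (B 0) u * (\<Sum>i<M. casorati_cofactor M g i j u * g i (u + of_nat M))"
proof -
  have "0 = (\<Sum>i<M. casorati_cofactor M g i j u * (\<Sum>k\<le>M. poly (B (M - k)) u * g i (u + of_nat k)))"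
    using annU g by simp
  also have "\<dots> = (\<Sum>k\<le>M. poly (B (M - k)) u * (\<Sum>i<M. casorati_cofactor M g i j u * g i (u + of_nat k)))"
    unfolding sum_distrib_left by (subst sum.swap) (simp add: mult_ac)
  also have "\<dots> = (\<Sum>k<M. poly (B (M - k)) u * (\<Sum>i<M. casorati_cofactor M g i j u * g i (u + of_nat k)))
      + poly (B 0) u * (\<Sum>i<M. casorati_cofactor M g i j u * g i (u + of_nat M))"
    by (simp add: lessThan_Suc_atMost[symmetric])
  also have "(\<Sum>k<M. poly (B (M - k)) u * (\<Sum>i<M. casorati_cofactor M g i j u * g i (u + of_nat k)))
     = (\<Sum>k<M. if k = j then poly (B (M - j)) u * casoratian M g u else 0)"
    using sum_casorati_cofactor_column[OF j] by (intro sum.cong) auto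
  finally show ?thesis using j by (simp add: eq_neg_iff_add_eq_0)
qed

text \<open>
  Abel's formula. Pair the equations \<open>D g\<^sub>i = 0\<close> with the cofactors of the last column at
  \<open>u + 1\<close>: only the terms with \<open>B\<^sub>0\<close> and \<open>B\<^sub>M\<close> survive.
\<close>

lemma casoratian_shift:
  assumes g: "\<And>i. i < M \<Longrightarrow> g i \<in> U" and M: "M > 0"
  shows "poly (B 0) u * casoratian M g (u + 1) = (- 1) ^ M * poly (B M) u * casoratian M g u"
proof -
  let ?c = "\<lambda>i. casorati_cofactor M g i (M - 1) (u + 1)"
  have "0 = (\<Sum>i<M. ?c i * (\<Sum>k\<le>M. poly (B (M - k)) u * g i (u + of_nat k)))"
    using annU g by simp
  also have "\<dots> = (\<Sum>k\<le>M. poly (B (M - k)) u * (\<Sum>i<M. ?c i * g i (u + of_nat k)))"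
    unfolding sum_distrib_left by (subst sum.swap) (simp add: mult_ac)
  also have "\<dots> = poly (B M) u * (\<Sum>i<M. ?c i * g i u)
      + (\<Sum>k<M. poly (B (M - Suc k)) u * (\<Sum>i<M. ?c i * g i (u + of_nat (Suc k))))"
    by (subst sum.atMost_shift) simp
  also have "(\<Sum>i<M. ?c i * g i u) = (- 1) ^ (M - 1) * (\<Sum>i<M. casorati_cofactor M g i 0 u * g i (u + of_nat 0))"
    unfolding sum_distrib_left using casorati_cofactor_shift[OF M] by (intro sum.cong) (auto simp: mult_ac)
  also have "(\<Sum>i<M. casorati_cofactor M g i 0 u * g i (u + of_nat 0)) = casoratian M g u"
    using sum_casorati_cofactor_column[of 0 M 0] M by simp
  also have "(\<Sum>k<M. poly (B (M - Suc k)) u * (\<Sum>i<M. ?c i * g i (u + of_nat (Suc k)))) =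
      (\<Sum>k<M. if k = M - 1 then poly (B 0) u * casoratian M g (u + 1) else 0)"
  proof (intro sum.cong refl)
    fix k assume k: "k \<in> {..<M}"
    have "(\<Sum>i<M. ?c i * g i (u + of_nat (Suc k))) = (if M - 1 = k then casoratian M g (u + 1) else 0)"
      using sum_casorati_cofactor_column[of "M - 1" M k g "u + 1"] k M by (simp add: add_ac)
    then show "poly (B (M - Suc k)) u * (\<Sum>i<M. ?c i * g i (u + of_nat (Suc k))) =
        (if k = M - 1 then poly (B 0) u * casoratian M g (u + 1) else 0)"
      using M by auto
  qed
  also have "\<dots> = poly (B 0) u * casoratian M g (u + 1)" using M by simp
  also have "(- 1) ^ (M - 1) = - ((- 1) ^ M :: complex)" using M by (cases M) auto
  finally show ?thesis by (simp add: algebra_simps)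
qed

end

section \<open>Degree and orders of the Casoratian\<close>

lemma holomorphic_eq_at:
  assumes "F holomorphic_on UNIV" "G holomorphic_on UNIV" "\<And>u. u \<noteq> s \<Longrightarrow> F u = G u"
  shows "F s = (G s :: complex)"
proof -
  have "isCont F s" "isCont G s"
    using assms(1,2) holomorphic_on_imp_continuous_on continuous_on_eq_continuous_at open_UNIV by blast+
  then have F: "(F \<longlongrightarrow> F s) (at s)" and G: "(G \<longlongrightarrow> G s) (at s)" by (auto simp: isCont_def)
  have "(F \<longlongrightarrow> G s) (at s)"
    by (rule Lim_transform_eventually[OF G]) (auto simp: eventually_at_filter assms(3))
  with F show ?thesis by (intro tendsto_unique[of "at s"]) auto
qed

definition exact_order :: "nat \<Rightarrow> complex \<Rightarrow> (complex \<Rightarrow> complex) \<Rightarrow> bool" where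
  "exact_order d s F \<longleftrightarrow> (\<exists>h. h holomorphic_on UNIV \<and> h s \<noteq> 0 \<and> (\<forall>u. F u = (u - s) ^ d * h u))"

lemma exact_order_poly:
  fixes P :: "complex poly"
  assumes "P \<noteq> 0" "c \<noteq> 0"
  shows "exact_order (Polynomial.order s P) s (\<lambda>u. c * exp (\<alpha> * u) * poly P u)"
proof -
  obtain Q where Q: "P = [:- s, 1:] ^ Polynomial.order s P * Q" "\<not> [:- s, 1:] dvd Q"
    using order_decomp[OF assms(1)] by blast
  have "poly Q s \<noteq> 0" using Q(2) by (simp add: poly_eq_0_iff_dvd)
  moreover have "poly P u = (u - s) ^ Polynomial.order s P * poly Q u" for u
    by (subst Q(1)) (simp add: poly_power)
  ultimately show ?thesis unfolding exact_order_def
    using assms(2)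
    by (intro exI[of _ "\<lambda>u. c * exp (\<alpha> * u) * poly Q u"]) (auto intro!: holomorphic_intros simp: mult_ac)
qed

text \<open>
  In this form a zero of \<open>F\<close> is inferred from the vanishing of \<open>F W\<close> without dividing functions.
\<close>

lemma exact_order_cancel:
  assumes W: "exact_order d s W" and F: "F holomorphic_on UNIV"
    and v: "vanishes_to (Suc d) s (\<lambda>u. F u * W u)"
  shows "F s = 0"
proof -
  obtain h where h: "h holomorphic_on UNIV" "h s \<noteq> 0" "\<And>u. W u = (u - s) ^ d * h u"
    using W unfolding exact_order_def by blast
  obtain k where k: "k holomorphic_on UNIV" "\<And>u. F u * W u = (u - s) ^ Suc d * k u"
    using v unfolding vanishes_to_def by blast
  have "F s * h s = (s - s) * k s"
  proof (rule holomorphic_eq_at[of "\<lambda>u. F u * h u" "\<lambda>u. (u - s) * k u"])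
    fix u assume "u \<noteq> s"
    have "(u - s) ^ d * (F u * h u) = (u - s) ^ d * ((u - s) * k u)"
      using k(2)[of u] h(3)[of u] by (simp add: mult_ac)
    then show "F u * h u = (u - s) * k u" using \<open>u \<noteq> s\<close> by simp
  qed (use F h k in \<open>auto intro!: holomorphic_intros\<close>)
  then show ?thesis using h(2) by simp
qed

lemma vanishes_to_le_exact:
  assumes "exact_order d s F" "vanishes_to e s F"
  shows "e \<le> d"
proof (rule ccontr)
  assume "\<not> e \<le> d"
  then have "vanishes_to (Suc d) s (\<lambda>u. 1 * F u)"
    using vanishes_to_mono[OF assms(2), of "Suc d"] by simp
  then have "(\<lambda>u::complex. 1::complex) s = 0"
    by (intro exact_order_cancel[OF assms(1)]) auto
  then show False by simp
qed

lemma coeff_shift_top: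
  fixes P :: "complex poly"
  assumes "degree P \<le> D"
  shows "coeff (P \<circ>\<^sub>p [:1, 1:]) D = coeff P D \<and>
    (D > 0 \<longrightarrow> coeff (P \<circ>\<^sub>p [:1, 1:]) (D - 1) = coeff P (D - 1) + of_nat D * coeff P D)"
  using assms
proof (induction D arbitrary: P)
  case 0
  then obtain c where "P = [:c:]" by (metis degree_eq_zeroE le_0_eq)
  then show ?case by simp
next
  case (Suc D)
  obtain a R where P: "P = pCons a R" by (cases P)
  have R: "degree R \<le> D" using Suc.prems unfolding P by (cases "R = 0") auto
  note IH = Suc.IH[OF R]
  have c: "coeff (P \<circ>\<^sub>p [:1, 1:]) k = coeff [:a:] k + coeff (R \<circ>\<^sub>p [:1, 1:]) k +
      (case k of 0 \<Rightarrow> 0 | Suc j \<Rightarrow> coeff (R \<circ>\<^sub>p [:1, 1:]) j)" for k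
    unfolding P by (simp add: pcompose_pCons coeff_pCons split: nat.splits)
  have "degree (R \<circ>\<^sub>p [:1, 1:]) \<le> D" using R by (simp add: degree_pcompose)
  then have z: "coeff (R \<circ>\<^sub>p [:1, 1:]) (Suc D) = 0" by (simp add: coeff_eq_0)
  show ?case
    using IH z unfolding c by (cases D) (auto simp: P algebra_simps)
qed

lemma coeff_mult_top:
  fixes P Q :: "complex poly"
  assumes "degree P \<le> a" "degree Q \<le> b"
  shows "coeff (P * Q) (a + b) = coeff P a * coeff Q b"
    "a > 0 \<Longrightarrow> coeff (P * Q) (a + b - 1) =
       coeff P (a - 1) * coeff Q b + coeff P a * (if b > 0 then coeff Q (b - 1) else 0)"
proof -
  have z: "coeff P i = 0" if "i > a" for i using that assms(1) by (simp add: coeff_eq_0)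
  have z': "coeff Q i = 0" if "i > b" for i using that assms(2) by (simp add: coeff_eq_0)
  have "coeff (P * Q) (a + b) = (\<Sum>i\<le>a + b. if i = a then coeff P a * coeff Q b else 0)"
    unfolding coeff_mult
  proof (intro sum.cong refl)
    fix i show "coeff P i * coeff Q (a + b - i) = (if i = a then coeff P a * coeff Q b else 0)"
      using z[of i] z'[of "a + b - i"] by (cases i a rule: linorder_cases) auto
  qed
  then show "coeff (P * Q) (a + b) = coeff P a * coeff Q b" by simp
  assume a: "a > 0"
  let ?r = "if b > 0 then coeff Q (b - 1) else 0"
  have "coeff (P * Q) (a + b - 1) = (\<Sum>i\<le>a + b - 1. (if i = a - 1 then coeff P (a - 1) * coeff Q b else 0)
      + (if i = a then coeff P a * ?r else 0))"
    unfolding coeff_mult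
  proof (intro sum.cong refl)
    fix i assume i: "i \<in> {..a + b - 1}"
    consider "i < a - 1" | "i = a - 1" | "i = a" | "i > a" using a by linarith
    then show "coeff P i * coeff Q (a + b - 1 - i) = (if i = a - 1 then coeff P (a - 1) * coeff Q b else 0)
      + (if i = a then coeff P a * ?r else 0)"
    proof cases
      case 1
      then show ?thesis using z'[of "a + b - 1 - i"] by auto
    next
      case 2
      then show ?thesis using a by auto
    next
      case 3
      then show ?thesis using a i by auto
    next
      case 4
      then show ?thesis using z[of i] a by auto
    qed
  qed
  also have "\<dots> = coeff P (a - 1) * coeff Q b + coeff P a * ?r"
    using a by (simp add: sum.distrib) auto
  finally show "coeff (P * Q) (a + b - 1) = coeff P (a - 1) * coeff Q b + coeff P a * ?r" .
qed

text \<open>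
  Comparing the top coefficients gives \<open>\<kappa>\<close>. In the next ones the shift of \<open>P\<close> contributes
  \<open>deg P\<close> times the leading coefficient, and all other contributions of \<open>P\<close> cancel.
\<close>

lemma difference_equation_degree:
  fixes P B0 BM :: "complex poly"
  assumes eq: "Polynomial.smult \<kappa> (B0 * (P \<circ>\<^sub>p [:1, 1:])) = BM * P"
    and P: "P \<noteq> 0" and B0: "degree B0 \<le> N" "coeff B0 N = 1" and BM: "degree BM \<le> N" and N: "N > 0"
  shows "coeff BM (N - 1) = coeff BM N * (coeff B0 (N - 1) + of_nat (degree P))"
proof -
  let ?D = "degree P" and ?S = "P \<circ>\<^sub>p [:1, 1:]"
  have S: "degree ?S \<le> ?D" by (simp add: degree_pcompose)
  have lc: "lead_coeff P \<noteq> 0" using P by simp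
  have "\<kappa> * (coeff B0 N * coeff ?S ?D) = coeff BM N * coeff P ?D"
    using coeff_mult_top(1)[OF B0(1) S] coeff_mult_top(1)[OF BM order_refl, of P]
      arg_cong[OF eq, of "\<lambda>p. coeff p (N + ?D)"] by simp
  then have \<kappa>: "\<kappa> = coeff BM N" using coeff_shift_top[of P ?D] lc B0(2) by simp
  have "\<kappa> * (coeff B0 (N - 1) * coeff ?S ?D + coeff B0 N * (if ?D > 0 then coeff ?S (?D - 1) else 0))
     = coeff BM (N - 1) * coeff P ?D + coeff BM N * (if ?D > 0 then coeff P (?D - 1) else 0)"
    using coeff_mult_top(2)[OF B0(1) S N] coeff_mult_top(2)[OF BM order_refl N, of P]
      arg_cong[OF eq, of "\<lambda>p. coeff p (N + ?D - 1)"] by simp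
  moreover have "coeff ?S ?D = coeff P ?D" "?D > 0 \<Longrightarrow> coeff ?S (?D - 1) = coeff P (?D - 1) + of_nat ?D * coeff P ?D"
    using coeff_shift_top[of P ?D] by auto
  ultimately have "coeff P ?D * (coeff BM N * (coeff B0 (N - 1) + of_nat ?D)) = coeff P ?D * coeff BM (N - 1)"
    unfolding \<kappa> B0(2) by (cases "?D > 0") (auto simp: algebra_simps)
  then show ?thesis using lc by simp
qed

text \<open>
  Lower bounds on the orders at the points \<open>pt a\<close> that already exhaust the degree are equalities, and
  there are no other roots.
\<close>

lemma orders_saturate:
  fixes P :: "complex poly"
  assumes P: "P \<noteq> 0" and A: "finite A" "inj_on pt A"
    and le: "\<And>a. a \<in> A \<Longrightarrow> \<omega> a \<le> Polynomial.order (pt a) P"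
    and sum: "degree P = (\<Sum>a\<in>A. \<omega> a)"
  shows "a \<in> A \<Longrightarrow> Polynomial.order (pt a) P = \<omega> a" "s \<notin> pt ` A \<Longrightarrow> poly P s \<noteq> 0"
proof -
  let ?o = "\<lambda>s. Polynomial.order s P"
  have bound: "(\<Sum>s\<in>X. ?o s) \<le> degree P" if "finite X" for X
  proof -
    have "(\<Sum>s\<in>X. ?o s) = (\<Sum>s\<in>X \<inter> {x. poly P x = 0}. ?o s)"
      using that by (intro sum.mono_neutral_right) (auto simp: order_root)
    also have "\<dots> \<le> (\<Sum>s | poly P s = 0. ?o s)"
      using poly_roots_finite[OF P] by (intro sum_mono2) auto
    also have "\<dots> \<le> degree P" by (rule sum_order_le_degree[OF P])
    finally show ?thesis .
  qed
  have re: "(\<Sum>s\<in>pt ` A. ?o s) = (\<Sum>a\<in>A. ?o (pt a))" using A by (simp add: sum.reindex)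
  have ge: "(\<Sum>a\<in>A. \<omega> a) \<le> (\<Sum>a\<in>A. ?o (pt a))" using le by (intro sum_mono) auto
  show "?o (pt a) = \<omega> a" if a: "a \<in> A"
  proof (rule ccontr)
    assume "?o (pt a) \<noteq> \<omega> a"
    then have "\<omega> a < ?o (pt a)" using le[OF a] by simp
    then have "(\<Sum>a\<in>A. \<omega> a) < (\<Sum>a\<in>A. ?o (pt a))"
      using le a A by (intro sum_strict_mono_ex1) auto
    then show False using bound[of "pt ` A"] re sum A by simp
  qed
  show "poly P s \<noteq> 0" if s: "s \<notin> pt ` A"
  proof
    assume "poly P s = 0"
    then have "?o s > 0" using P by (simp add: order_root)
    then show False using bound[of "insert s (pt ` A)"] re ge sum A s by simp
  qed
qed

context bispectral_setup
begin

abbreviation \<mu> :: "nat \<Rightarrow> complex" where "\<mu> i \<equiv> l i - of_nat (Ns i)"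

lemma ns_pos: "i \<in> {1..n} \<Longrightarrow> j \<in> {1..Ns i} \<Longrightarrow> 0 < ns i j"
  and ns_mono: "i \<in> {1..n} \<Longrightarrow> strict_mono_on {1..Ns i} (ns i)"
  and Ns_pos: "i \<in> {1..n} \<Longrightarrow> 0 < Ns i"
  using incr_n unfolding increasing_positive_def by blast+

lemma ns_inj: "i \<in> {1..n} \<Longrightarrow> inj_on (ns i) {1..Ns i}"
  using ns_mono strict_mono_on_imp_inj_on by blast

lemma ns_ge: assumes i: "i \<in> {1..n}" shows "j \<in> {1..Ns i} \<Longrightarrow> j \<le> ns i j"
  using index_le_strict_mono[OF ns_mono[OF i]] ns_pos[OF i] by blast

lemma ns_le_top: assumes i: "i \<in> {1..n}" and j: "j \<in> {1..Ns i}" shows "ns i j \<le> ns i (Ns i)"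
proof (cases "j = Ns i")
  case False
  then show ?thesis using ns_mono[OF i] j by (intro less_imp_le) (auto simp: strict_mono_on_def)
qed simp

definition large_count :: "nat \<Rightarrow> nat \<Rightarrow> nat" where
  "large_count i r = card {j \<in> {1..Ns i}. r \<le> ns i j}"

text \<open>
  The order of vanishing of the Casoratian at \<open>\<mu> i + r\<close> that is forced by the discrete exponents. The
  inner subtraction is truncated: beyond \<open>r = N\<^sub>i\<close> the weight counts the \<open>n\<^sub>i\<^sub>j \<ge> r\<close>.
\<close>

definition weight :: "nat \<Rightarrow> nat \<Rightarrow> nat" where
  "weight i r = large_count i r - (Ns i - r)"

text \<open>
  The subtraction in the definition of \<open>weight\<close> does not truncate, since \<open>n\<^sub>i\<^sub>j \<ge> j\<close>.
\<close>

lemma weight_add: assumes i: "i \<in> {1..n}" shows "weight i r + (Ns i - r) = large_count i r"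
proof -
  have "Ns i - r \<le> large_count i r"
  proof (cases "r = 0")
    case True
    then have "{j \<in> {1..Ns i}. r \<le> ns i j} = {1..Ns i}" by auto
    then show ?thesis unfolding large_count_def by (simp only:) simp
  next
    case False
    have "card {r..Ns i} \<le> large_count i r"
      unfolding large_count_def using ns_ge[OF i] False by (intro card_mono) (auto intro: order_trans)
    then show ?thesis by simp
  qed
  then show ?thesis by (simp add: weight_def)
qed

lemma large_count_step:
  assumes i: "i \<in> {1..n}"
  shows "large_count i r = large_count i (Suc r) + (if r \<in> ns i ` {1..Ns i} then 1 else 0)"
proof (cases "r \<in> ns i ` {1..Ns i}")
  case True
  then obtain j0 where j0: "j0 \<in> {1..Ns i}" "r = ns i j0" by blast
  have "{j \<in> {1..Ns i}. r \<le> ns i j} = insert j0 {j \<in> {1..Ns i}. Suc r \<le> ns i j}"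
    using j0 by (auto simp: Suc_le_eq le_less dest: inj_onD[OF ns_inj[OF i]])
  moreover have "j0 \<notin> {j \<in> {1..Ns i}. Suc r \<le> ns i j}" using j0 by auto
  ultimately show ?thesis using True unfolding large_count_def by (simp only:) simp
next
  case False
  then have "{j \<in> {1..Ns i}. r \<le> ns i j} = {j \<in> {1..Ns i}. Suc r \<le> ns i j}"
    by (auto simp: Suc_le_eq le_less)
  then show ?thesis using False unfolding large_count_def by (simp only:) simp
qed

text \<open>
  The weight drops after each \<open>n\<^sub>i\<^sub>j\<close> and grows after each \<open>r < N\<^sub>i\<close>; these are going to be the
  roots of \<open>B\<^sub>0\<close> and of \<open>B\<^sub>M\<close> on the string.
\<close>

lemma weight_step:
  assumes i: "i \<in> {1..n}"
  shows "weight i (Suc r) + (if r \<in> ns i ` {1..Ns i} then 1 else 0) = weight i r + (if r < Ns i then 1 else 0)"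
  using weight_add[OF i, of r] weight_add[OF i, of "Suc r"] large_count_step[OF i, of r]
  by (cases "r < Ns i") auto

lemma weight_0: "weight i 0 = 0"
proof -
  have "{j \<in> {1..Ns i}. 0 \<le> ns i j} = {1..Ns i}" by auto
  then show ?thesis unfolding weight_def large_count_def by (simp only:) simp
qed

lemma weight_beyond_top: assumes i: "i \<in> {1..n}" and r: "r > ns i (Ns i)" shows "weight i r = 0"
proof -
  have "{j \<in> {1..Ns i}. r \<le> ns i j} = {}" using ns_le_top[OF i] r by fastforce
  then show ?thesis unfolding weight_def large_count_def by (simp only:) simp
qed

text \<open>
  Count the pairs \<open>(r, j)\<close> with \<open>1 \<le> r \<le> n\<^sub>i\<^sub>j\<close> in both orders.
\<close>

lemma weight_sum:
  assumes i: "i \<in> {1..n}"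
  shows "int (\<Sum>r=1..ns i (Ns i). weight i r) = (\<Sum>j=1..Ns i. int (ns i j) + 1 - int j)"
proof -
  let ?R = "ns i (Ns i)"
  have R: "Ns i \<le> ?R" using ns_ge[OF i, of "Ns i"] Ns_pos[OF i] by simp
  have "(\<Sum>r=1..?R. large_count i r) = (\<Sum>r=1..?R. \<Sum>j=1..Ns i. if r \<le> ns i j then 1 else 0)"
    unfolding large_count_def by (intro sum.cong refl) (simp only: card_eq_sum sum.inter_filter[OF finite_atLeastAtMost])
  also have "\<dots> = (\<Sum>j=1..Ns i. \<Sum>r=1..?R. if r \<le> ns i j then 1 else 0)" by (rule sum.swap)
  also have "\<dots> = (\<Sum>j=1..Ns i. ns i j)"
  proof (intro sum.cong refl)
    fix j assume j: "j \<in> {1..Ns i}"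
    have "{1..?R} \<inter> {r. r \<le> ns i j} = {1..ns i j}" using ns_le_top[OF i j] by auto
    then show "(\<Sum>r=1..?R. if r \<le> ns i j then 1 else 0) = ns i j" by (simp add: sum.If_cases)
  qed
  finally have 1: "(\<Sum>r=1..?R. large_count i r) = (\<Sum>j=1..Ns i. ns i j)" .
  have "(\<Sum>r=1..?R. Ns i - r) = (\<Sum>r=1..Ns i. Ns i - r)"
    using R by (intro sum.mono_neutral_right) auto
  also have "\<dots> = (\<Sum>j=1..Ns i. j - 1)"
    by (subst sum.atLeastAtMost_rev) (auto intro!: sum.cong)
  finally have 2: "(\<Sum>r=1..?R. Ns i - r) = (\<Sum>j=1..Ns i. j - 1)" .
  have "(\<Sum>r=1..?R. weight i r) + (\<Sum>r=1..?R. Ns i - r) = (\<Sum>r=1..?R. large_count i r)"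
    unfolding sum.distrib[symmetric] using weight_add[OF i] by simp
  then have "int (\<Sum>r=1..?R. weight i r) + (\<Sum>j=1..Ns i. int (j - 1)) = (\<Sum>j=1..Ns i. int (ns i j))"
    unfolding 1 2 by (metis of_nat_add of_nat_sum)
  moreover have "(\<Sum>j=1..Ns i. int (ns i j) + 1 - int j) = (\<Sum>j=1..Ns i. int (ns i j)) - (\<Sum>j=1..Ns i. int (j - 1))"
    unfolding sum_subtractf[symmetric] by (intro sum.cong) (auto simp: of_nat_diff)
  ultimately show ?thesis by simp
qed

text \<open>
  A basis of \<open>U\<close> that realises the discrete exponents at \<open>l i\<close>.
\<close>

definition adapted :: "nat \<Rightarrow> (nat \<Rightarrow> complex \<Rightarrow> complex) \<Rightarrow> bool" where
  "adapted i g \<longleftrightarrow> family_basis M g U \<and>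
     (\<forall>k<M. \<forall>j<gap_exponents M (Ns i) (ns i) (Suc k). g k (l i + of_nat j) = 0)"

lemma adapted_exists:
  assumes "i \<in> {1..n}" shows "\<exists>g. adapted i g"
proof -
  obtain fs where fs: "is_basis fs U" "length fs = M"
      "\<And>k. k \<in> {1..M} \<Longrightarrow> (\<forall>j<gap_exponents M (Ns i) (ns i) k. (fs ! (k - 1)) (l i + of_nat j) = 0)"
    using exps[OF assms] unfolding discrete_exponents_def by blast
  have "adapted i (\<lambda>k. fs ! k)"
    unfolding adapted_def using is_basis_family[OF fs(1)] fs(2) fs(3)[of "Suc k" for k] by auto
  then show ?thesis by blast
qed

text \<open>
  The elements of an adapted basis whose zeros \<open>l i, l i + 1, \<dots>\<close> reach up to
  \<open>\<mu> i + r + M - 1\<close>, the last point of the Casorati matrix at \<open>\<mu> i + r\<close>. In these rows only the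
  first \<open>N\<^sub>i - r\<close> columns can be nonzero there.
\<close>

definition vanishing_rows :: "nat \<Rightarrow> nat \<Rightarrow> nat set" where
  "vanishing_rows i r = {k \<in> {..<M}. M - Ns i + r \<le> gap_exponents M (Ns i) (ns i) (Suc k)}"

lemma card_vanishing_rows:
  assumes i: "i \<in> {1..n}"
  shows "card (vanishing_rows i r) = large_count i r"
proof -
  define e where "e = M - Ns i"
  have mem: "k \<in> vanishing_rows i r \<longleftrightarrow> e \<le> k \<and> r \<le> ns i (Suc k - e)" if "k < M" for k
  proof (cases "Suc k \<le> e")
    case True
    then show ?thesis using that by (simp add: vanishing_rows_def gap_exponents_def e_def[symmetric])
  next
    case False
    then show ?thesis using that by (simp add: vanishing_rows_def gap_exponents_def e_def[symmetric])
  qed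
  have sub: "vanishing_rows i r \<subseteq> {..<M}" by (auto simp: vanishing_rows_def)
  have M_e: "M = e + Ns i" using Ns_le[OF i] by (simp add: e_def)
  have "vanishing_rows i r = (\<lambda>j. e + j - 1) ` {j \<in> {1..Ns i}. r \<le> ns i j}"
  proof (intro equalityI subsetI)
    fix k assume k: "k \<in> vanishing_rows i r"
    then have kM: "k < M" using sub by blast
    have "e \<le> k" "r \<le> ns i (Suc k - e)" using mem[OF kM] k by auto
    moreover have "Suc k - e \<in> {1..Ns i}" "k = e + (Suc k - e) - 1" using kM M_e \<open>e \<le> k\<close> by auto
    ultimately show "k \<in> (\<lambda>j. e + j - 1) ` {j \<in> {1..Ns i}. r \<le> ns i j}" by blast
  next
    fix k assume "k \<in> (\<lambda>j. e + j - 1) ` {j \<in> {1..Ns i}. r \<le> ns i j}"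
    then obtain j where j: "j \<in> {1..Ns i}" "r \<le> ns i j" "k = e + j - 1" by blast
    then have "k < M" "e \<le> k" "Suc k - e = j" using M_e by auto
    then show "k \<in> vanishing_rows i r" using mem j(2) by simp
  qed
  moreover have "inj_on (\<lambda>j. e + j - 1) {j \<in> {1..Ns i}. r \<le> ns i j}" by (auto simp: inj_on_def)
  ultimately show ?thesis unfolding large_count_def by (simp only: card_image)
qed

text \<open>
  The second claim goes one point beyond the Casorati matrix; there a zero is missing only if some
  element vanishes up to exactly \<open>\<mu> i + r + M - 1\<close>, that is if \<open>r\<close> is one of the \<open>n\<^sub>i\<^sub>j\<close>.
\<close>

lemma adapted_vanishing:
  assumes i: "i \<in> {1..n}" and g: "adapted i g" and k: "k \<in> vanishing_rows i r"
  shows "k' < M \<Longrightarrow> Ns i \<le> r + k' \<Longrightarrow> g k (\<mu> i + of_nat r + of_nat k') = 0"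
    "r \<notin> ns i ` {1..Ns i} \<Longrightarrow> g k (\<mu> i + of_nat r + of_nat M) = 0"
proof -
  have kM: "k < M" "M - Ns i + r \<le> gap_exponents M (Ns i) (ns i) (Suc k)"
    using k by (auto simp: vanishing_rows_def)
  (* Zeros are counted from l i, which is Ns i steps after the start of the string. *)
  have pt: "\<mu> i + of_nat r + of_nat k' = l i + of_nat (r + k' - Ns i)" if "Ns i \<le> r + k'" for k'
    using that by (simp add: of_nat_diff)
  show "g k (\<mu> i + of_nat r + of_nat k') = 0" if "k' < M" "Ns i \<le> r + k'"
  proof -
    have "r + k' - Ns i < gap_exponents M (Ns i) (ns i) (Suc k)"
      using kM(2) that Ns_le[OF i] by linarith
    then show ?thesis unfolding pt[OF that(2)] using g kM(1) unfolding adapted_def by blast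
  qed
  show "g k (\<mu> i + of_nat r + of_nat M) = 0" if r: "r \<notin> ns i ` {1..Ns i}"
  proof -
    have "M - Ns i + r \<noteq> gap_exponents M (Ns i) (ns i) (Suc k)"
    proof (cases "Suc k \<le> M - Ns i")
      case False
      have "Suc k - (M - Ns i) \<in> {1..Ns i}" using False kM(1) Ns_le[OF i] by auto
      then have "ns i (Suc k - (M - Ns i)) \<noteq> r" using r by blast
      then show ?thesis using False by (simp add: gap_exponents_def)
    qed (use kM in \<open>auto simp: gap_exponents_def\<close>)
    then have "r + M - Ns i < gap_exponents M (Ns i) (ns i) (Suc k)"
      using kM(2) Ns_le[OF i] by linarith
    moreover have "Ns i \<le> r + M" using Ns_le[OF i] by simp
    ultimately show ?thesis unfolding pt[OF \<open>Ns i \<le> r + M\<close>] using g kM(1) unfolding adapted_def by blast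
  qed
qed

lemma adapted_holomorphic: "adapted i g \<Longrightarrow> k < M \<Longrightarrow> g k holomorphic_on UNIV"
  using U_holomorphic family_basisD(3) unfolding adapted_def by blast

lemma adapted_casoratian_vanishes:
  assumes i: "i \<in> {1..n}" and g: "adapted i g"
  shows "vanishes_to (weight i r) (\<mu> i + of_nat r) (casoratian M g)"
proof -
  have "vanishes_to (card (vanishing_rows i r) - card {..<Ns i - r}) (\<mu> i + of_nat r) (casoratian M g)"
  proof (rule casoratian_vanishes_to)
    show "vanishing_rows i r \<subseteq> {..<M}" by (auto simp: vanishing_rows_def)
    show "{..<Ns i - r} \<subseteq> {..<M}" using Ns_le[OF i] by auto
    show "g k (\<mu> i + of_nat r + of_nat k') = 0"
      if "k \<in> vanishing_rows i r" "k' < M" "k' \<notin> {..<Ns i - r}" for k k'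
      using adapted_vanishing(1)[OF i g that(1,2)] that(3) by simp
  qed (use adapted_holomorphic[OF g] in auto)
  then show ?thesis by (simp add: card_vanishing_rows[OF i] weight_def)
qed

lemma adapted_cofactor_vanishes:
  assumes i: "i \<in> {1..n}" and g: "adapted i g" and j: "j < M" and k: "k < M"
  shows "vanishes_to (card (vanishing_rows i r - {k}) - (Ns i - r)) (\<mu> i + of_nat r) (casorati_cofactor M g k j)"
proof -
  let ?s = "\<mu> i + of_nat r" and ?I = "vanishing_rows i r" and ?J = "{..<Ns i - r}"
  have "vanishes_to (card (?I - {k}) - card (?J - {j})) ?s (casorati_cofactor M g k j)"
  proof (rule casorati_cofactor_vanishes_to)
    show "?I \<subseteq> {..<M}" by (auto simp: vanishing_rows_def)
    show "?J \<subseteq> {..<M}" using Ns_le[OF i] by auto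
    show "g k' (?s + of_nat k'') = 0" if "k' \<in> ?I" "k'' < M" "k'' \<notin> ?J" for k' k''
      using adapted_vanishing(1)[OF i g that(1,2)] that(3) by simp
  qed (use adapted_holomorphic[OF g] k j in auto)
  moreover have "card (?J - {j}) \<le> Ns i - r" using card_mono[of ?J "?J - {j}"] by auto
  ultimately show ?thesis by (elim vanishes_to_mono) simp
qed

end

section \<open>The roots of the leading and of the last coefficient\<close>

lemma roots_eq_of_simple_orders:
  fixes P :: "complex poly"
  assumes P: "P \<noteq> 0" and le: "\<And>s. Polynomial.order s P \<le> 1"
    and sub: "{s. poly P s = 0} \<subseteq> X" and X: "finite X" "card X \<le> degree P"
  shows "{s. poly P s = 0} = X"
proof -
  have "degree P = (\<Sum>s | poly P s = 0. Polynomial.order s P)"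
  proof -
    have "degree P = size (proots P)" by (simp add: size_proots_complex)
    also have "\<dots> = (\<Sum>s\<in>set_mset (proots P). count (proots P) s)" by (rule size_multiset_overloaded_eq)
    finally show ?thesis using P by simp
  qed
  also have "\<dots> \<le> (\<Sum>s | poly P s = 0. 1)" using le by (intro sum_mono) auto
  finally have "card X \<le> card {s. poly P s = 0}" using X by simp
  with card_mono[OF X(1) sub] have "card {s. poly P s = 0} = card X" by (rule le_antisym)
  then show ?thesis by (rule card_subset_eq[OF X(1) sub])
qed

context bispectral_setup
begin

lemma M_pos: "i \<in> {1..n} \<Longrightarrow> M > 0"
  using Ns_pos[of i] Ns_le[of i] by simp

lemma N_pos: assumes i: "i \<in> {1..n}" shows "N > 0"
proof -
  have "Ns i \<le> (\<Sum>i=1..n. Ns i)" using i by (intro member_le_sum) auto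
  then show ?thesis using Ns_pos[OF i] unfolding N_sum rank_sum_def by linarith
qed

lemma exact_order_casoratian:
  assumes "family_basis M g U"
  shows "exact_order (Polynomial.order s wronskian_poly) s (casoratian M g)"
proof -
  obtain c \<alpha> where "c \<noteq> 0" "\<And>u. casoratian M g u = c * exp (\<alpha> * u) * poly wronskian_poly u"
    "wronskian_poly \<noteq> 0" using casoratian_form[OF assms] by blast
  moreover from this(2) have "casoratian M g = (\<lambda>u. c * exp (\<alpha> * u) * poly wronskian_poly u)" by (rule ext)
  ultimately show ?thesis using exact_order_poly[of wronskian_poly c s \<alpha>] by simp
qed

lemma weight_le_order:
  assumes i: "i \<in> {1..n}"
  shows "weight i r \<le> Polynomial.order (\<mu> i + of_nat r) wronskian_poly"
proof -
  obtain g where g: "adapted i g" using adapted_exists[OF i] by blast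
  then have "family_basis M g U" by (simp add: adapted_def)
  from vanishes_to_le_exact[OF exact_order_casoratian[OF this] adapted_casoratian_vanishes[OF i g]]
  show ?thesis .
qed

lemma wronskian_difference_equation:
  assumes i: "i \<in> {1..n}"
  shows "\<exists>\<kappa>. \<kappa> \<noteq> 0 \<and> Polynomial.smult \<kappa> (B 0 * (wronskian_poly \<circ>\<^sub>p [:1, 1:])) = B M * wronskian_poly"
    "wronskian_poly \<noteq> 0"
proof -
  obtain g where g: "adapted i g" using adapted_exists[OF i] by blast
  then have gb: "family_basis M g U" by (simp add: adapted_def)
  then have gU: "\<And>i. i < M \<Longrightarrow> g i \<in> U" by (rule family_basisD(3))
  obtain c \<alpha> where c: "c \<noteq> 0" "\<And>u. casoratian M g u = c * exp (\<alpha> * u) * poly wronskian_poly u"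
    "wronskian_poly \<noteq> 0" using casoratian_form[OF gb] by blast
  show "wronskian_poly \<noteq> 0" by (rule c(3))
  define \<kappa> where "\<kappa> = (- 1) ^ M * exp \<alpha>"
  have sq: "(- 1) ^ M * (- 1) ^ M = (1 :: complex)" by (simp flip: power_add mult_2)
  have "poly (Polynomial.smult \<kappa> (B 0 * (wronskian_poly \<circ>\<^sub>p [:1, 1:]))) u = poly (B M * wronskian_poly) u" for u
  proof -
    have "c * exp (\<alpha> * u) * (exp \<alpha> * (poly (B 0) u * poly wronskian_poly (1 + u)))
       = c * exp (\<alpha> * u) * ((- 1) ^ M * poly (B M) u * poly wronskian_poly u)"
      using casoratian_shift[where g = g and u = u, OF gU M_pos[OF i]]
      unfolding c(2) by (simp add: distrib_left exp_add mult_ac add.commute)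
    then have "exp \<alpha> * (poly (B 0) u * poly wronskian_poly (1 + u)) = (- 1) ^ M * poly (B M) u * poly wronskian_poly u"
      using c(1) by simp
    then have "(- 1) ^ M * (exp \<alpha> * (poly (B 0) u * poly wronskian_poly (1 + u)))
        = ((- 1) ^ M * (- 1) ^ M) * (poly (B M) u * poly wronskian_poly u)" by (simp add: mult_ac)
    then show ?thesis unfolding sq by (simp add: \<kappa>_def poly_pcompose mult_ac)
  qed
  then have "Polynomial.smult \<kappa> (B 0 * (wronskian_poly \<circ>\<^sub>p [:1, 1:])) = B M * wronskian_poly"
    by (simp add: poly_eq_poly_eq_iff[symmetric] fun_eq_iff)
  then show "\<exists>\<kappa>. \<kappa> \<noteq> 0 \<and> Polynomial.smult \<kappa> (B 0 * (wronskian_poly \<circ>\<^sub>p [:1, 1:])) = B M * wronskian_poly"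
    by (intro exI[of _ \<kappa>]) (auto simp: \<kappa>_def)
qed

lemma excess_eq: "excess a = of_int (\<Sum>b=1..Ms a. int (ms a b) + 1 - int b)"
proof -
  have "(\<Sum>b=1..k. int b - 1) = int (k * (k - 1) div 2)" for k
  proof (induction k)
    case (Suc k)
    have "Suc k * (Suc k - 1) div 2 = k * (k - 1) div 2 + k"
      by (cases k) (auto simp: algebra_simps)
    then show ?case using Suc by simp
  qed simp
  moreover have "(\<Sum>b=1..Ms a. int (ms a b) + 1 - int b) = int (\<Sum>b=1..Ms a. ms a b) - (\<Sum>b=1..Ms a. int b - 1)"
    by (simp add: sum_subtractf sum.distrib)
  ultimately show ?thesis by (simp add: excess_def)
qed

text \<open>
  The Fuchs relation and the difference equation of the Casoratian express the same two coefficients of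
  \<open>B\<^sub>M\<close>, so the degree is the sum of the excesses. Numerical non-degeneracy turns it into the sum of the
  weights.
\<close>

lemma degree_wronskian_poly:
  assumes i: "i \<in> {1..n}"
  shows "degree wronskian_poly = (\<Sum>i=1..n. \<Sum>r=1..ns i (Ns i). weight i r)"
proof -
  obtain \<kappa> where "Polynomial.smult \<kappa> (B 0 * (wronskian_poly \<circ>\<^sub>p [:1, 1:])) = B M * wronskian_poly"
    using wronskian_difference_equation(1)[OF i] by blast
  then have "coeff (B M) (N - 1) = coeff (B M) N * (coeff (B 0) (N - 1) + of_nat (degree wronskian_poly))"
    using wronskian_difference_equation(2)[OF i]
    by (rule difference_equation_degree) (use degree_B monic N_eq N_pos[OF i] in auto)
  then have "of_nat (degree wronskian_poly) = (\<Sum>a=1..m. excess a)"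
    using fuchs_relation[OF N_pos[OF i]] coeff_last_nonzero by simp
  also have "\<dots> = of_int (\<Sum>a=1..m. \<Sum>b=1..Ms a. int (ms a b) + 1 - int b)"
    by (simp add: excess_eq)
  also have "(\<Sum>a=1..m. \<Sum>b=1..Ms a. int (ms a b) + 1 - int b) = (\<Sum>i=1..n. \<Sum>j=1..Ns i. int (ns i j) + 1 - int j)"
    using numeric unfolding numerically_nondegenerate_def .
  also have "\<dots> = (\<Sum>i=1..n. int (\<Sum>r=1..ns i (Ns i). weight i r))"
    using weight_sum by (intro sum.cong refl) simp
  also have "\<dots> = int (\<Sum>i=1..n. \<Sum>r=1..ns i (Ns i). weight i r)" by simp
  finally have "(of_nat (degree wronskian_poly) :: complex) = of_nat (\<Sum>i=1..n. \<Sum>r=1..ns i (Ns i). weight i r)"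
    by (simp only: of_int_of_nat_eq)
  then show ?thesis by (simp only: of_nat_eq_iff)
qed

lemma string_inj:
  assumes "i \<in> {1..n}" "j \<in> {1..n}" "\<mu> i + of_nat r = \<mu> j + of_nat r'"
  shows "i = j \<and> r = r'"
proof -
  have "l i - l j = of_int (int (Ns i) - int r - int (Ns j) + int r')"
    using assms(3) by (simp add: algebra_simps)
  then have "l i - l j \<in> \<int>" by (metis Ints_of_int)
  then have "i = j" using l_distinct assms(1,2) by blast
  then show ?thesis using assms(3) by simp
qed

text \<open>
  The orders forced on the strings already add up to the degree.
\<close>

lemma wronskian_orders:
  assumes i: "i \<in> {1..n}"
  shows "Polynomial.order (\<mu> i + of_nat r) wronskian_poly = weight i r"
    "(\<And>i r. i \<in> {1..n} \<Longrightarrow> s \<noteq> \<mu> i + of_nat r) \<Longrightarrow> poly wronskian_poly s \<noteq> 0"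
proof -
  let ?A = "Sigma {1..n} (\<lambda>i. {1..ns i (Ns i)})" and ?pt = "\<lambda>(i, r). \<mu> i + of_nat r"
  have inj: "inj_on ?pt ?A"
  proof (rule inj_onI)
    fix a b assume ab: "a \<in> ?A" "b \<in> ?A" "?pt a = ?pt b"
    obtain i r j r' where "a = (i, r)" "b = (j, r')" by (cases a, cases b)
    then show "a = b" using string_inj[of i j r r'] ab by simp
  qed
  have deg: "degree wronskian_poly = (\<Sum>a\<in>?A. case a of (i, r) \<Rightarrow> weight i r)"
    unfolding degree_wronskian_poly[OF i] by (subst sum.Sigma) auto
  have le: "(case a of (i, r) \<Rightarrow> weight i r) \<le> Polynomial.order (?pt a) wronskian_poly" if "a \<in> ?A" for a
    using weight_le_order that by auto
  have fin: "finite ?A" by auto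
  note W = wronskian_difference_equation(2)[OF i]
  have sat: "Polynomial.order (?pt a) wronskian_poly = (case a of (i, r) \<Rightarrow> weight i r)" if "a \<in> ?A" for a
    by (rule orders_saturate(1)[OF W fin inj le deg that])
  have sat': "poly wronskian_poly s \<noteq> 0" if "s \<notin> ?pt ` ?A" for s
    by (rule orders_saturate(2)[OF W fin inj le deg that])
  show "poly wronskian_poly s \<noteq> 0" if "\<And>i r. i \<in> {1..n} \<Longrightarrow> s \<noteq> \<mu> i + of_nat r"
  proof (rule sat')
    show "s \<notin> ?pt ` ?A"
    proof
      assume "s \<in> ?pt ` ?A"
      then obtain i r where "i \<in> {1..n}" "s = \<mu> i + of_nat r" by auto
      then show False using that by blast
    qed
  qed
  show "Polynomial.order (\<mu> i + of_nat r) wronskian_poly = weight i r"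
  proof (cases "r \<in> {1..ns i (Ns i)}")
    case True
    then show ?thesis using sat[of "(i, r)"] i by simp
  next
    case False
    then have w: "weight i r = 0"
      using weight_0 weight_beyond_top[OF i, of r] by (cases "r = 0") auto
    have "\<mu> i + of_nat r \<notin> ?pt ` ?A"
    proof
      assume "\<mu> i + of_nat r \<in> ?pt ` ?A"
      then obtain j r' where "j \<in> {1..n}" "r' \<in> {1..ns j (Ns j)}" "\<mu> i + of_nat r = \<mu> j + of_nat r'" by auto
      then show False using string_inj[OF i, of j r r'] False by auto
    qed
    from sat'[OF this] have "Polynomial.order (\<mu> i + of_nat r) wronskian_poly = 0" by (rule order_0I)
    then show ?thesis using w by simp
  qed
qed

text \<open>
  If \<open>B\<^sub>0\<close> vanished to a higher order, then by \<open>operator_cofactor_relation\<close> each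
  \<open>B\<^sub>k W\<close> would vanish to a higher order than \<open>W\<close>, and \<open>s\<close> would be a common root of the
  \<open>B\<^sub>k\<close>.
\<close>

lemma B0_order_le:
  assumes g: "family_basis M g U"
    and d: "Polynomial.order s wronskian_poly \<le> e + \<epsilon>"
    and H: "\<And>j. j < M \<Longrightarrow> vanishes_to e s (\<lambda>u. \<Sum>i<M. casorati_cofactor M g i j u * g i (u + of_nat M))"
  shows "Polynomial.order s (B 0) \<le> \<epsilon>"
proof (rule ccontr)
  assume "\<not> ?thesis"
  then have "[:- s, 1:] ^ Suc \<epsilon> dvd B 0" using order_divides[of s "Suc \<epsilon>" "B 0"] by auto
  then obtain C where C: "B 0 = [:- s, 1:] ^ Suc \<epsilon> * C" by (rule dvdE)
  have "poly (B 0) u = (u - s) ^ Suc \<epsilon> * poly C u" for u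
    unfolding C by (simp only: poly_mult poly_power) simp
  then have v0: "vanishes_to (Suc \<epsilon>) s (\<lambda>u. - poly (B 0) u)"
    by (intro vanishes_toI[of "\<lambda>u. - poly C u"]) (auto intro!: holomorphic_intros simp del: power_Suc)
  have gU: "\<And>i. i < M \<Longrightarrow> g i \<in> U" using g by (rule family_basisD(3))
  have low: "poly (B (M - j)) s = 0" if j: "j < M" for j
  proof (rule exact_order_cancel[where F = "poly (B (M - j))", OF exact_order_casoratian[OF g]])
    have "vanishes_to (Suc \<epsilon> + e) s (\<lambda>u. poly (B (M - j)) u * casoratian M g u)"
      using vanishes_to_mult[OF v0 H[OF j]] operator_cofactor_relation[where g = g, OF gU j] by simp
    then show "vanishes_to (Suc (Polynomial.order s wronskian_poly)) s (\<lambda>u. poly (B (M - j)) u * casoratian M g u)"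
      by (rule vanishes_to_mono) (use d in simp)
  qed (auto intro!: holomorphic_intros)
  moreover have "poly (B 0) s = 0" unfolding C by simp
  ultimately have "poly (B k) s = 0" if "k \<le> M" for k
    using that low[of "M - k"] by (cases "k = 0") auto
  then show False using no_common[of s] by blast
qed

text \<open>
  The sum is a determinant whose column \<open>j\<close> is replaced by the values one point beyond the Casorati
  matrix. It loses one zero against the Casoratian only at \<open>r = n\<^sub>i\<^sub>j\<close>.
\<close>

lemma cofactor_sum_vanishes:
  assumes i: "i \<in> {1..n}" and g: "adapted i g" and j: "j < M"
    and e: "e = (if r \<in> ns i ` {1..Ns i} then weight i r - 1 else weight i r)"
  shows "vanishes_to e (\<mu> i + of_nat r) (\<lambda>u. \<Sum>k<M. casorati_cofactor M g k j u * g k (u + of_nat M))"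
proof (rule vanishes_to_sum)
  fix k assume "k \<in> {..<M}"
  then have k: "k < M" by simp
  let ?s = "\<mu> i + of_nat r" and ?I = "vanishing_rows i r"
  have fin: "finite ?I" by (simp add: vanishing_rows_def)
  note cof = adapted_cofactor_vanishes[OF i g j k, of r]
  have hol: "vanishes_to 0 ?s (\<lambda>u. g k (u + of_nat M))"
    using adapted_holomorphic[OF g k] by (simp add: vanishes_to_0_iff holomorphic_shift)
  show "vanishes_to e ?s (\<lambda>u. casorati_cofactor M g k j u * g k (u + of_nat M))"
  proof (cases "k \<in> ?I")
    case False
    then have "card (?I - {k}) = large_count i r" using card_vanishing_rows[OF i] by simp
    then have "e \<le> card (?I - {k}) - (Ns i - r) + 0" using e by (auto simp: weight_def)
    with vanishes_to_mult[OF cof hol] show ?thesis by (rule vanishes_to_mono)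
  next
    (* Row k is lost from the count, but for r outside the ns i j its last factor vanishes. *)
    case True
    then have cI: "card (?I - {k}) = large_count i r - 1"
      using card_vanishing_rows[OF i] fin by (simp add: card_Diff_singleton)
    show ?thesis
    proof (cases "r \<in> ns i ` {1..Ns i}")
      case r: True
      have "e \<le> card (?I - {k}) - (Ns i - r) + 0" using e cI r by (auto simp: weight_def)
      with vanishes_to_mult[OF cof hol] show ?thesis by (rule vanishes_to_mono)
    next
      case r: False
      have "vanishes_to 1 ?s (\<lambda>u. g k (u + of_nat M))"
        using adapted_holomorphic[OF g k] adapted_vanishing(2)[OF i g True r]
        by (intro vanishes_to_1 holomorphic_shift) auto
      from vanishes_to_mult[OF cof this] show ?thesis
        by (rule vanishes_to_mono) (use e cI r in \<open>auto simp: weight_def\<close>)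
    qed
  qed
qed

lemma B0_order:
  assumes i0: "i0 \<in> {1..n}"
  shows "i \<in> {1..n} \<Longrightarrow> r \<notin> ns i ` {1..Ns i} \<Longrightarrow> poly (B 0) (\<mu> i + of_nat r) \<noteq> 0"
    "(\<And>i r. i \<in> {1..n} \<Longrightarrow> s \<noteq> \<mu> i + of_nat r) \<Longrightarrow> poly (B 0) s \<noteq> 0"
    "Polynomial.order s (B 0) \<le> 1"
proof -
  have string: "Polynomial.order (\<mu> i + of_nat r) (B 0) \<le> (if r \<in> ns i ` {1..Ns i} then 1 else 0)"
    if i: "i \<in> {1..n}" for i r
  proof -
    obtain g where g: "adapted i g" using adapted_exists[OF i] by blast
    show ?thesis
    proof (rule B0_order_le[OF _ _ cofactor_sum_vanishes[OF i g _ refl]])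
      show "family_basis M g U" using g by (simp add: adapted_def)
    qed (auto simp: wronskian_orders[OF i])
  qed
  have off: "Polynomial.order s (B 0) \<le> 0" if s: "\<And>i r. i \<in> {1..n} \<Longrightarrow> s \<noteq> \<mu> i + of_nat r" for s
  proof -
    obtain g where g: "adapted i0 g" using adapted_exists[OF i0] by blast
    show ?thesis
    proof (rule B0_order_le[where e = 0])
      show "family_basis M g U" using g by (simp add: adapted_def)
      have "Polynomial.order s wronskian_poly = 0" using wronskian_orders(2)[OF i0 s] by (intro order_0I) auto
      then show "Polynomial.order s wronskian_poly \<le> 0 + 0" by simp
      fix j assume "j < M"
      then have "vanishes_to 0 s (\<lambda>u. \<Sum>k<M. casorati_cofactor M g k j u * g k (u + of_nat M))"
        using vanishes_to_holomorphic[OF cofactor_sum_vanishes[OF i0 g _ refl, of j 0]] by (simp add: vanishes_to_0_iff)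
      then show "vanishes_to 0 s (\<lambda>u. \<Sum>k<M. casorati_cofactor M g k j u * g k (u + of_nat M))" .
    qed
  qed
  show "poly (B 0) (\<mu> i + of_nat r) \<noteq> 0" if "i \<in> {1..n}" "r \<notin> ns i ` {1..Ns i}"
    using string[OF that(1), of r] that(2) B0_nonzero by (simp add: order_root)
  show "poly (B 0) s \<noteq> 0" if "\<And>i r. i \<in> {1..n} \<Longrightarrow> s \<noteq> \<mu> i + of_nat r"
    using off[OF that] B0_nonzero by (simp add: order_root)
  show "Polynomial.order s (B 0) \<le> 1"
  proof (cases "\<exists>i r. i \<in> {1..n} \<and> s = \<mu> i + of_nat r")
    case True
    then obtain i r where "i \<in> {1..n}" "s = \<mu> i + of_nat r" by blast
    then show ?thesis using string[of i r] by (auto split: if_splits)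
  next
    case False
    then show ?thesis using off[of s] by auto
  qed
qed

text \<open>
  The roots are simple and lie among \<open>N\<close> points, while the degree is \<open>N\<close>.
\<close>

lemma B0_roots:
  assumes i0: "i0 \<in> {1..n}"
  shows "poly (B 0) s = 0 \<longleftrightarrow> (\<exists>i\<in>{1..n}. \<exists>j\<in>{1..Ns i}. s = \<mu> i + of_nat (ns i j))"
proof -
  let ?A = "Sigma {1..n} (\<lambda>i. {1..Ns i})"
  let ?X = "(\<lambda>(i, j). \<mu> i + of_nat (ns i j)) ` ?A"
  have "{s. poly (B 0) s = 0} = ?X"
  proof (rule roots_eq_of_simple_orders[OF B0_nonzero B0_order(3)[OF i0]])
    show "{s. poly (B 0) s = 0} \<subseteq> ?X"
    proof
      fix s assume "s \<in> {s. poly (B 0) s = 0}"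
      then have s: "poly (B 0) s = 0" by simp
      then obtain i r where ir: "i \<in> {1..n}" "s = \<mu> i + of_nat r" using B0_order(2)[OF i0, of s] by blast
      then obtain j where "j \<in> {1..Ns i}" "r = ns i j" using B0_order(1)[OF i0, of i r] s by blast
      then show "s \<in> ?X" using ir by force
    qed
    show "finite ?X" by simp
    have "card ?X \<le> card ?A" by (intro card_image_le) auto
    also have "\<dots> = N" by (simp add: N_sum rank_sum_def)
    finally show "card ?X \<le> degree (B 0)" by (simp add: N_eq)
  qed
  then show ?thesis by (auto simp: set_eq_iff)
qed

lemma B0_order_string:
  assumes i: "i \<in> {1..n}"
  shows "Polynomial.order (\<mu> i + of_nat r) (B 0) = (if r \<in> ns i ` {1..Ns i} then 1 else 0)"
proof (cases "r \<in> ns i ` {1..Ns i}")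
  case True
  then have "poly (B 0) (\<mu> i + of_nat r) = 0" using B0_roots[OF i] i by blast
  then have "Polynomial.order (\<mu> i + of_nat r) (B 0) \<noteq> 0" using B0_nonzero by (simp add: order_root)
  then show ?thesis using B0_order(3)[OF i, of "\<mu> i + of_nat r"] True by auto
next
  case False
  then show ?thesis using B0_order(1)[OF i i False] by (simp add: order_0I)
qed

lemma order_pcompose_shift:
  fixes P :: "complex poly"
  assumes P: "P \<noteq> 0"
  shows "Polynomial.order s (P \<circ>\<^sub>p [:1, 1:]) = Polynomial.order (s + 1) P"
proof -
  obtain Q where Q: "P = [:- (s + 1), 1:] ^ Polynomial.order (s + 1) P * Q" "\<not> [:- (s + 1), 1:] dvd Q"
    using order_decomp[OF P] by blast
  have Qs: "poly Q (s + 1) \<noteq> 0" using Q(2) by (simp add: poly_eq_0_iff_dvd)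
  have "([:- (s + 1), 1:] ^ k) \<circ>\<^sub>p [:1, 1:] = [:- s, 1:] ^ k" for k
    by (induction k) (simp_all add: pcompose_mult pcompose_pCons pcompose_1 del: mult_pCons_left)
  then have "P \<circ>\<^sub>p [:1, 1:] = [:- s, 1:] ^ Polynomial.order (s + 1) P * (Q \<circ>\<^sub>p [:1, 1:])"
    by (subst Q(1)) (simp only: pcompose_mult)
  moreover have "Polynomial.order s (Q \<circ>\<^sub>p [:1, 1:]) = 0"
    using Qs by (intro order_0I) (simp add: poly_pcompose add.commute)
  moreover have "Q \<circ>\<^sub>p [:1, 1:] \<noteq> 0" using Qs by (auto simp: pcompose_eq_0_iff)
  ultimately show ?thesis by (simp only:) (simp add: order_mult order_power_n_n del: mult_pCons_left)
qed

text \<open>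
  Orders in \<open>B\<^sub>0(u) W(u + 1) = \<plusminus> B\<^sub>M(u) W(u)\<close>.
\<close>

lemma BM_order:
  assumes i0: "i0 \<in> {1..n}"
  shows "Polynomial.order s (B M) + Polynomial.order s wronskian_poly
       = Polynomial.order s (B 0) + Polynomial.order (s + 1) wronskian_poly" "B M \<noteq> 0"
proof -
  show BM: "B M \<noteq> 0" using coeff_last_nonzero by auto
  note W = wronskian_difference_equation(2)[OF i0]
  then have Ws: "wronskian_poly \<circ>\<^sub>p [:1, 1:] \<noteq> 0" by (simp add: pcompose_eq_0_iff)
  obtain \<kappa> where \<kappa>: "\<kappa> \<noteq> 0" "Polynomial.smult \<kappa> (B 0 * (wronskian_poly \<circ>\<^sub>p [:1, 1:])) = B M * wronskian_poly"
    using wronskian_difference_equation(1)[OF i0] by blast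
  have "Polynomial.order s (B M * wronskian_poly) = Polynomial.order s (B 0 * (wronskian_poly \<circ>\<^sub>p [:1, 1:]))"
    unfolding \<kappa>(2)[symmetric] using \<kappa>(1) by (rule order_smult)
  then show "Polynomial.order s (B M) + Polynomial.order s wronskian_poly
       = Polynomial.order s (B 0) + Polynomial.order (s + 1) wronskian_poly"
    using BM W Ws B0_nonzero by (simp add: order_mult order_pcompose_shift)
qed

lemma BM_order_string:
  assumes i: "i \<in> {1..n}"
  shows "Polynomial.order (\<mu> i + of_nat r) (B M) = (if r < Ns i then 1 else 0)"
proof -
  have "\<mu> i + of_nat r + 1 = \<mu> i + of_nat (Suc r)" by simp
  then show ?thesis
    using BM_order(1)[OF i, of "\<mu> i + of_nat r"] weight_step[OF i, of r]
    by (simp only: wronskian_orders(1)[OF i] B0_order_string[OF i])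
qed

lemma BM_off_strings:
  assumes i0: "i0 \<in> {1..n}" and s: "\<And>i r. i \<in> {1..n} \<Longrightarrow> s \<noteq> \<mu> i + of_nat r"
  shows "poly (B M) s \<noteq> 0"
proof -
  have "Polynomial.order (s + 1) wronskian_poly = 0"
  proof (cases "\<exists>i r. i \<in> {1..n} \<and> s + 1 = \<mu> i + of_nat r")
    case True
    then obtain i r where ir: "i \<in> {1..n}" "s + 1 = \<mu> i + of_nat r" by blast
    have "r = 0"
    proof (rule ccontr)
      assume "r \<noteq> 0"
      then obtain r' where "r = Suc r'" by (cases r) auto
      then have "s = \<mu> i + of_nat r'" using ir(2) by (simp add: algebra_simps)
      then show False using s ir(1) by blast
    qed
    then show ?thesis unfolding ir(2) wronskian_orders(1)[OF ir(1)] by (simp add: weight_0)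
  next
    case False
    then show ?thesis by (intro order_0I wronskian_orders(2)[OF i0]) auto
  qed
  moreover have "Polynomial.order s (B 0) = 0" by (intro order_0I B0_order(2)[OF i0] s)
  ultimately have "Polynomial.order s (B M) = 0" using BM_order(1)[OF i0, of s] by simp
  then show ?thesis using BM_order(2)[OF i0] by (simp add: order_root)
qed

end

section \<open>The conjugate space and its adjoint difference equation\<close>

lemma eventually_not_in_finite:
  fixes F :: "complex set"
  assumes "finite F" shows "\<forall>\<^sub>F v in at s. v \<notin> F"
proof -
  have "open (- (F - {s}))" using assms by (intro open_Compl finite_imp_closed) auto
  then show ?thesis unfolding eventually_at_topological by blast
qed

context bispectral_setup
begin

text \<open>
  Generators of the conjugate space. The sign makes \<open>\<phi>\<^sub>k\<close> the solution of
  \<open>\<Sum>\<^sub>k \<phi>\<^sub>k(u) g\<^sub>k(u + j) = - \<delta>\<^sub>j\<^sub>0 / B\<^sub>M(u)\<close>, \<open>j < M\<close>, and equivalently of the system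
  whose only nonzero right-hand side is \<open>1 / B\<^sub>0(u)\<close> at \<open>j = M\<close>.
\<close>

definition phi :: "(nat \<Rightarrow> complex \<Rightarrow> complex) \<Rightarrow> nat \<Rightarrow> complex \<Rightarrow> complex" where
  "phi g k u = - casorati_cofactor M g k 0 u / (poly (B M) u * casoratian M g u)"

text \<open>
  The second description, in terms of the points \<open>u + 1, \<dots>, u + M\<close>. It is the useful one where
  \<open>B\<^sub>M\<close> vanishes.
\<close>

lemma phi_shift:
  assumes g: "family_basis M g U" and M: "M > 0" and k: "k < M"
  shows "phi g k u = casorati_cofactor M g k (M - 1) (u + 1) / (poly (B 0) u * casoratian M g (u + 1))"
proof -
  have sgn: "(- 1) ^ (M - 1) = - ((- 1) ^ M :: complex)" using M by (cases M) auto
  have "casorati_cofactor M g k (M - 1) (u + 1) / (poly (B 0) u * casoratian M g (u + 1)) =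
    ((- 1) ^ M * - casorati_cofactor M g k 0 u) / ((- 1) ^ M * (poly (B M) u * casoratian M g u))"
    using casoratian_shift[where g = g and u = u, OF family_basisD(3)[OF g] M] casorati_cofactor_shift[OF M k, of g u]
    unfolding sgn by (simp add: mult_ac)
  also have "\<dots> = phi g k u" unfolding phi_def by (subst mult_divide_mult_cancel_left) auto
  finally show ?thesis by simp
qed

lemma sum_phi:
  assumes "casoratian M g u \<noteq> 0" "j < M"
  shows "(\<Sum>k<M. phi g k u * g k (u + of_nat j)) = (if j = 0 then - 1 / poly (B M) u else 0)"
proof -
  have "(\<Sum>k<M. phi g k u * g k (u + of_nat j)) =
      - (\<Sum>k<M. casorati_cofactor M g k 0 u * g k (u + of_nat j)) / (poly (B M) u * casoratian M g u)"
    unfolding phi_def by (simp add: sum_divide_distrib sum_negf)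
  also have "\<dots> = (if j = 0 then - 1 / poly (B M) u else 0)"
    using sum_casorati_cofactor_column[of 0 M j g u] assms by auto
  finally show ?thesis .
qed

lemma casorati_kernel:
  assumes W: "casoratian M g u \<noteq> 0" and z: "\<And>j. j < M \<Longrightarrow> (\<Sum>k<M. y k * g k (u + of_nat j)) = 0"
    and k: "k < M"
  shows "y k = 0"
proof -
  have "0 = (\<Sum>j<M. (\<Sum>i<M. y i * g i (u + of_nat j)) * casorati_cofactor M g k j u)"
    using z by simp
  also have "\<dots> = (\<Sum>i<M. y i * (\<Sum>j<M. g i (u + of_nat j) * casorati_cofactor M g k j u))"
    unfolding sum_distrib_left sum_distrib_right by (subst sum.swap) (simp add: mult_ac)
  also have "\<dots> = (\<Sum>i<M. if i = k then y k * casoratian M g u else 0)"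
    using sum_casorati_cofactor_row[OF _ k] by (intro sum.cong) auto
  finally show ?thesis using k W by simp
qed

text \<open>
  The entry in row \<open>j\<close> and column \<open>k\<close> of the inverse of the Casorati matrix.
\<close>

definition inverse_entry :: "(nat \<Rightarrow> complex \<Rightarrow> complex) \<Rightarrow> nat \<Rightarrow> nat \<Rightarrow> complex \<Rightarrow> complex" where
  "inverse_entry g j k u = casorati_cofactor M g k j u / casoratian M g u"

lemma sum_dual_coord:
  assumes "casoratian M g u \<noteq> 0" "j < M" "w < M"
  shows "(\<Sum>k<M. inverse_entry g j k u * g k (u + of_nat w)) = (if j = w then 1 else 0)"
  unfolding inverse_entry_def times_divide_eq_left sum_divide_distrib[symmetric]
  using sum_casorati_cofactor_column[OF assms(2,3), of g u] assms(1) by simp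

text \<open>
  The condition under which all quotients below are honest ones.
\<close>

definition generic :: "(nat \<Rightarrow> complex \<Rightarrow> complex) \<Rightarrow> complex \<Rightarrow> bool" where
  "generic g u \<longleftrightarrow> casoratian M g u \<noteq> 0 \<and> casoratian M g (u + 1) \<noteq> 0 \<and>
     poly (B M) u \<noteq> 0 \<and> poly (B 0) u \<noteq> 0"

text \<open>
  Multiplied by the Casorati matrix at \<open>u\<close>, both sides agree: the columns \<open>u + 1, \<dots>, u + M - 1\<close>
  are shared with the Casorati matrix at \<open>u + 1\<close>, and the value at the remaining point \<open>u\<close> is determined by
  the difference equation.
\<close>

lemma inverse_entry_step:
  assumes g: "family_basis M g U" and gen: "generic g u" and j: "Suc j < M" and k: "k < M"
  shows "inverse_entry g (Suc j) k u = inverse_entry g j k (u + 1) - poly (B (M - Suc j)) u * phi g k u"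
proof -
  define y where "y k = inverse_entry g (Suc j) k u - inverse_entry g j k (u + 1) + poly (B (M - Suc j)) u * phi g k u" for k
  have W: "casoratian M g u \<noteq> 0" "casoratian M g (u + 1) \<noteq> 0" "poly (B M) u \<noteq> 0"
    using gen unfolding generic_def by auto
  have "y k = 0"
  proof (rule casorati_kernel[OF W(1) _ k])
    fix w assume w: "w < M"
    have split: "(\<Sum>k<M. y k * g k (u + of_nat w)) = (\<Sum>k<M. inverse_entry g (Suc j) k u * g k (u + of_nat w))
      - (\<Sum>k<M. inverse_entry g j k (u + 1) * g k (u + of_nat w))
      + poly (B (M - Suc j)) u * (\<Sum>k<M. phi g k u * g k (u + of_nat w))"
      unfolding y_def by (simp add: sum.distrib sum_subtractf sum_distrib_left algebra_simps)
    show "(\<Sum>k<M. y k * g k (u + of_nat w)) = 0"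
    proof (cases w)
      case (Suc w')
      have "(\<Sum>k<M. inverse_entry g j k (u + 1) * g k (u + of_nat w)) = (if j = w' then 1 else 0)"
        using sum_dual_coord[OF W(2), of j w'] j w Suc by (simp add: add_ac)
      then show ?thesis
        unfolding split using sum_dual_coord[OF W(1) j w] sum_phi[OF W(1) w] Suc by auto
    next
      case 0
      (* F is the element of U that is 1 at u + 1 + j and 0 at the other points u + 1, ..., u + M. *)
      define F where "F = (\<lambda>v. \<Sum>k<M. inverse_entry g j k (u + 1) * g k v)"
      have FU: "F \<in> U" unfolding F_def by (rule family_basisD(2)[OF g])
      have Fv: "F (u + of_nat (Suc i)) = (if j = i then 1 else 0)" if "i < M" for i
        unfolding F_def using sum_dual_coord[OF W(2), of j i] j that by (simp add: add_ac)
      have "0 = (\<Sum>i\<le>M. poly (B (M - i)) u * F (u + of_nat i))" using annU[OF FU] by simp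
      also have "\<dots> = poly (B M) u * F u + (\<Sum>i<M. poly (B (M - Suc i)) u * F (u + of_nat (Suc i)))"
        by (subst sum.atMost_shift) simp
      also have "(\<Sum>i<M. poly (B (M - Suc i)) u * F (u + of_nat (Suc i))) =
          (\<Sum>i<M. if i = j then poly (B (M - Suc j)) u else 0)"
        using Fv by (intro sum.cong) auto
      finally have "F u = - poly (B (M - Suc j)) u / poly (B M) u"
        using j W(3) by (simp add: field_simps eq_neg_iff_add_eq_0)
      then have "(\<Sum>k<M. inverse_entry g j k (u + 1) * g k (u + of_nat w)) = - poly (B (M - Suc j)) u / poly (B M) u"
        by (simp add: F_def 0)
      then show ?thesis
        unfolding split using sum_dual_coord[OF W(1) j w] sum_phi[OF W(1) w] 0 by simp
    qed
  qed
  then show ?thesis unfolding y_def by (simp add: algebra_simps)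
qed

lemma inverse_entry_telescope:
  assumes g: "family_basis M g U" and k: "k < M"
  shows "j < M \<Longrightarrow> (\<And>i. i \<le> j \<Longrightarrow> generic g (u + of_nat i)) \<Longrightarrow>
    inverse_entry g j k u = - (\<Sum>i\<le>j. poly (B (M - i)) (u + of_nat (j - i)) * phi g k (u + of_nat (j - i)))"
proof (induction j arbitrary: u)
  case 0
  then have "poly (B M) u \<noteq> 0" using 0(2)[of 0] by (simp add: generic_def)
  then show ?case by (simp add: inverse_entry_def phi_def)
next
  case (Suc j)
  have gen: "generic g u" using Suc.prems(2)[of 0] by simp
  have "inverse_entry g j k (u + 1) = - (\<Sum>i\<le>j. poly (B (M - i)) (u + 1 + of_nat (j - i)) * phi g k (u + 1 + of_nat (j - i)))"
  proof (rule Suc.IH)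
    show "generic g (u + 1 + of_nat i)" if "i \<le> j" for i
      using Suc.prems(2)[of "Suc i"] that by (simp add: add_ac)
  qed (use Suc.prems in simp)
  also have "\<dots> = - (\<Sum>i\<le>j. poly (B (M - i)) (u + of_nat (Suc j - i)) * phi g k (u + of_nat (Suc j - i)))"
    by (intro arg_cong[of _ _ uminus] sum.cong) (auto simp: Suc_diff_le add_ac)
  finally show ?case
    using inverse_entry_step[OF g gen Suc.prems(1) k] by simp
qed

text \<open>
  The first row of the inverse Casorati matrix is \<open>- B\<^sub>M \<phi>\<close>, the last one is \<open>B\<^sub>0 \<phi>\<close> at the
  preceding point. Expressing the last row through the first one step by step gives the adjoint
  equation.
\<close>

lemma phi_adjoint_equation:
  assumes g: "family_basis M g U" and k: "k < M" and M: "M > 0"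
    and gen: "\<And>j. j \<le> M \<Longrightarrow> generic g (v - of_nat j)"
  shows "(\<Sum>j\<le>M. poly (B (M - j)) (v - of_nat j) * phi g k (v - of_nat j)) = 0"
proof -
  (* The last row of the inverse is taken at u, and phi_shift expresses it by phi at u - 1 = v - M. *)
  define u where "u = v - of_nat (M - 1)"
  have shift: "u + of_nat (M - 1 - i) = v - of_nat i" if "i \<le> M - 1" for i
    using that M by (cases M) (auto simp: u_def of_nat_diff)
  have gen': "generic g (u + of_nat i)" if "i \<le> M - 1" for i
  proof -
    have "u + of_nat i = v - of_nat (M - 1 - i)" using that M by (cases M) (auto simp: u_def of_nat_diff)
    then show ?thesis using gen[of "M - 1 - i"] by simp
  qed
  have "inverse_entry g (M - 1) k u = - (\<Sum>i\<le>M - 1. poly (B (M - i)) (u + of_nat (M - 1 - i)) * phi g k (u + of_nat (M - 1 - i)))"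
    using M by (intro inverse_entry_telescope[OF g k] gen') auto
  also have "\<dots> = - (\<Sum>i\<le>M - 1. poly (B (M - i)) (v - of_nat i) * phi g k (v - of_nat i))"
    by (intro arg_cong[of _ _ uminus] sum.cong refl) (simp only: shift atMost_iff)
  finally have 1: "inverse_entry g (M - 1) k u = - (\<Sum>i\<le>M - 1. poly (B (M - i)) (v - of_nat i) * phi g k (v - of_nat i))" .
  have uv: "u = v - of_nat M + 1" using M by (cases M) (auto simp: u_def)
  have "poly (B 0) (v - of_nat M) \<noteq> 0" using gen[of M] by (simp add: generic_def)
  then have "poly (B 0) (v - of_nat M) * phi g k (v - of_nat M) = inverse_entry g (M - 1) k u"
    unfolding phi_shift[OF g M k] uv inverse_entry_def by simp
  moreover have "(\<Sum>j\<le>M. poly (B (M - j)) (v - of_nat j) * phi g k (v - of_nat j)) =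
     (\<Sum>i\<le>M - 1. poly (B (M - i)) (v - of_nat i) * phi g k (v - of_nat i)) +
     poly (B 0) (v - of_nat M) * phi g k (v - of_nat M)"
    using M by (cases M) auto
  ultimately show ?thesis using 1 by simp
qed

lemma eventually_generic:
  assumes g: "family_basis M g U"
  shows "\<forall>\<^sub>F v in at s. \<forall>j\<le>M. generic g (v - of_nat j)"
proof -
  obtain c \<alpha> where c: "c \<noteq> 0" "\<And>u. casoratian M g u = c * exp (\<alpha> * u) * poly wronskian_poly u"
    "wronskian_poly \<noteq> 0" using casoratian_form[OF g] by blast
  define P where "P = wronskian_poly * (wronskian_poly \<circ>\<^sub>p [:1, 1:]) * B M * B 0"
  have "B M \<noteq> 0" using coeff_last_nonzero by auto
  then have P0: "P \<noteq> 0" using c(3) B0_nonzero by (simp add: P_def pcompose_eq_0_iff)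
  have gen: "generic g u" if "poly P u \<noteq> 0" for u
    using that c(1) unfolding generic_def c(2) P_def by (simp add: poly_pcompose add.commute)
  have ev: "\<forall>\<^sub>F v in at s. poly P (v - of_nat j) \<noteq> 0" for j
  proof -
    have "P \<circ>\<^sub>p [:- of_nat j, 1:] \<noteq> 0" using P0 by (simp add: pcompose_eq_0_iff)
    then have "finite {v. poly (P \<circ>\<^sub>p [:- of_nat j, 1:]) v = 0}" by (rule poly_roots_finite)
    then have "\<forall>\<^sub>F v in at s. v \<notin> {v. poly (P \<circ>\<^sub>p [:- of_nat j, 1:]) v = 0}"
      by (rule eventually_not_in_finite)
    then show ?thesis by (simp add: poly_pcompose)
  qed
  have "\<forall>\<^sub>F v in at s. \<forall>j\<in>{..M}. poly P (v - of_nat j) \<noteq> 0"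
    by (intro eventually_ball_finite) (auto intro: ev)
  then show ?thesis by eventually_elim (use gen in auto)
qed

lemma phi_holomorphic:
  assumes g: "family_basis M g U" and k: "k < M" and M: "M > 0"
    and S: "\<And>s. s \<in> S \<Longrightarrow> poly (B M) s \<noteq> 0 \<and> poly wronskian_poly s \<noteq> 0"
  shows "phi g k holomorphic_on S"
proof -
  obtain c \<alpha> where c: "c \<noteq> 0" "\<And>u. casoratian M g u = c * exp (\<alpha> * u) * poly wronskian_poly u"
    using casoratian_form[OF g] by blast
  have hol: "\<And>i. i < M \<Longrightarrow> g i holomorphic_on UNIV" using U_holomorphic family_basisD(3)[OF g] by blast
  have "vanishes_to (card ({}::nat set) - 0) 0 (casorati_cofactor M g k 0)"
    using casorati_cofactor_vanishes_to[where I = "{}" and J = "{}" and s = 0, OF hol _ _ k M] by auto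
  then have "casorati_cofactor M g k 0 holomorphic_on UNIV" by (rule vanishes_to_holomorphic)
  then have "casorati_cofactor M g k 0 holomorphic_on S" by (rule holomorphic_on_subset) simp
  then show ?thesis unfolding phi_def c(2) using S c(1) by (intro holomorphic_intros) auto
qed

lemma basis_change_const:
  assumes g: "family_basis M g U" and f: "family_basis M f U"
  shows "\<exists>\<kappa>. \<kappa> \<noteq> 0 \<and> (\<forall>u. casoratian M f u = \<kappa> * casoratian M g u)"
proof -
  have "\<forall>i. \<exists>x. i < M \<longrightarrow> f i = (\<lambda>u. \<Sum>k<M. x k * g k u)"
    using family_basisD(1)[OF g family_basisD(3)[OF f]] by blast
  then obtain C where C: "\<And>i. i < M \<Longrightarrow> f i = (\<lambda>u. \<Sum>k<M. C i k * g k u)" by metis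
  then have C': "f i u = (\<Sum>k<M. C i k * g k u)" if "i < M" for i u using that by simp
  define \<kappa> where "\<kappa> = Determinant.det (Matrix.mat M M (\<lambda>(i, k). C i k))"
  have eq: "casoratian M f u = \<kappa> * casoratian M g u" for u
    unfolding \<kappa>_def by (rule casoratian_change_of_basis[OF C'])
  obtain u where "casoratian M f u \<noteq> 0" using casoratian_nonzero[OF f] by blast
  then have "\<kappa> \<noteq> 0" using eq by auto
  then show ?thesis using eq by blast
qed

text \<open>
  Let the constant matrix \<open>C\<close> express \<open>hs\<close> in the basis \<open>g\<close>, with one free row on top. Choose this
  row so that the product with the Casorati matrix has the first row \<open>(1, 0, \<dots>, 0)\<close>; its determinant is
  then the Wronskian of \<open>hs\<close> at \<open>u + 1\<close>, and expanding \<open>det C\<close> along the free row gives the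
  coefficients.
\<close>

lemma wronskian_expansion:
  assumes g: "family_basis M g U" and M: "M > 0" and hs: "set hs \<subseteq> U" "length hs = M - 1"
  shows "\<exists>y. \<forall>u. casoratian M g u \<noteq> 0 \<longrightarrow>
    discrete_wronskian hs (u + 1) = (\<Sum>k<M. y k * casorati_cofactor M g k 0 u)"
proof -
  have "\<forall>i. \<exists>x. i < M - 1 \<longrightarrow> hs ! i = (\<lambda>u. \<Sum>k<M. x k * g k u)"
  proof
    fix i show "\<exists>x. i < M - 1 \<longrightarrow> hs ! i = (\<lambda>u. \<Sum>k<M. x k * g k u)"
    proof (cases "i < M - 1")
      case True
      then have "hs ! i \<in> U" using hs nth_mem by (metis subsetD)
      from family_basisD(1)[OF g this] show ?thesis by blast
    qed auto
  qed
  then obtain c where c: "\<And>i. i < M - 1 \<Longrightarrow> hs ! i = (\<lambda>u. \<Sum>k<M. c i k * g k u)" by metis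
  define C where "C x = Matrix.mat M M (\<lambda>(i, k). if i = 0 then x k else c (i - 1) k)" for x :: "nat \<Rightarrow> complex"
  define y where "y k = cofactor (C (\<lambda>_. 0)) 0 k" for k
  have CM: "C x \<in> carrier_mat M M" for x by (simp add: C_def)
  have cof: "cofactor (C x) 0 k = y k" if "k < M" for x k
  proof -
    have "mat_delete (C x) 0 k = mat_delete (C (\<lambda>_. 0)) 0 k"
      unfolding mat_delete_def C_def using that by (intro eq_matI) auto
    then show ?thesis by (simp add: y_def cofactor_def)
  qed
  have detC: "Determinant.det (C x) = (\<Sum>k<M. x k * y k)" for x
  proof -
    have "Determinant.det (C x) = (\<Sum>k<M. C x $$ (0, k) * cofactor (C x) 0 k)"
      by (rule laplace_expansion_row[OF CM M])
    also have "\<dots> = (\<Sum>k<M. x k * y k)" using M cof by (intro sum.cong) (auto simp: C_def)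
    finally show ?thesis .
  qed
  have "discrete_wronskian hs (u + 1) = (\<Sum>k<M. y k * casorati_cofactor M g k 0 u)" if W: "casoratian M g u \<noteq> 0" for u
  proof -
    define x where "x k = casorati_cofactor M g k 0 u / casoratian M g u" for k
    define P where "P = C x * casorati M g u"
    have PM: "P \<in> carrier_mat M M" unfolding P_def using CM casorati_carrier(1) by (rule mult_carrier_mat)
    have P0: "P $$ (0, w) = (if w = 0 then 1 else 0)" if "w < M" for w
    proof -
      have "P $$ (0, w) = (\<Sum>k<M. x k * g k (u + of_nat w))"
        unfolding P_def C_def casorati_def using that M by (simp add: scalar_prod_def atLeast0LessThan)
      then show ?thesis using sum_dual_coord[OF W M that] unfolding x_def inverse_entry_def by simp
    qed
    have PS: "P $$ (Suc i, w) = (hs ! i) (u + of_nat w)" if "Suc i < M" "w < M" for i w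
      unfolding P_def C_def casorati_def using that c[of i] by (simp add: scalar_prod_def atLeast0LessThan)
    have "mat_delete P 0 0 = Matrix.mat (length hs) (length hs) (\<lambda>(j, k). (hs ! j) (u + 1 + of_nat k))"
      using PM PS unfolding mat_delete_def hs(2) by (intro eq_matI) (auto simp: add_ac)
    then have "cofactor P 0 0 = discrete_wronskian hs (u + 1)"
      by (simp add: cofactor_def discrete_wronskian_def)
    moreover have "Determinant.det P = (\<Sum>w<M. P $$ (0, w) * cofactor P 0 w)"
      by (rule laplace_expansion_row[OF PM M])
    moreover have "(\<Sum>w<M. P $$ (0, w) * cofactor P 0 w) = (\<Sum>w<M. if w = 0 then cofactor P 0 0 else 0)"
      using P0 by (intro sum.cong) auto
    ultimately have "discrete_wronskian hs (u + 1) = Determinant.det P" using M by simp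
    also have "\<dots> = Determinant.det (C x) * casoratian M g u"
      unfolding P_def casoratian_def by (rule det_mult[OF CM casorati_carrier(1)])
    also have "\<dots> = (\<Sum>k<M. y k * casorati_cofactor M g k 0 u)"
      unfolding detC x_def sum_distrib_right using W by (intro sum.cong) auto
    finally show ?thesis .
  qed
  then show ?thesis by blast
qed

lemma discrete_wronskian_casoratian: "discrete_wronskian fs = casoratian (length fs) (\<lambda>i. fs ! i)"
  by (simp add: fun_eq_iff discrete_wronskian_def casoratian_def casorati_def)

lemma basis_length:
  assumes i: "i \<in> {1..n}" and gs: "is_basis gs U"
  shows "length gs = M"
proof -
  obtain fs where fs: "is_basis fs U" "length fs = M"
    using exps[OF i] unfolding discrete_exponents_def by blast
  have "\<exists>f. bij_betw f (set gs) (set fs)"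
    by (rule cfun.bij_if_span_eq_span_bases) (use gs fs in \<open>auto simp: is_basis_def\<close>)
  then have "card (set gs) = card (set fs)" using bij_betw_same_card by blast
  then show ?thesis using gs fs by (simp add: is_basis_def distinct_card)
qed

lemma regularized_conjugate_eq:
  assumes i: "i \<in> {1..n}" and g: "family_basis M g U"
  shows "regularized_conjugate U M B = {f. \<exists>x. f = (\<lambda>u. \<Sum>k<M. x k * phi g k u)}"
proof -
  note M = M_pos[OF i]
  have sp: "{f. \<exists>x. f = (\<lambda>u. \<Sum>k<M. x k * phi g k u)} = cfun.span (phi g ` {..<M})"
    using span_family[of "{..<M}" "phi g"] by simp
  let ?G = "{\<lambda>u. discrete_wronskian fs (u + 1) / (poly (B M) u * discrete_wronskian gs u) | fs gs.
                  set fs \<subseteq> U \<and> length fs = M - 1 \<and> is_basis gs U}"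
  have "?G \<subseteq> cfun.span (phi g ` {..<M})"
  proof
    fix f assume "f \<in> ?G"
    then obtain hs gs where h: "f = (\<lambda>u. discrete_wronskian hs (u + 1) / (poly (B M) u * discrete_wronskian gs u))"
      "set hs \<subseteq> U" "length hs = M - 1" "is_basis gs U" by blast
    have "family_basis M (\<lambda>i. gs ! i) U" using is_basis_family[OF h(4)] basis_length[OF i h(4)] by simp
    then obtain \<kappa> where \<kappa>: "\<kappa> \<noteq> 0" "\<And>u. discrete_wronskian gs u = \<kappa> * casoratian M g u"
      using basis_change_const[OF g] basis_length[OF i h(4)] by (auto simp: discrete_wronskian_casoratian)
    obtain y where y: "\<And>u. casoratian M g u \<noteq> 0 \<Longrightarrow>
        discrete_wronskian hs (u + 1) = (\<Sum>k<M. y k * casorati_cofactor M g k 0 u)"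
      using wronskian_expansion[OF g M h(2,3)] by blast
    have "f = (\<lambda>u. \<Sum>k<M. (- y k / \<kappa>) * phi g k u)"
    proof
      fix u
      (* At the zeros of the Casoratian both sides are 0 by the convention for division by 0. *)
      show "f u = (\<Sum>k<M. (- y k / \<kappa>) * phi g k u)"
      proof (cases "casoratian M g u = 0")
        case True
        then show ?thesis by (simp add: h(1) \<kappa>(2) phi_def)
      next
        case False
        have "(\<Sum>k<M. (- y k / \<kappa>) * phi g k u) =
            (\<Sum>k<M. y k * casorati_cofactor M g k 0 u) / (poly (B M) u * (\<kappa> * casoratian M g u))"
          unfolding phi_def sum_divide_distrib by (intro sum.cong) auto
        then show ?thesis using y[OF False] by (simp add: h(1) \<kappa>(2))
      qed
    qed
    then show "f \<in> cfun.span (phi g ` {..<M})" unfolding sp[symmetric] mem_Collect_eq by (rule exI[of _ "\<lambda>k. - y k / \<kappa>"])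
  qed
  moreover have "phi g ` {..<M} \<subseteq> cfun.span ?G"
  proof
    fix f assume "f \<in> phi g ` {..<M}"
    then obtain k where k: "k < M" "f = phi g k" by blast
    obtain gs where gs: "is_basis gs U" "length gs = M"
      using exps[OF i] unfolding discrete_exponents_def by blast
    have "family_basis M (\<lambda>i. gs ! i) U" using is_basis_family[OF gs(1)] gs(2) by simp
    then obtain \<kappa> where \<kappa>: "\<kappa> \<noteq> 0" "\<And>u. discrete_wronskian gs u = \<kappa> * casoratian M g u"
      using basis_change_const[OF g] gs(2) by (auto simp: discrete_wronskian_casoratian)
    define hs where "hs = map (\<lambda>i. g (if i < k then i else Suc i)) [0..<M - 1]"
    have hs: "set hs \<subseteq> U" "length hs = M - 1"
      using family_basisD(3)[OF g] by (auto simp: hs_def)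
    have wr: "casorati_cofactor M g k 0 u = (- 1) ^ k * discrete_wronskian hs (u + 1)" for u
    proof -
      have "mat_delete (casorati M g u) k 0 = Matrix.mat (length hs) (length hs) (\<lambda>(j, k). (hs ! j) (u + 1 + of_nat k))"
        unfolding mat_delete_def hs(2) casorati_def hs_def using k M by (intro eq_matI) (auto simp: add_ac)
      then show ?thesis by (simp add: casorati_cofactor_def cofactor_def discrete_wronskian_def)
    qed
    have "f = (\<lambda>u. (- ((- 1) ^ k) * \<kappa>) * (discrete_wronskian hs (u + 1) / (poly (B M) u * discrete_wronskian gs u)))"
      unfolding k(2) fun_eq_iff phi_def wr \<kappa>(2) using \<kappa>(1) by simp
    also have "\<dots> \<in> cfun.span ?G"
      by (intro cfun.span_scale cfun.span_base) (use hs gs in blast)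
    finally show "f \<in> cfun.span ?G" .
  qed
  ultimately have "cfun.span ?G = cfun.span (phi g ` {..<M})"
    by (intro subset_antisym cfun.span_minimal cfun.subspace_span)
  then show ?thesis unfolding regularized_conjugate_def sp .
qed

end

section \<open>Simple poles and residues of the conjugate space\<close>

text \<open>
  At most a simple pole: a removable singularity is included, so that the property is linear.
\<close>

definition simple_pole_at :: "(complex \<Rightarrow> complex) \<Rightarrow> complex \<Rightarrow> bool" where
  "simple_pole_at f s \<longleftrightarrow> (\<exists>\<psi>. \<psi> analytic_on {s} \<and> (\<forall>\<^sub>F u in at s. f u = \<psi> u / (u - s)))"

lemma simple_pole_at_residue:
  assumes "simple_pole_at f s"
  shows "((\<lambda>u. (u - s) * f u) \<longlongrightarrow> residue f s) (at s)"
    "((\<lambda>u. (u - s) * f u) \<longlongrightarrow> L) (at s) \<Longrightarrow> residue f s = L"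
proof -
  obtain \<psi> where \<psi>: "\<psi> analytic_on {s}" "\<forall>\<^sub>F u in at s. f u = \<psi> u / (u - s)"
    using assms unfolding simple_pole_at_def by blast
  obtain e where e: "e > 0" "\<psi> holomorphic_on ball s e"
    using \<psi>(1) unfolding analytic_at by (meson open_contains_ball holomorphic_on_subset)
  have "residue f s = residue (\<lambda>u. \<psi> u / (u - s)) s" using \<psi>(2) by (intro residue_cong) auto
  also have "\<dots> = \<psi> s" using e by (intro residue_simple[of "ball s e"]) auto
  finally have r: "residue f s = \<psi> s" .
  have "isCont \<psi> s" using \<psi>(1) by (rule analytic_at_imp_isCont)
  then have "(\<psi> \<longlongrightarrow> \<psi> s) (at s)" by (simp add: isCont_def)
  moreover have "\<forall>\<^sub>F u in at s. \<psi> u = (u - s) * f u"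
    using \<psi>(2) eventually_not_in_finite[OF finite.insertI[OF finite.emptyI], of s s]
    by eventually_elim auto
  ultimately show lim: "((\<lambda>u. (u - s) * f u) \<longlongrightarrow> residue f s) (at s)"
    unfolding r by (rule Lim_transform_eventually)
  show "residue f s = L" if "((\<lambda>u. (u - s) * f u) \<longlongrightarrow> L) (at s)"
    using tendsto_unique[OF _ lim that] by simp
qed

lemma simple_pole_at_sum:
  fixes K :: nat
  assumes "\<And>k. k < K \<Longrightarrow> simple_pole_at (f k) s"
  shows "simple_pole_at (\<lambda>u. \<Sum>k<K. x k * f k u) s"
proof -
  have "\<forall>k. \<exists>\<psi>. k < K \<longrightarrow> \<psi> analytic_on {s} \<and> (\<forall>\<^sub>F u in at s. f k u = \<psi> u / (u - s))"
    using assms unfolding simple_pole_at_def by blast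
  then obtain \<psi> where \<psi>: "\<And>k. k < K \<Longrightarrow> \<psi> k analytic_on {s}"
    "\<And>k. k < K \<Longrightarrow> \<forall>\<^sub>F u in at s. f k u = \<psi> k u / (u - s)" by metis
  have "\<forall>\<^sub>F u in at s. \<forall>k\<in>{..<K}. f k u = \<psi> k u / (u - s)"
    by (intro eventually_ball_finite) (auto intro: \<psi>(2))
  then have "\<forall>\<^sub>F u in at s. (\<Sum>k<K. x k * f k u) = (\<Sum>k<K. x k * \<psi> k u) / (u - s)"
    by eventually_elim (simp add: sum_divide_distrib)
  moreover have "(\<lambda>u. \<Sum>k<K. x k * \<psi> k u) analytic_on {s}"
    using \<psi>(1) by (intro analytic_intros) auto
  ultimately show ?thesis unfolding simple_pole_at_def by blast
qed

lemma residue_sum_simple: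
  fixes K :: nat
  assumes "\<And>k. k < K \<Longrightarrow> simple_pole_at (f k) s"
  shows "residue (\<lambda>u. \<Sum>k<K. x k * f k u) s = (\<Sum>k<K. x k * residue (f k) s)"
proof (rule simple_pole_at_residue(2)[OF simple_pole_at_sum[OF assms]])
  have "((\<lambda>u. \<Sum>k<K. x k * ((u - s) * f k u)) \<longlongrightarrow> (\<Sum>k<K. x k * residue (f k) s)) (at s)"
    by (intro tendsto_intros simple_pole_at_residue(1) assms) auto
  then show "((\<lambda>u. (u - s) * (\<Sum>k<K. x k * f k u)) \<longlongrightarrow> (\<Sum>k<K. x k * residue (f k) s)) (at s)"
    by (simp add: sum_distrib_left mult_ac)
qed auto

lemma simple_pole_at_quotient:
  assumes F: "vanishes_to a s F" and G: "exact_order b s G" and ab: "b \<le> Suc a"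
  shows "simple_pole_at (\<lambda>u. F u / G u) s"
proof -
  obtain h where h: "h holomorphic_on UNIV" "\<And>u. F u = (u - s) ^ a * h u"
    using F unfolding vanishes_to_def by blast
  obtain k where k: "k holomorphic_on UNIV" "k s \<noteq> 0" "\<And>u. G u = (u - s) ^ b * k u"
    using G unfolding exact_order_def by blast
  have an: "h analytic_on {s}" "k analytic_on {s}"
    using h(1) k(1) holomorphic_on_imp_analytic_at by blast+
  have "(\<lambda>u. (u - s) ^ (Suc a - b) * h u / k u) analytic_on {s}"
    using an k(2) by (intro analytic_intros) auto
  moreover have "F u / G u = ((u - s) ^ (Suc a - b) * h u / k u) / (u - s)" if "u \<noteq> s" for u
  proof -
    have "(u - s) * (u - s) ^ a = (u - s) ^ b * (u - s) ^ (Suc a - b)"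
      using ab by (simp flip: power_add power_Suc)
    then have "(u - s) ^ a / (u - s) ^ b = (u - s) ^ (Suc a - b) / (u - s)"
      using that by (simp add: field_simps)
    moreover have "F u / G u = ((u - s) ^ a / (u - s) ^ b) * (h u / k u)" unfolding h(2) k(3) by simp
    ultimately show ?thesis by simp
  qed
  then have "\<forall>\<^sub>F u in at s. F u / G u = ((u - s) ^ (Suc a - b) * h u / k u) / (u - s)"
    by (auto simp: eventually_at_filter)
  ultimately show ?thesis unfolding simple_pole_at_def by blast
qed

lemma simple_pole_at_analytic:
  assumes "f analytic_on {s}" shows "simple_pole_at f s" "residue f s = 0"
proof -
  have "\<forall>\<^sub>F u in at s. f u = ((u - s) * f u) / (u - s)" by (auto simp: eventually_at_filter)
  moreover have "(\<lambda>u. (u - s) * f u) analytic_on {s}" using assms by (intro analytic_intros)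
  ultimately show sp: "simple_pole_at f s" unfolding simple_pole_at_def by blast
  have "isCont f s" using assms by (rule analytic_at_imp_isCont)
  then have "(f \<longlongrightarrow> f s) (at s)" by (simp add: isCont_def)
  then have "((\<lambda>u. (u - s) * f u) \<longlongrightarrow> (s - s) * f s) (at s)" by (intro tendsto_intros)
  then show "residue f s = 0" using simple_pole_at_residue(2)[OF sp] by simp
qed

lemma vanishes_to_shift:
  assumes "vanishes_to a (s + 1) F" shows "vanishes_to a s (\<lambda>u. F (u + 1))"
proof -
  obtain h where h: "h holomorphic_on UNIV" "\<And>u. F u = (u - (s + 1)) ^ a * h u"
    using assms unfolding vanishes_to_def by blast
  show ?thesis
    by (rule vanishes_toI[of "\<lambda>u. h (u + 1)"]) (use holomorphic_shift[OF h(1)] h(2) in auto)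
qed

lemma exact_order_shift:
  assumes "exact_order a (s + 1) F" shows "exact_order a s (\<lambda>u. F (u + 1))"
proof -
  obtain h where h: "h holomorphic_on UNIV" "h (s + 1) \<noteq> 0" "\<And>u. F u = (u - (s + 1)) ^ a * h u"
    using assms unfolding exact_order_def by blast
  show ?thesis unfolding exact_order_def
    by (rule exI[of _ "\<lambda>u. h (u + 1)"]) (use holomorphic_shift[OF h(1)] h(2,3) in auto)
qed

lemma exact_order_mult_poly:
  assumes "P \<noteq> 0" "exact_order b s G"
  shows "exact_order (Polynomial.order s P + b) s (\<lambda>u. poly P u * G u)"
proof -
  obtain h where h: "h holomorphic_on UNIV" "h s \<noteq> 0" "\<And>u. poly P u = (u - s) ^ Polynomial.order s P * h u"
    using exact_order_poly[OF assms(1), of 1 s 0] unfolding exact_order_def by auto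
  obtain k where k: "k holomorphic_on UNIV" "k s \<noteq> 0" "\<And>u. G u = (u - s) ^ b * k u"
    using assms(2) unfolding exact_order_def by blast
  show ?thesis unfolding exact_order_def
    by (rule exI[of _ "\<lambda>u. h u * k u"]) (use h k in \<open>auto intro!: holomorphic_intros simp: power_add\<close>)
qed

context bispectral_setup
begin

lemma cofactor_vanishes:
  assumes i: "i \<in> {1..n}" and g: "adapted i g" and j: "j < M" and k: "k < M"
  shows "vanishes_to (weight i r - 1) (\<mu> i + of_nat r) (casorati_cofactor M g k j)"
proof -
  have "large_count i r - 1 \<le> card (vanishing_rows i r - {k})"
    using card_vanishing_rows[OF i, of r]
    by (cases "k \<in> vanishing_rows i r") (auto simp: card_Diff_singleton vanishing_rows_def)
  with adapted_cofactor_vanishes[OF i g j k, of r] show ?thesis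
    by (elim vanishes_to_mono) (auto simp: weight_def)
qed

text \<open>
  The cofactor does not see the last column, so the rows needed for it are those that vanish up to one
  point less. At \<open>r = n\<^sub>i\<^sub>j\<close> there is one more such row, which compensates the row lost in a
  cofactor.
\<close>

lemma last_cofactor_vanishes:
  assumes i: "i \<in> {1..n}" and g: "adapted i g" and k: "k < M" and r: "r \<in> ns i ` {1..Ns i}"
  shows "vanishes_to (weight i (Suc r)) (\<mu> i + of_nat (Suc r)) (casorati_cofactor M g k (M - 1))"
proof -
  let ?s = "\<mu> i + of_nat (Suc r)" and ?I = "vanishing_rows i r" and ?J = "insert (M - 1) {..<Ns i - Suc r}"
  have M: "M > 0" using M_pos[OF i] .
  have fin: "finite ?I" by (simp add: vanishing_rows_def)
  have "vanishes_to (card (?I - {k}) - card (?J - {M - 1})) ?s (casorati_cofactor M g k (M - 1))"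
  proof (rule casorati_cofactor_vanishes_to)
    show "?I \<subseteq> {..<M}" by (auto simp: vanishing_rows_def)
    show "?J \<subseteq> {..<M}" using Ns_le[OF i] M by auto
    show "g k' (?s + of_nat k'') = 0" if "k' \<in> ?I" "k'' < M" "k'' \<notin> ?J" for k' k''
    proof -
      have "Suc k'' < M" "Ns i \<le> r + Suc k''" using that M by auto
      from adapted_vanishing(1)[OF i g that(1) this] show ?thesis by (simp add: algebra_simps)
    qed
  qed (use adapted_holomorphic[OF g] k M in auto)
  moreover have "card (?J - {M - 1}) \<le> Ns i - Suc r"
    using card_mono[of "{..<Ns i - Suc r}" "?J - {M - 1}"] by auto
  moreover have "large_count i r - 1 \<le> card (?I - {k})"
    using card_vanishing_rows[OF i] fin by (cases "k \<in> ?I") (auto simp: card_Diff_singleton)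
  moreover have "large_count i r - 1 = large_count i (Suc r)" using large_count_step[OF i, of r] r by simp
  ultimately show ?thesis by (elim vanishes_to_mono) (auto simp: weight_def)
qed

text \<open>
  For \<open>r \<ge> N\<^sub>i\<close> the factor \<open>B\<^sub>M\<close> is nonzero, and a cofactor vanishes to at least one order less
  than the Casoratian. For \<open>r < N\<^sub>i\<close> the formula with \<open>B\<^sub>0\<close> applies; where \<open>B\<^sub>0\<close> vanishes,
  the cofactor gains the order that is needed.
\<close>

lemma phi_simple_pole:
  assumes i: "i \<in> {1..n}" and g: "adapted i g" and k: "k < M"
  shows "simple_pole_at (phi g k) (\<mu> i + of_nat r)"
proof -
  let ?s = "\<mu> i + of_nat r"
  have gb: "family_basis M g U" using g by (simp add: adapted_def)
  have M: "M > 0" using M_pos[OF i] .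
  have BM0: "B M \<noteq> 0" using BM_order(2)[OF i] .
  have exW: "exact_order (weight i r) (\<mu> i + of_nat r) (casoratian M g)" for r
    using exact_order_casoratian[OF gb, of "\<mu> i + of_nat r"] by (simp add: wronskian_orders(1)[OF i])
  have suc: "?s + 1 = \<mu> i + of_nat (Suc r)" by simp
  show ?thesis
  proof (cases "r < Ns i")
    case False
    have ord: "Polynomial.order ?s (B M) = 0" using BM_order_string[OF i, of r] False by simp
    have "vanishes_to (weight i r - 1) ?s (\<lambda>u. - casorati_cofactor M g k 0 u)"
      using vanishes_to_mult[OF _ cofactor_vanishes[OF i g M k, of r], of 0 "\<lambda>_. -1"] by (simp add: vanishes_to_0_iff)
    from simple_pole_at_quotient[OF this exact_order_mult_poly[OF BM0 exW[of r]]]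
    show ?thesis unfolding phi_def[abs_def] ord by simp
  next
    case True
    have exW': "exact_order (weight i (Suc r)) ?s (\<lambda>u. casoratian M g (u + 1))"
      using exW[of "Suc r"] unfolding suc[symmetric] by (rule exact_order_shift)
    note ex = exact_order_mult_poly[OF B0_nonzero exW']
    have eq: "phi g k = (\<lambda>u. casorati_cofactor M g k (M - 1) (u + 1) / (poly (B 0) u * casoratian M g (u + 1)))"
      using phi_shift[OF gb M k] by (rule ext)
    show ?thesis
    proof (cases "r \<in> ns i ` {1..Ns i}")
      case r: True
      have "vanishes_to (weight i (Suc r)) ?s (\<lambda>u. casorati_cofactor M g k (M - 1) (u + 1))"
        using last_cofactor_vanishes[OF i g k r] unfolding suc[symmetric] by (rule vanishes_to_shift)
      from simple_pole_at_quotient[OF this ex] show ?thesis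
        unfolding eq B0_order_string[OF i] using r by simp
    next
      case r: False
      have "vanishes_to (weight i (Suc r) - 1) ?s (\<lambda>u. casorati_cofactor M g k (M - 1) (u + 1))"
        using cofactor_vanishes[OF i g _ k, of "M - 1" "Suc r"] M unfolding suc[symmetric]
        by (intro vanishes_to_shift) simp
      from simple_pole_at_quotient[OF this ex] show ?thesis
        unfolding eq B0_order_string[OF i] using r by simp
    qed
  qed
qed

abbreviation strings :: "complex set" where
  "strings \<equiv> (\<Union>i\<in>{1..n}. pole_string Ns ns l i)"

lemma pole_string_iff: "s \<in> pole_string Ns ns l i \<longleftrightarrow> (\<exists>r\<le>ns i (Ns i). s = \<mu> i + of_nat r)"
  by (auto simp: pole_string_def)

lemma finite_strings: "finite strings"
proof -
  have "pole_string Ns ns l i = (\<lambda>r. \<mu> i + of_nat r) ` {..ns i (Ns i)}" for i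
    by (auto simp: pole_string_def)
  then show ?thesis by auto
qed

lemma nonzero_off_strings:
  assumes i0: "i0 \<in> {1..n}" and s: "s \<notin> strings"
  shows "poly (B M) s \<noteq> 0 \<and> poly wronskian_poly s \<noteq> 0"
proof (cases "\<exists>i r. i \<in> {1..n} \<and> s = \<mu> i + of_nat r")
  case True
  then obtain i r where ir: "i \<in> {1..n}" "s = \<mu> i + of_nat r" by blast
  then have r: "r > ns i (Ns i)" using s pole_string_iff by (metis UN_I not_le_imp_less)
  have "Ns i \<le> ns i (Ns i)" using ns_ge[OF ir(1), of "Ns i"] Ns_pos[OF ir(1)] by simp
  then have "Polynomial.order s (B M) = 0" unfolding ir(2) using BM_order_string[OF ir(1), of r] r by simp
  moreover have "Polynomial.order s wronskian_poly = 0"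
    unfolding ir(2) wronskian_orders(1)[OF ir(1)] by (rule weight_beyond_top[OF ir(1) r])
  ultimately show ?thesis using BM_order(2)[OF i0] wronskian_difference_equation(2)[OF i0] by (simp add: order_root)
next
  case False
  then show ?thesis using BM_off_strings[OF i0, of s] wronskian_orders(2)[OF i0, of s] by blast
qed

lemma conjugate_holomorphic:
  assumes i0: "i0 \<in> {1..n}" and f: "f \<in> regularized_conjugate U M B"
  shows "f holomorphic_on - strings"
proof -
  obtain g where g: "adapted i0 g" using adapted_exists[OF i0] by blast
  then have gb: "family_basis M g U" by (simp add: adapted_def)
  obtain x where f: "f = (\<lambda>u. \<Sum>k<M. x k * phi g k u)" using f regularized_conjugate_eq[OF i0 gb] by blast
  have "phi g k holomorphic_on - strings" if "k < M" for k
    using nonzero_off_strings[OF i0] by (intro phi_holomorphic[OF gb that M_pos[OF i0]]) auto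
  then show ?thesis unfolding f by (intro holomorphic_intros) auto
qed

lemma conjugate_off_strings:
  assumes i0: "i0 \<in> {1..n}" and f: "f \<in> regularized_conjugate U M B" and s: "s \<notin> strings"
  shows "simple_pole_at f s" "residue f s = 0"
proof -
  have "open (- strings)" using finite_strings by (intro open_Compl finite_imp_closed)
  then have "f analytic_on {s}"
    using conjugate_holomorphic[OF i0 f] s by (meson analytic_at ComplI)
  then show "simple_pole_at f s" "residue f s = 0" using simple_pole_at_analytic by blast+
qed

lemma conjugate_simple_pole:
  assumes i0: "i0 \<in> {1..n}" and f: "f \<in> regularized_conjugate U M B"
  shows "simple_pole_at f s"
proof (cases "s \<in> strings")
  case True
  then obtain i r where ir: "i \<in> {1..n}" "s = \<mu> i + of_nat r" using pole_string_iff by blast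
  obtain g where g: "adapted i g" using adapted_exists[OF ir(1)] by blast
  then have gb: "family_basis M g U" by (simp add: adapted_def)
  obtain x where f: "f = (\<lambda>u. \<Sum>k<M. x k * phi g k u)" using f regularized_conjugate_eq[OF i0 gb] by blast
  show ?thesis unfolding f ir(2) by (intro simple_pole_at_sum phi_simple_pole[OF ir(1) g])
next
  case False
  then show ?thesis by (rule conjugate_off_strings(1)[OF i0 f])
qed

lemma conjugate_adjoint:
  assumes i0: "i0 \<in> {1..n}" and f: "f \<in> regularized_conjugate U M B"
  shows "\<forall>\<^sub>F v in at s. (\<Sum>j\<le>M. poly (B (M - j)) (v - of_nat j) * f (v - of_nat j)) = 0"
proof -
  obtain g where g: "adapted i0 g" using adapted_exists[OF i0] by blast
  then have gb: "family_basis M g U" by (simp add: adapted_def)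
  obtain x where f: "f = (\<lambda>u. \<Sum>k<M. x k * phi g k u)" using f regularized_conjugate_eq[OF i0 gb] by blast
  show ?thesis
    using eventually_generic[OF gb]
  proof eventually_elim
    case (elim v)
    have "(\<Sum>j\<le>M. poly (B (M - j)) (v - of_nat j) * f (v - of_nat j)) =
      (\<Sum>k<M. x k * (\<Sum>j\<le>M. poly (B (M - j)) (v - of_nat j) * phi g k (v - of_nat j)))"
      unfolding f sum_distrib_left by (subst sum.swap) (simp add: mult_ac)
    also have "\<dots> = 0"
      using phi_adjoint_equation[OF gb _ M_pos[OF i0]] elim by (intro sum.neutral) auto
    finally show ?case .
  qed
qed

text \<open>
  Multiply the adjoint equation by \<open>v - s\<close> and let \<open>v \<rightarrow> s\<close>; all poles are simple.
\<close>

lemma residue_equation: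
  assumes i0: "i0 \<in> {1..n}" and f: "f \<in> regularized_conjugate U M B"
  shows "(\<Sum>j\<le>M. poly (B (M - j)) (s - of_nat j) * residue f (s - of_nat j)) = 0"
proof -
  have lim: "((\<lambda>v. (v - s) * f (v - of_nat j)) \<longlongrightarrow> residue f (s - of_nat j)) (at s)" for j
  proof -
    have "filterlim (\<lambda>v. v - of_nat j) (at (s - of_nat j)) (at s)"
      by (intro filterlim_atI tendsto_intros) (auto simp: eventually_at_filter)
    from filterlim_compose[OF simple_pole_at_residue(1)[OF conjugate_simple_pole[OF i0 f]] this]
    show ?thesis by simp
  qed
  have "((\<lambda>v. \<Sum>j\<le>M. poly (B (M - j)) (v - of_nat j) * ((v - s) * f (v - of_nat j))) \<longlongrightarrow>
      (\<Sum>j\<le>M. poly (B (M - j)) (s - of_nat j) * residue f (s - of_nat j))) (at s)"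
    by (intro tendsto_intros lim)
  moreover have "\<forall>\<^sub>F v in at s. (\<Sum>j\<le>M. poly (B (M - j)) (v - of_nat j) * ((v - s) * f (v - of_nat j))) = 0"
    using conjugate_adjoint[OF i0 f, of s]
  proof eventually_elim
    case (elim v)
    have "(\<Sum>j\<le>M. poly (B (M - j)) (v - of_nat j) * ((v - s) * f (v - of_nat j))) =
        (v - s) * (\<Sum>j\<le>M. poly (B (M - j)) (v - of_nat j) * f (v - of_nat j))"
      by (simp add: sum_distrib_left mult_ac)
    then show ?case using elim by simp
  qed
  ultimately have "((\<lambda>v. 0) \<longlongrightarrow> (\<Sum>j\<le>M. poly (B (M - j)) (s - of_nat j) * residue f (s - of_nat j))) (at s)"
    by (rule Lim_transform_eventually)
  from tendsto_unique[OF trivial_limit_at this tendsto_const] show ?thesis .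
qed

text \<open>
  Take \<open>f = \<Sum>\<^sub>k g\<^sub>k(\<mu> i + r') \<phi>\<^sub>k\<close>. Near \<open>\<mu> i + r\<close> with \<open>r \<le> r'\<close> its singular part
  is that of \<open>\<Sum>\<^sub>k g\<^sub>k(u + r' - r) \<phi>\<^sub>k(u)\<close>, which is \<open>0\<close> for \<open>r < r'\<close> and
  \<open>- 1 / B\<^sub>M(u)\<close> for \<open>r = r'\<close>, and \<open>B\<^sub>M\<close> has a simple root there.
\<close>

lemma triangular_element:
  assumes i: "i \<in> {1..n}" and r': "r' < Ns i"
  shows "\<exists>f\<in>regularized_conjugate U M B.
    residue f (\<mu> i + of_nat r') \<noteq> 0 \<and> (\<forall>r<r'. residue f (\<mu> i + of_nat r) = 0)"
proof -
  obtain g where g: "adapted i g" using adapted_exists[OF i] by blast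
  then have gb: "family_basis M g U" by (simp add: adapted_def)
  let ?s' = "\<mu> i + of_nat r'"
  define f where "f = (\<lambda>u. \<Sum>k<M. g k ?s' * phi g k u)"
  have fU: "f \<in> regularized_conjugate U M B"
    unfolding f_def regularized_conjugate_eq[OF i gb] mem_Collect_eq by (rule exI[of _ "\<lambda>k. g k ?s'"]) simp
  have lim: "((\<lambda>u. (u - (\<mu> i + of_nat r)) * (if r = r' then - 1 / poly (B M) u else 0)) \<longlongrightarrow>
      residue f (\<mu> i + of_nat r)) (at (\<mu> i + of_nat r))" if r: "r \<le> r'" for r
  proof -
    let ?s = "\<mu> i + of_nat r"
    have sp: "\<And>k. k < M \<Longrightarrow> simple_pole_at (phi g k) ?s" by (rule phi_simple_pole[OF i g])
    have s': "?s' = ?s + of_nat (r' - r)" using r by (simp add: of_nat_diff)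
    have res: "residue f ?s = (\<Sum>k<M. g k (?s + of_nat (r' - r)) * residue (phi g k) ?s)"
      unfolding f_def s' by (rule residue_sum_simple[OF sp])
    have cont: "((\<lambda>u. g k (u + of_nat (r' - r))) \<longlongrightarrow> g k (?s + of_nat (r' - r))) (at ?s)" if "k < M" for k
    proof -
      have "(\<lambda>u. g k (u + of_nat (r' - r))) holomorphic_on UNIV"
        by (intro holomorphic_shift adapted_holomorphic[OF g that])
      then have "isCont (\<lambda>u. g k (u + of_nat (r' - r))) ?s"
        using holomorphic_on_imp_continuous_on continuous_on_eq_continuous_at open_UNIV by blast
      then show ?thesis by (simp add: isCont_def)
    qed
    have "((\<lambda>u. \<Sum>k<M. g k (u + of_nat (r' - r)) * ((u - ?s) * phi g k u)) \<longlongrightarrow> residue f ?s) (at ?s)"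
      unfolding res by (intro tendsto_sum tendsto_mult cont simple_pole_at_residue(1) sp) auto
    moreover have "\<forall>\<^sub>F u in at ?s. (\<Sum>k<M. g k (u + of_nat (r' - r)) * ((u - ?s) * phi g k u)) =
        (u - ?s) * (if r = r' then - 1 / poly (B M) u else 0)"
      using eventually_generic[OF gb, of ?s]
    proof eventually_elim
      case (elim u)
      then have W: "casoratian M g u \<noteq> 0" using elim[rule_format, of 0] by (simp add: generic_def)
      have "r' - r < M" using r' Ns_le[OF i] by simp
      then have "(\<Sum>k<M. phi g k u * g k (u + of_nat (r' - r))) = (if r' - r = 0 then - 1 / poly (B M) u else 0)"
        by (rule sum_phi[OF W])
      moreover have "(\<Sum>k<M. g k (u + of_nat (r' - r)) * ((u - ?s) * phi g k u)) =
          (u - ?s) * (\<Sum>k<M. phi g k u * g k (u + of_nat (r' - r)))"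
        by (simp add: sum_distrib_left mult_ac)
      ultimately show ?case using r by simp
    qed
    ultimately show ?thesis by (rule Lim_transform_eventually)
  qed
  have "residue f (\<mu> i + of_nat r) = 0" if "r < r'" for r
  proof -
    have "((\<lambda>u. 0) \<longlongrightarrow> residue f (\<mu> i + of_nat r)) (at (\<mu> i + of_nat r))" using lim[of r] that by simp
    from tendsto_unique[OF trivial_limit_at this tendsto_const] show ?thesis .
  qed
  moreover have "residue f ?s' \<noteq> 0"
  proof
    assume z: "residue f ?s' = 0"
    have "Polynomial.order ?s' (B M) = 1" using BM_order_string[OF i] r' by simp
    then obtain C where C: "B M = [:- ?s', 1:] * C" "\<not> [:- ?s', 1:] dvd C"
      using order_decomp[OF BM_order(2)[OF i], of ?s'] by auto
    have C0: "poly C ?s' \<noteq> 0" using C(2) by (simp add: poly_eq_0_iff_dvd)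
    have "((\<lambda>u. - 1 / poly C u) \<longlongrightarrow> - 1 / poly C ?s') (at ?s')"
      using C0 by (intro tendsto_intros)
    moreover have "\<forall>\<^sub>F u in at ?s'. - 1 / poly C u = (u - ?s') * (if r' = r' then - 1 / poly (B M) u else 0)"
    proof -
      have "poly (B M) u = (u - ?s') * poly C u" for u
        unfolding C(1) poly_mult by simp
      then have "- 1 / poly C u = (u - ?s') * (if r' = r' then - 1 / poly (B M) u else 0)" if "u \<noteq> ?s'" for u
        using that by simp
      then show ?thesis unfolding eventually_at_filter by (intro always_eventually allI impI)
    qed
    ultimately have "((\<lambda>u. (u - ?s') * (if r' = r' then - 1 / poly (B M) u else 0)) \<longlongrightarrow> - 1 / poly C ?s') (at ?s')"
      by (rule Lim_transform_eventually)
    from tendsto_unique[OF _ this lim[OF order_refl]] have "- 1 / poly C ?s' = 0" using z by simp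
    then show False using C0 by simp
  qed
  ultimately show ?thesis using fU by blast
qed

end

section \<open>The dual space as a space of quasi-polynomials\<close>

lemma xdx_eq_deriv: "xdx = deriv"
  by (simp add: fun_eq_iff xdx_def dx_def)

lemma higher_deriv_exp_scaled: "(deriv ^^ i) (\<lambda>t. exp (c * t)) = (\<lambda>t::complex. c ^ i * exp (c * t))"
proof (induction i)
  case (Suc i)
  have "deriv (\<lambda>t. c ^ i * exp (c * t)) t = c ^ Suc i * exp (c * t)" for t
    by (rule DERIV_imp_deriv) (auto intro!: derivative_eq_intros)
  then show ?case unfolding funpow.simps o_apply Suc.IH by (rule ext)
qed simp

lemma higher_deriv_linear_UNIV:
  assumes "F holomorphic_on UNIV" "G holomorphic_on UNIV"
  shows "(deriv ^^ i) (\<lambda>t. c * F t + G t) t = c * (deriv ^^ i) F t + (deriv ^^ i) G t"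
proof -
  have "(deriv ^^ i) (\<lambda>t. c * F t + G t) t = (deriv ^^ i) (\<lambda>t. c * F t) t + (deriv ^^ i) G t"
    using assms by (intro higher_deriv_add[of _ UNIV]) (auto intro!: holomorphic_intros)
  also have "(deriv ^^ i) (\<lambda>t. c * F t) t = c * (deriv ^^ i) F t"
    using assms by (intro higher_deriv_cmult[of _ UNIV]) auto
  finally show ?thesis .
qed

lemma dual_operator_linear:
  assumes "F holomorphic_on UNIV" "G holomorphic_on UNIV"
  shows "dual_differential_operator N M A (\<lambda>t. c * F t + G t) t =
    c * dual_differential_operator N M A F t + dual_differential_operator N M A G t"
  unfolding dual_differential_operator_def xdx_eq_deriv higher_deriv_linear_UNIV[OF assms]
  by (simp add: sum_distrib_left sum.distrib algebra_simps)

lemma dual_operator_zero: "dual_differential_operator N M A (\<lambda>t. 0) t = 0"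
proof -
  have "(deriv ^^ i) (\<lambda>t::complex. 0::complex) = (\<lambda>t. 0)" for i by (induction i) auto
  then show ?thesis by (simp add: dual_differential_operator_def xdx_eq_deriv)
qed

lemma dual_operator_sum:
  assumes "finite R" "\<And>r. r \<in> R \<Longrightarrow> F r holomorphic_on UNIV"
  shows "dual_differential_operator N M A (\<lambda>t. \<Sum>r\<in>R. c r * F r t) t =
    (\<Sum>r\<in>R. c r * dual_differential_operator N M A (F r) t)"
  using assms
proof (induction R rule: finite_induct)
  case (insert a R)
  have "(\<lambda>t. \<Sum>r\<in>R. c r * F r t) holomorphic_on UNIV" using insert by (intro holomorphic_intros) auto
  then show ?case using insert dual_operator_linear[of "F a" "\<lambda>t. \<Sum>r\<in>R. c r * F r t"] by simp
qed (simp add: dual_operator_zero)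

lemma simple_pole_at_mult_exp:
  assumes "simple_pole_at f s"
  shows "residue (\<lambda>u. exp (u * t) * f u) s = exp (s * t) * residue f s"
proof -
  obtain \<psi> where \<psi>: "\<psi> analytic_on {s}" "\<forall>\<^sub>F u in at s. f u = \<psi> u / (u - s)"
    using assms unfolding simple_pole_at_def by blast
  have "(\<lambda>u. exp (u * t) * \<psi> u) analytic_on {s}" using \<psi>(1) by (intro analytic_intros)
  moreover have "\<forall>\<^sub>F u in at s. exp (u * t) * f u = (exp (u * t) * \<psi> u) / (u - s)"
    using \<psi>(2) by eventually_elim simp
  ultimately have "simple_pole_at (\<lambda>u. exp (u * t) * f u) s" unfolding simple_pole_at_def by blast
  moreover have "((\<lambda>u. exp (u * t) * ((u - s) * f u)) \<longlongrightarrow> exp (s * t) * residue f s) (at s)"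
    by (intro tendsto_intros simple_pole_at_residue(1) assms)
  then have "((\<lambda>u. (u - s) * (exp (u * t) * f u)) \<longlongrightarrow> exp (s * t) * residue f s) (at s)"
    by (simp add: mult_ac)
  ultimately show ?thesis by (rule simple_pole_at_residue(2))
qed

context bispectral_setup
begin

abbreviation conjugate_space :: "(complex \<Rightarrow> complex) set" where "conjugate_space \<equiv> regularized_conjugate U M B"

lemma conjugate_space_combination:
  fixes K :: nat
  assumes "\<And>a. a < K \<Longrightarrow> f a \<in> conjugate_space" shows "(\<lambda>u. \<Sum>a<K. x a * f a u) \<in> conjugate_space"
proof -
  have "(\<lambda>u. \<Sum>a<K. x a * f a u) = (\<Sum>a<K. (\<lambda>u. x a * f a u))"
    by (simp add: fun_eq_iff sum_functions_apply)
  also have "\<dots> \<in> conjugate_space"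
    using assms unfolding regularized_conjugate_def by (intro cfun.span_sum cfun.span_scale) auto
  finally show ?thesis .
qed

text \<open>
  By the residue theorem \<open>f\<close> contributes \<open>2\<pi>\<i> x\<^bsup>\<mu>\<^esup> R(x)\<close> to the dual space, with \<open>\<mu>\<close> the start
  of the \<open>i\<close>-th string and \<open>R\<close> this polynomial.
\<close>

definition residue_poly :: "nat \<Rightarrow> (complex \<Rightarrow> complex) \<Rightarrow> complex poly" where
  "residue_poly i f = (\<Sum>r\<le>ns i (Ns i). Polynomial.monom (residue f (\<mu> i + of_nat r)) r)"

lemma beyond_string: "i \<in> {1..n} \<Longrightarrow> r > ns i (Ns i) \<Longrightarrow> \<mu> i + of_nat r \<notin> strings"
proof
  assume i: "i \<in> {1..n}" and r: "r > ns i (Ns i)" and "\<mu> i + of_nat r \<in> strings"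
  then obtain j r' where "j \<in> {1..n}" "r' \<le> ns j (Ns j)" "\<mu> i + of_nat r = \<mu> j + of_nat r'"
    using pole_string_iff by blast
  then show False using string_inj[OF i, of j r r'] r by auto
qed

lemma below_string: "i \<in> {1..n} \<Longrightarrow> k > 0 \<Longrightarrow> \<mu> i - of_nat k \<notin> strings"
proof
  assume i: "i \<in> {1..n}" and k: "k > 0" and "\<mu> i - of_nat k \<in> strings"
  then obtain j r' where j: "j \<in> {1..n}" "\<mu> i - of_nat k = \<mu> j + of_nat r'"
    using pole_string_iff by blast
  then have "\<mu> i + of_nat 0 = \<mu> j + of_nat (r' + k)" by (simp add: algebra_simps)
  then show False using string_inj[OF i j(1)] k by fastforce
qed

lemma coeff_residue_poly:
  assumes i: "i \<in> {1..n}" and f: "f \<in> conjugate_space"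
  shows "coeff (residue_poly i f) r = residue f (\<mu> i + of_nat r)"
proof -
  have "coeff (residue_poly i f) r = (\<Sum>r'\<le>ns i (Ns i). if r' = r then residue f (\<mu> i + of_nat r) else 0)"
    unfolding residue_poly_def coeff_sum by (intro sum.cong) auto
  also have "\<dots> = residue f (\<mu> i + of_nat r)"
    using conjugate_off_strings(2)[OF i f beyond_string[OF i, of r]] by auto
  finally show ?thesis .
qed

lemma residue_poly_combination:
  fixes K :: nat
  assumes i: "i \<in> {1..n}" and f: "\<And>a. a < K \<Longrightarrow> f a \<in> conjugate_space"
  shows "residue_poly i (\<lambda>u. \<Sum>a<K. x a * f a u) = (\<Sum>a<K. Polynomial.smult (x a) (residue_poly i (f a)))"
proof (rule poly_eqI)
  fix r
  have "residue (\<lambda>u. \<Sum>a<K. x a * f a u) (\<mu> i + of_nat r) = (\<Sum>a<K. x a * residue (f a) (\<mu> i + of_nat r))"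
    by (intro residue_sum_simple conjugate_simple_pole[OF i] f)
  then show "coeff (residue_poly i (\<lambda>u. \<Sum>a<K. x a * f a u)) r =
      coeff (\<Sum>a<K. Polynomial.smult (x a) (residue_poly i (f a))) r"
    using coeff_residue_poly[OF i f] coeff_residue_poly[OF i conjugate_space_combination[OF f]]
    by (simp add: coeff_sum)
qed

lemma contour_integral_conjugate:
  assumes i: "i \<in> {1..n}" and f: "f \<in> conjugate_space" and \<gamma>: "separating_contours n Ns ns l \<gamma>"
  shows "contour_integral (\<gamma> i) (\<lambda>u. exp (u * t) * f u) =
     (of_real (2 * pi) * \<i>) * (exp (\<mu> i * t) * poly (residue_poly i f) (exp t))"
proof -
  let ?F = "\<lambda>u. exp (u * t) * f u" and ?g = "\<gamma> i" and ?S = "pole_string Ns ns l i"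
  have jc: "valid_path ?g" "pathfinish ?g = pathstart ?g"
      "\<And>w. w \<in> inside (path_image ?g) \<Longrightarrow> winding_number ?g w = 1"
    and ins: "?S \<subseteq> inside (path_image ?g)"
    and out: "\<And>j. j \<in> {1..n} \<Longrightarrow> j \<noteq> i \<Longrightarrow> pole_string Ns ns l j \<subseteq> outside (path_image ?g)"
    using \<gamma> i unfolding separating_contours_def counterclockwise_jordan_curve_def by blast+
  have avoid: "path_image ?g \<subseteq> UNIV - strings"
  proof -
    have "pole_string Ns ns l j \<inter> path_image ?g = {}" if j: "j \<in> {1..n}" for j
      using ins out[OF j] inside_no_overlap[of "path_image ?g"] outside_no_overlap[of "path_image ?g"]
      by (cases "j = i") blast+
    then show ?thesis by blast
  qed
  have "contour_integral ?g ?F = of_real (2 * pi) * \<i> * (\<Sum>p\<in>strings. winding_number ?g p * residue ?F p)"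
  proof (rule Residue_theorem)
    have "f holomorphic_on UNIV - strings"
      using conjugate_holomorphic[OF i f] by (simp add: Compl_eq_Diff_UNIV)
    then show "?F holomorphic_on UNIV - strings" by (intro holomorphic_intros)
  qed (use jc avoid finite_strings in auto)
  also have "(\<Sum>p\<in>strings. winding_number ?g p * residue ?F p) = (\<Sum>p\<in>?S. winding_number ?g p * residue ?F p)"
  proof (rule sum.mono_neutral_right[OF finite_strings])
    show "?S \<subseteq> strings" using i by blast
    show "\<forall>p\<in>strings - ?S. winding_number ?g p * residue ?F p = 0"
    proof
      fix p assume "p \<in> strings - ?S"
      then obtain j where "j \<in> {1..n}" "j \<noteq> i" "p \<in> pole_string Ns ns l j" by blast
      then have "p \<in> outside (path_image ?g)" using out by blast
      then have "winding_number ?g p = 0"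
        using jc by (intro winding_number_zero_in_outside valid_path_imp_path)
      then show "winding_number ?g p * residue ?F p = 0" by simp
    qed
  qed
  also have "\<dots> = (\<Sum>p\<in>?S. exp (p * t) * residue f p)"
    using ins jc(3) simple_pole_at_mult_exp[OF conjugate_simple_pole[OF i f]]
    by (intro sum.cong refl) auto
  also have "?S = (\<lambda>r. \<mu> i + of_nat r) ` {..ns i (Ns i)}" by (auto simp: pole_string_def)
  also have "(\<Sum>p\<in>(\<lambda>r. \<mu> i + of_nat r) ` {..ns i (Ns i)}. exp (p * t) * residue f p) =
      (\<Sum>r\<le>ns i (Ns i). exp ((\<mu> i + of_nat r) * t) * residue f (\<mu> i + of_nat r))"
    by (subst sum.reindex) (auto simp: inj_on_def)
  also have "\<dots> = exp (\<mu> i * t) * poly (residue_poly i f) (exp t)"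
  proof -
    have "exp ((\<mu> i + of_nat r) * t) = exp (\<mu> i * t) * exp t ^ r" for r
      by (simp add: distrib_right exp_add exp_of_nat_mult)
    then show ?thesis
      unfolding residue_poly_def poly_sum sum_distrib_left
      by (intro sum.cong refl) (simp only: poly_monom mult_ac)
  qed
  finally show ?thesis .
qed

text \<open>
  In the residue equation at \<open>M\<close> steps beyond the last pole of \<open>f\<close> on the string only the term with
  \<open>B\<^sub>0\<close> is left, so this pole is a root of \<open>B\<^sub>0\<close>.
\<close>

lemma degree_residue_poly:
  assumes i: "i \<in> {1..n}" and f: "f \<in> conjugate_space" and nz: "residue_poly i f \<noteq> 0"
  shows "degree (residue_poly i f) \<in> ns i ` {1..Ns i}"
proof -
  let ?D = "degree (residue_poly i f)"
  let ?s = "\<mu> i + of_nat (?D + M)"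
  have pt: "?s - of_nat j = \<mu> i + of_nat (?D + M - j)" if "j \<le> M" for j
    using that by (simp add: of_nat_diff)
  have "0 = (\<Sum>j\<le>M. poly (B (M - j)) (?s - of_nat j) * residue f (?s - of_nat j))"
    by (rule residue_equation[OF i f, symmetric])
  also have "\<dots> = (\<Sum>j\<le>M. if j = M then poly (B 0) (\<mu> i + of_nat ?D) * lead_coeff (residue_poly i f) else 0)"
  proof (intro sum.cong refl)
    fix j assume j: "j \<in> {..M}"
    have "residue f (?s - of_nat j) = coeff (residue_poly i f) (?D + M - j)"
      using j unfolding coeff_residue_poly[OF i f] by (simp only: pt atMost_iff)
    moreover have "coeff (residue_poly i f) (?D + M - j) = 0" if "j \<noteq> M"
      using that j by (intro coeff_eq_0) auto
    ultimately show "poly (B (M - j)) (?s - of_nat j) * residue f (?s - of_nat j) =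
       (if j = M then poly (B 0) (\<mu> i + of_nat ?D) * lead_coeff (residue_poly i f) else 0)"
      by (cases "j = M") (simp_all add: algebra_simps)
  qed
  finally have "poly (B 0) (\<mu> i + of_nat ?D) = 0" using nz by simp
  then obtain i' j where ij: "i' \<in> {1..n}" "j \<in> {1..Ns i'}" "\<mu> i + of_nat ?D = \<mu> i' + of_nat (ns i' j)"
    using B0_roots[OF i] by blast
  then have "i = i' \<and> ?D = ns i' j" by (intro string_inj[OF i])
  then show ?thesis using ij by blast
qed

lemma residue_poly_zero:
  assumes i: "i \<in> {1..n}" and f: "f \<in> conjugate_space" and z: "\<And>j. j \<in> {1..Ns i} \<Longrightarrow> coeff (residue_poly i f) (ns i j) = 0"
  shows "residue_poly i f = 0"
proof (rule ccontr)
  assume nz: "residue_poly i f \<noteq> 0"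
  from degree_residue_poly[OF i f this] obtain j where "j \<in> {1..Ns i}" "degree (residue_poly i f) = ns i j" by blast
  then have "lead_coeff (residue_poly i f) = 0" using z by simp
  then show False using nz by simp
qed

lemma order_0_eqI:
  fixes p :: "complex poly"
  assumes "\<And>r. r < k \<Longrightarrow> coeff p r = 0" "coeff p k \<noteq> 0"
  shows "p \<noteq> 0" "Polynomial.order 0 p = k"
proof -
  show p: "p \<noteq> 0" using assms(2) by auto
  have "k \<le> Polynomial.order 0 p" using assms(1) p monom_1_dvd_iff monom_1_dvd_iff' by blast
  moreover have "\<not> Suc k \<le> Polynomial.order 0 p"
    using assms(2) p monom_1_dvd_iff[OF p, of "Suc k"] monom_1_dvd_iff'[of "Suc k" p] by auto
  ultimately show "Polynomial.order 0 p = k" by simp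
qed

text \<open>
  A residue polynomial is determined by its \<open>N\<^sub>i\<close> coefficients at the \<open>n\<^sub>i\<^sub>j\<close>, since these
  include the leading one. The triangular elements provide \<open>N\<^sub>i\<close> independent residue polynomials, so these
  coefficients can be prescribed.
\<close>

lemma dual_elements:
  assumes i: "i \<in> {1..n}"
  shows "\<exists>F. \<forall>e\<in>{1..Ns i}. F e \<in> conjugate_space \<and>
     (\<forall>j\<in>{1..Ns i}. coeff (residue_poly i (F e)) (ns i j) = (if j = e then 1 else 0))"
proof -
  have "\<forall>r. \<exists>f. r < Ns i \<longrightarrow> f \<in> conjugate_space \<and> residue f (\<mu> i + of_nat r) \<noteq> 0 \<and> (\<forall>r'<r. residue f (\<mu> i + of_nat r') = 0)"
    using triangular_element[OF i] by blast
  then obtain f where f: "\<And>r. r < Ns i \<Longrightarrow> f r \<in> conjugate_space"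
    "\<And>r. r < Ns i \<Longrightarrow> coeff (residue_poly i (f r)) r \<noteq> 0"
    "\<And>r r'. r < Ns i \<Longrightarrow> r' < r \<Longrightarrow> coeff (residue_poly i (f r)) r' = 0"
    using coeff_residue_poly[OF i] by metis
  define a where "a e r = coeff (residue_poly i (f r)) (ns i e)" for e r
  have comb: "coeff (residue_poly i (\<lambda>u. \<Sum>r<Ns i. x r * f r u)) k = (\<Sum>r<Ns i. coeff (residue_poly i (f r)) k * x r)" for x k
    using residue_poly_combination[OF i f(1), where K = "Ns i" and x = x] by (simp add: coeff_sum mult.commute)
  (* The orders at 0 are distinct, hence the lowest coefficients give x = 0. *)
  have inj: "\<forall>r\<in>{..<Ns i}. x r = 0" if z: "\<And>e. e \<in> {1..Ns i} \<Longrightarrow> (\<Sum>r\<in>{..<Ns i}. a e r * x r) = 0" for x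
  proof -
    have "residue_poly i (\<lambda>u. \<Sum>r<Ns i. x r * f r u) = 0"
      using z by (intro residue_poly_zero[OF i] conjugate_space_combination f(1)) (auto simp: comb a_def)
    then have s0: "(\<Sum>r<Ns i. coeff (residue_poly i (f r)) k * x r) = 0" for k
      using comb[of x k] by simp
    have "x k = 0" if "k < Ns i" for k
      using that
    proof (induction k rule: less_induct)
      case (less k)
      have "0 = (\<Sum>r<Ns i. if r = k then coeff (residue_poly i (f k)) k * x k else 0)"
      proof (subst s0[of k, symmetric], intro sum.cong refl)
        fix r assume "r \<in> {..<Ns i}"
        then show "coeff (residue_poly i (f r)) k * x r = (if r = k then coeff (residue_poly i (f k)) k * x k else 0)"
          using less.IH[of r] f(3)[of r k] by (cases r k rule: linorder_cases) auto
      qed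
      then show ?case using less.prems f(2)[of k] by simp
    qed
    then show ?thesis by blast
  qed
  have "\<exists>F. F \<in> conjugate_space \<and> (\<forall>j\<in>{1..Ns i}. coeff (residue_poly i F) (ns i j) = (if j = e then 1 else 0))"
    if e: "e \<in> {1..Ns i}" for e
  proof -
    obtain x where x: "\<forall>j\<in>{1..Ns i}. (\<Sum>r\<in>{..<Ns i}. a j r * x r) = (if j = e then 1 else 0)"
      using dual_solution[of "{1..Ns i}" "{..<Ns i}" e a, OF _ _ _ e inj] by auto
    have "(\<lambda>u. \<Sum>r<Ns i. x r * f r u) \<in> conjugate_space" by (intro conjugate_space_combination f(1))
    moreover have "\<forall>j\<in>{1..Ns i}. coeff (residue_poly i (\<lambda>u. \<Sum>r<Ns i. x r * f r u)) (ns i j) = (if j = e then 1 else 0)"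
      using x by (simp add: comb a_def)
    ultimately show ?thesis by blast
  qed
  then show ?thesis by (intro bchoice) blast
qed

text \<open>
  The difference of both sides is the residue polynomial of a combination of \<open>f\<close> and the \<open>F e\<close>, and its
  coefficients at all \<open>n\<^sub>i\<^sub>j\<close> vanish.
\<close>

lemma residue_poly_expand:
  assumes i: "i \<in> {1..n}" and f: "f \<in> conjugate_space"
    and F: "\<And>e. e \<in> {1..Ns i} \<Longrightarrow> F e \<in> conjugate_space"
      "\<And>e j. e \<in> {1..Ns i} \<Longrightarrow> j \<in> {1..Ns i} \<Longrightarrow> coeff (residue_poly i (F e)) (ns i j) = (if j = e then 1 else 0)"
  shows "residue_poly i f = (\<Sum>e=1..Ns i. Polynomial.smult (coeff (residue_poly i f) (ns i e)) (residue_poly i (F e)))"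
proof -
  define c where "c e = coeff (residue_poly i f) (ns i e)" for e
  (* The index 0 is free for f, as the F e are indexed from 1. *)
  define G where "G a = (if a = 0 then f else F a)" for a
  define x where "x a = (if a = 0 then 1 else - c a)" for a
  have G: "G a \<in> conjugate_space" if "a < Suc (Ns i)" for a using that f F(1) by (auto simp: G_def)
  have split: "(\<Sum>a<Suc (Ns i). Polynomial.smult (x a) (residue_poly i (G a))) =
     residue_poly i f - (\<Sum>e=1..Ns i. Polynomial.smult (c e) (residue_poly i (F e)))"
  proof -
    have "(\<Sum>a<Suc (Ns i). Polynomial.smult (x a) (residue_poly i (G a))) =
       residue_poly i f + (\<Sum>a<Ns i. Polynomial.smult (- c (Suc a)) (residue_poly i (F (Suc a))))"
      by (subst sum.lessThan_Suc_shift) (simp add: x_def G_def)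
    also have "(\<Sum>a<Ns i. Polynomial.smult (- c (Suc a)) (residue_poly i (F (Suc a)))) =
        - (\<Sum>e=1..Ns i. Polynomial.smult (c e) (residue_poly i (F e)))"
      by (simp add: sum.atLeast1_atMost_eq sum_negf)
    finally show ?thesis by simp
  qed
  let ?h = "\<lambda>u. \<Sum>a<Suc (Ns i). x a * G a u"
  have hU: "?h \<in> conjugate_space" by (rule conjugate_space_combination) (rule G)
  have h: "residue_poly i ?h = residue_poly i f - (\<Sum>e=1..Ns i. Polynomial.smult (c e) (residue_poly i (F e)))"
    by (rule trans[OF residue_poly_combination[OF i] split]) (rule G)
  have "residue_poly i ?h = 0"
  proof (rule residue_poly_zero[OF i hU])
    fix j assume j: "j \<in> {1..Ns i}"
    have "coeff (\<Sum>e=1..Ns i. Polynomial.smult (c e) (residue_poly i (F e))) (ns i j) = (\<Sum>e=1..Ns i. if e = j then c j else 0)"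
      unfolding coeff_sum using F(2) j by (intro sum.cong) auto
    then show "coeff (residue_poly i ?h) (ns i j) = 0"
      unfolding h using j by (simp add: c_def)
  qed
  then show ?thesis unfolding h by (simp add: c_def)
qed

end

section \<open>The dual operator and its exponents\<close>

lemma exponentials_independent_family:
  fixes c e :: "'a \<Rightarrow> complex"
  assumes A: "finite A" "inj_on e A" and z: "\<And>t. (\<Sum>a\<in>A. c a * exp (e a * t)) = 0" and a: "a \<in> A"
  shows "c a = 0"
proof -
  define c' where "c' x = c (inv_into A e x)" for x
  have c': "c' (e a) = c a" if "a \<in> A" for a using inv_into_f_f[OF A(2) that] by (simp add: c'_def)
  have "(\<Sum>x\<in>e ` A. c' x * exp (x * t)) = 0" for t
  proof -
    have "(\<Sum>x\<in>e ` A. c' x * exp (x * t)) = (\<Sum>a\<in>A. c' (e a) * exp (e a * t))"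
      by (subst sum.reindex[OF A(2)]) (simp add: o_def)
    also have "\<dots> = (\<Sum>a\<in>A. c a * exp (e a * t))" using c' by (intro sum.cong) auto
    finally show ?thesis using z by simp
  qed
  from exponentials_independent[OF _ this] A(1) a c'[OF a] show ?thesis by auto
qed

lemma higher_deriv_poly_exp:
  "(deriv ^^ r) (\<lambda>t. poly p (exp t)) = (\<lambda>t. poly ((euler ^^ r) p) (exp t))"
proof (induction r)
  case (Suc r)
  have "deriv (\<lambda>t. poly q (exp t)) t = poly (euler q) (exp t)" for q :: "complex poly" and t
    by (rule DERIV_imp_deriv) (auto intro!: derivative_eq_intros simp: euler_def)
  then show ?case unfolding funpow.simps o_apply Suc.IH by (intro ext)
qed simp

lemma dx_power_holomorphic:
  assumes "F holomorphic_on S" "open S"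
  shows "(dx ^^ k) F holomorphic_on S"
proof (induction k)
  case (Suc k)
  have "(\<lambda>t. deriv ((dx ^^ k) F) t / exp t) holomorphic_on S"
    using Suc assms(2) by (intro holomorphic_intros holomorphic_deriv) auto
  then show ?case by (simp add: dx_def[abs_def])
qed (use assms in simp)

text \<open>
  The expansion of \<open>(x d/dx)\<^sup>i\<close> in the operators \<open>x\<^sup>k (d/dx)\<^sup>k\<close>.
\<close>

lemma higher_deriv_Stirling:
  assumes F: "F holomorphic_on S" and S: "open S" and t: "t \<in> S"
  shows "(deriv ^^ i) F t = (\<Sum>k\<le>i. of_nat (Stirling i k) * exp t ^ k * (dx ^^ k) F t)"
  using t
proof (induction i arbitrary: t)
  case (Suc i)
  let ?D = "\<lambda>k. (dx ^^ k) F"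
  let ?R = "\<lambda>t. \<Sum>k\<le>i. of_nat (Stirling i k) * exp t ^ k * ?D k t"
  have d: "(?D k has_field_derivative exp t * ?D (Suc k) t) (at t)" for k
  proof -
    have "(?D k has_field_derivative deriv (?D k) t) (at t)"
      using dx_power_holomorphic[OF F S, of k] S Suc.prems by (rule holomorphic_derivI)
    then show ?thesis by (simp add: dx_def)
  qed
  have "(?R has_field_derivative (\<Sum>k\<le>i. of_nat (Stirling i k) *
      (of_nat k * exp t ^ k * ?D k t + exp t ^ k * (exp t * ?D (Suc k) t)))) (at t)"
  proof (rule DERIV_sum)
    fix k
    have "((\<lambda>t. exp t ^ k) has_field_derivative of_nat k * exp t ^ k) (at t)"
      using DERIV_power[OF DERIV_exp[of t], of k] by (cases k) auto
    from DERIV_cmult[OF DERIV_mult[OF this d[of k]], of "of_nat (Stirling i k)"]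
    show "((\<lambda>t. of_nat (Stirling i k) * exp t ^ k * ?D k t) has_field_derivative
        of_nat (Stirling i k) * (of_nat k * exp t ^ k * ?D k t + exp t ^ k * (exp t * ?D (Suc k) t))) (at t)"
      by (simp add: mult_ac add.commute)
  qed
  then have "deriv ?R t = (\<Sum>k\<le>i. of_nat (Stirling i k) *
      (of_nat k * exp t ^ k * ?D k t + exp t ^ k * (exp t * ?D (Suc k) t)))" by (rule DERIV_imp_deriv)
  moreover have "deriv ((deriv ^^ i) F) t = deriv ?R t"
    by (rule complex_derivative_transform_within_open[OF _ _ S Suc.prems])
       (use F S Suc.IH in \<open>auto intro!: holomorphic_intros holomorphic_higher_deriv dx_power_holomorphic\<close>)
  ultimately have "(deriv ^^ Suc i) F t = (\<Sum>k\<le>i. of_nat (Stirling i k) *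
      (of_nat k * exp t ^ k * ?D k t + exp t ^ k * (exp t * ?D (Suc k) t)))" by simp
  also have "\<dots> = (\<Sum>k\<le>i. of_nat k * of_nat (Stirling i k) * exp t ^ k * ?D k t) +
      (\<Sum>k\<le>i. of_nat (Stirling i k) * exp t ^ Suc k * ?D (Suc k) t)"
    unfolding sum.distrib[symmetric] by (intro sum.cong) (auto simp: algebra_simps)
  also have "(\<Sum>k\<le>i. of_nat k * of_nat (Stirling i k) * exp t ^ k * ?D k t) =
      (\<Sum>k\<le>Suc i. of_nat k * of_nat (Stirling i k) * exp t ^ k * ?D k t)"
    by simp
  also have "\<dots> = (\<Sum>k\<le>i. of_nat (Suc k) * of_nat (Stirling i (Suc k)) * exp t ^ Suc k * ?D (Suc k) t)"
    by (subst sum.atMost_Suc_shift) simp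
  also have "\<dots> + (\<Sum>k\<le>i. of_nat (Stirling i k) * exp t ^ Suc k * ?D (Suc k) t) =
      (\<Sum>k\<le>i. of_nat (Stirling (Suc i) (Suc k)) * exp t ^ Suc k * ?D (Suc k) t)"
    unfolding sum.distrib[symmetric] by (intro sum.cong) (auto simp: algebra_simps)
  also have "\<dots> = (\<Sum>k\<le>Suc i. of_nat (Stirling (Suc i) k) * exp t ^ k * ?D k t)"
    by (subst sum.atMost_Suc_shift) simp
  finally show ?case .
qed simp

lemma has_root_iff_deriv:
  assumes F: "F holomorphic_on UNIV"
  shows "has_root_of_multiplicity F t k \<longleftrightarrow> (\<forall>j<k. (deriv ^^ j) F t = 0) \<and> (deriv ^^ k) F t \<noteq> 0"
proof -
  have low: "(deriv ^^ i) F t = exp t ^ i * (dx ^^ i) F t" if "\<And>j. j < i \<Longrightarrow> (dx ^^ j) F t = 0" for i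
  proof -
    have "(deriv ^^ i) F t = (\<Sum>k\<le>i. if k = i then exp t ^ i * (dx ^^ i) F t else 0)"
      unfolding higher_deriv_Stirling[OF F open_UNIV UNIV_I] using that by (intro sum.cong) auto
    then show ?thesis by simp
  qed
  have "(\<forall>j<k. (dx ^^ j) F t = 0) \<longleftrightarrow> (\<forall>j<k. (deriv ^^ j) F t = 0)"
  proof
    assume "\<forall>j<k. (dx ^^ j) F t = 0"
    then show "\<forall>j<k. (deriv ^^ j) F t = 0" using low by simp
  next
    assume d: "\<forall>j<k. (deriv ^^ j) F t = 0"
    have "(dx ^^ j) F t = 0" if "j < k" for j
      using that
    proof (induction j rule: less_induct)
      case (less j)
      then have "(deriv ^^ j) F t = exp t ^ j * (dx ^^ j) F t" by (intro low) simp
      then show ?case using d less.prems by simp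
    qed
    then show "\<forall>j<k. (dx ^^ j) F t = 0" by blast
  qed
  then show ?thesis unfolding has_root_of_multiplicity_def using low[of k] by auto
qed

lemma higher_deriv_sum_UNIV:
  assumes "finite A" "\<And>a. a \<in> A \<Longrightarrow> F a holomorphic_on UNIV"
  shows "(deriv ^^ i) (\<lambda>t. \<Sum>a\<in>A. c a * F a t) t = (\<Sum>a\<in>A. c a * (deriv ^^ i) (F a) t)"
  using assms
proof (induction A rule: finite_induct)
  case empty
  have "(deriv ^^ i) (\<lambda>t::complex. 0::complex) = (\<lambda>t. 0)" by (induction i) auto
  then show ?case by simp
next
  case (insert a A)
  have "(\<lambda>t. \<Sum>a\<in>A. c a * F a t) holomorphic_on UNIV" using insert by (intro holomorphic_intros) auto
  then show ?case using insert higher_deriv_linear_UNIV[of "F a" "\<lambda>t. \<Sum>a\<in>A. c a * F a t"] by simp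
qed

context bispectral_setup
begin

abbreviation dual_op :: "(complex \<Rightarrow> complex) \<Rightarrow> complex \<Rightarrow> complex" where
  "dual_op \<equiv> dual_differential_operator N M (\<lambda>i j. coeff (B (M - j)) i)"

text \<open>
  The polynomials \<open>col i\<close> are the coefficients of the dual operator with respect to \<open>x d/dx\<close>.
\<close>

lemma dual_op_col: "dual_op F t = (\<Sum>i\<le>N. poly (col i) (exp t) * (deriv ^^ i) F t)"
proof -
  have "poly (col i) x = (\<Sum>j\<le>M. coeff (B (M - j)) i * x ^ j)" for i x
    unfolding poly_altdef_le[OF degree_col] by (intro sum.cong) (auto simp: coeff_column_poly)
  then show ?thesis
    by (simp add: dual_differential_operator_def xdx_eq_deriv sum_distrib_right)
qed

lemma dual_op_exp:
  "dual_op (\<lambda>t. exp (c * t)) t = (\<Sum>j\<le>M. poly (B (M - j)) c * exp ((c + of_nat j) * t))"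
proof -
  have "dual_op (\<lambda>t. exp (c * t)) t = (\<Sum>i\<le>N. \<Sum>j\<le>M. coeff (B (M - j)) i * exp t ^ j * (c ^ i * exp (c * t)))"
    by (simp add: dual_differential_operator_def xdx_eq_deriv higher_deriv_exp_scaled)
  also have "\<dots> = (\<Sum>j\<le>M. \<Sum>i\<le>N. (coeff (B (M - j)) i * c ^ i) * (exp t ^ j * exp (c * t)))"
    by (subst sum.swap) (simp add: mult_ac)
  also have "\<dots> = (\<Sum>j\<le>M. poly (B (M - j)) c * exp ((c + of_nat j) * t))"
  proof (intro sum.cong refl)
    fix j
    have "(\<Sum>i\<le>N. coeff (B (M - j)) i * c ^ i) = poly (B (M - j)) c"
      using degree_B[of "M - j"] by (simp add: poly_altdef_le)
    moreover have "exp t ^ j * exp (c * t) = exp ((c + of_nat j) * t)"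
      by (simp add: distrib_right exp_add exp_of_nat_mult)
    ultimately show "(\<Sum>i\<le>N. (coeff (B (M - j)) i * c ^ i) * (exp t ^ j * exp (c * t))) =
        poly (B (M - j)) c * exp ((c + of_nat j) * t)"
      by (simp flip: sum_distrib_right)
  qed
  finally show ?thesis .
qed

text \<open>
  Applying the operator to \<open>x\<^sup>c\<close> gives \<open>\<Sum>\<^sub>j B\<^bsub>M-j\<^esub>(c) x\<^bsup>c+j\<^esup>\<close>; collecting the coefficient of a
  power \<open>x\<^sup>s\<close> gives the residue equation at \<open>s\<close>.
\<close>

lemma dual_op_residue_poly:
  assumes i: "i \<in> {1..n}" and f: "f \<in> conjugate_space"
  shows "dual_op (\<lambda>t. exp (\<mu> i * t) * poly (residue_poly i f) (exp t)) t = 0"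
proof -
  let ?R = "ns i (Ns i)"
  define \<rho> where "\<rho> r = residue f (\<mu> i + of_nat r)" for r :: nat
  have \<rho>0: "\<rho> r = 0" if "r > ?R" for r
    using conjugate_off_strings(2)[OF i f beyond_string[OF i that]] by (simp add: \<rho>_def)
  have form: "exp (\<mu> i * t) * poly (residue_poly i f) (exp t) = (\<Sum>r\<le>?R. \<rho> r * exp ((\<mu> i + of_nat r) * t))" for t
  proof -
    have "exp ((\<mu> i + of_nat r) * t) = exp (\<mu> i * t) * exp t ^ r" for r
      by (simp add: distrib_right exp_add exp_of_nat_mult)
    then show ?thesis unfolding residue_poly_def poly_sum sum_distrib_left \<rho>_def
      by (intro sum.cong refl) (simp only: poly_monom mult_ac)
  qed
  have "dual_op (\<lambda>t. exp (\<mu> i * t) * poly (residue_poly i f) (exp t)) t =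
      (\<Sum>r\<le>?R. \<rho> r * (\<Sum>j\<le>M. poly (B (M - j)) (\<mu> i + of_nat r) * exp ((\<mu> i + of_nat r + of_nat j) * t)))"
    unfolding form by (subst dual_operator_sum) (auto intro!: holomorphic_intros simp: dual_op_exp)
  also have "\<dots> = (\<Sum>j\<le>M. \<Sum>r\<le>?R. \<rho> r * poly (B (M - j)) (\<mu> i + of_nat r) * exp ((\<mu> i + of_nat (r + j)) * t))"
    unfolding sum_distrib_left by (subst sum.swap) (simp add: mult_ac add.assoc)
  also have "\<dots> = (\<Sum>j\<le>M. \<Sum>s\<le>?R + M. (poly (B (M - j)) (\<mu> i + of_nat s - of_nat j) *
      residue f (\<mu> i + of_nat s - of_nat j)) * exp ((\<mu> i + of_nat s) * t))"
  proof (rule sum.cong[OF refl])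
    fix j assume j: "j \<in> {..M}"
    let ?h = "\<lambda>s. (poly (B (M - j)) (\<mu> i + of_nat s - of_nat j) *
      residue f (\<mu> i + of_nat s - of_nat j)) * exp ((\<mu> i + of_nat s) * t)"
    (* The points that are added to the range of summation lie off the strings. *)
    have h: "?h s = 0" if "s \<in> {..?R + M} - (\<lambda>r. r + j) ` {..?R}" for s
    proof -
      have "\<mu> i + of_nat s - of_nat j \<notin> strings"
      proof (cases "s < j")
        case True
        then have eq: "\<mu> i + of_nat s - of_nat j = \<mu> i - of_nat (j - s)" by (simp add: of_nat_diff)
        show ?thesis unfolding eq by (rule below_string[OF i]) (use True in simp)
      next
        case False
        then have eq: "s = (s - j) + j" by simp
        then have "s - j > ?R" using that by (metis DiffD2 atMost_iff image_eqI not_le)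
        moreover have eq': "\<mu> i + of_nat s - of_nat j = \<mu> i + of_nat (s - j)" using False by (simp add: of_nat_diff)
        ultimately show ?thesis unfolding eq' by (intro beyond_string[OF i])
      qed
      then show ?thesis using conjugate_off_strings(2)[OF i f] by simp
    qed
    have "(\<Sum>s\<le>?R + M. ?h s) = (\<Sum>s\<in>(\<lambda>r. r + j) ` {..?R}. ?h s)"
      using j h by (intro sum.mono_neutral_right) auto
    also have "\<dots> = (\<Sum>r\<le>?R. ?h (r + j))" by (subst sum.reindex) (auto simp: o_def)
    also have "\<dots> = (\<Sum>r\<le>?R. \<rho> r * poly (B (M - j)) (\<mu> i + of_nat r) * exp ((\<mu> i + of_nat (r + j)) * t))"
    proof (intro sum.cong refl)
      fix r
      have "\<mu> i + of_nat (r + j) - of_nat j = \<mu> i + of_nat r" by simp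
      then show "?h (r + j) = \<rho> r * poly (B (M - j)) (\<mu> i + of_nat r) * exp ((\<mu> i + of_nat (r + j)) * t)"
        unfolding \<rho>_def by (simp only: mult_ac)
    qed
    finally show "(\<Sum>r\<le>?R. \<rho> r * poly (B (M - j)) (\<mu> i + of_nat r) * exp ((\<mu> i + of_nat (r + j)) * t)) =
        (\<Sum>s\<le>?R + M. ?h s)" ..
  qed
  also have "\<dots> = (\<Sum>s\<le>?R + M. (\<Sum>j\<le>M. poly (B (M - j)) (\<mu> i + of_nat s - of_nat j) *
      residue f (\<mu> i + of_nat s - of_nat j)) * exp ((\<mu> i + of_nat s) * t))"
    unfolding sum_distrib_right by (rule sum.swap)
  also have "\<dots> = 0" using residue_equation[OF i f] by simp
  finally show ?thesis .
qed

text \<open>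
  Differentiate the equation \<open>e - g\<close> times at a point where \<open>F\<close> vanishes to order \<open>e\<close>. If \<open>p\<^sub>i\<close>
  vanishes there to order at least \<open>i - g\<close>, only the terms with \<open>i = g + r\<close>, in which \<open>r\<close>
  derivatives fall on \<open>p\<^sub>i\<close>, survive.
\<close>

lemma indicial_relation:
  assumes F: "F holomorphic_on UNIV" "\<And>t. dual_op F t = 0"
    and e: "\<And>j. j < e \<Longrightarrow> (deriv ^^ j) F t = 0" "(deriv ^^ e) F t \<noteq> 0"
    and low: "\<And>i r. i \<le> N \<Longrightarrow> i > g + r \<Longrightarrow> poly ((euler ^^ r) (col i)) (exp t) = 0"
    and ge: "g \<le> e" and gN: "g \<le> N"
  shows "(\<Sum>r\<le>N - g. poly ((euler ^^ r) (col (g + r))) (exp t) * of_nat ((e - g) choose r)) = 0"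
proof -
  define h where "h = e - g"
  have eh: "e = g + h" using ge by (simp add: h_def)
  have hol: "(\<lambda>t. poly (col i) (exp t)) holomorphic_on UNIV" "(deriv ^^ i) F holomorphic_on UNIV" for i
    using F(1) by (auto intro!: holomorphic_intros holomorphic_higher_deriv)
  have prod: "(deriv ^^ h) (\<lambda>t. poly (col i) (exp t) * (deriv ^^ i) F t) t =
      (\<Sum>r\<le>h. of_nat (h choose r) * poly ((euler ^^ r) (col i)) (exp t) * (deriv ^^ (h - r + i)) F t)" for i
  proof -
    have "(deriv ^^ k) ((deriv ^^ i) F) t = (deriv ^^ (k + i)) F t" for k
      by (simp only: funpow_add o_apply)
    then show ?thesis
      using higher_deriv_mult[OF hol(1)[of i] hol(2)[of i] open_UNIV UNIV_I, of h t]
      by (simp only: higher_deriv_poly_exp atLeast0AtMost)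
  qed
  have "(\<lambda>t. \<Sum>i\<in>{..N}. 1 * (poly (col i) (exp t) * (deriv ^^ i) F t)) = (\<lambda>t. 0)"
    using F(2) by (simp add: fun_eq_iff dual_op_col)
  then have "(deriv ^^ h) (\<lambda>t. \<Sum>i\<in>{..N}. 1 * (poly (col i) (exp t) * (deriv ^^ i) F t)) t = 0"
  proof -
    have "(deriv ^^ h) (\<lambda>t::complex. 0::complex) = (\<lambda>t. 0)" by (induction h) auto
    then show ?thesis by (simp only: \<open>(\<lambda>t. \<Sum>i\<in>{..N}. 1 * (poly (col i) (exp t) * (deriv ^^ i) F t)) = (\<lambda>t. 0)\<close>)
  qed
  also have "(deriv ^^ h) (\<lambda>t. \<Sum>i\<in>{..N}. 1 * (poly (col i) (exp t) * (deriv ^^ i) F t)) t =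
      (\<Sum>i\<in>{..N}. 1 * (deriv ^^ h) (\<lambda>t. poly (col i) (exp t) * (deriv ^^ i) F t) t)"
    by (rule higher_deriv_sum_UNIV) (use hol in \<open>auto intro!: holomorphic_on_mult\<close>)
  also have "\<dots> = (\<Sum>i\<in>{..N}. \<Sum>r\<le>h. of_nat (h choose r) * poly ((euler ^^ r) (col i)) (exp t) * (deriv ^^ (h - r + i)) F t)"
    by (simp add: prod)
  also have "\<dots> = (\<Sum>i\<in>{..N}. \<Sum>r\<le>h. if i = g + r then
      of_nat (h choose r) * poly ((euler ^^ r) (col (g + r))) (exp t) * (deriv ^^ e) F t else 0)"
  proof (intro sum.cong refl)
    fix i r assume i: "i \<in> {..N}" and r: "r \<in> {..h}"
    show "of_nat (h choose r) * poly ((euler ^^ r) (col i)) (exp t) * (deriv ^^ (h - r + i)) F t =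
      (if i = g + r then of_nat (h choose r) * poly ((euler ^^ r) (col (g + r))) (exp t) * (deriv ^^ e) F t else 0)"
    proof (cases i "g + r" rule: linorder_cases)
      case less
      then have "h - r + i < e" using r eh by auto
      then show ?thesis using e(1) less by simp
    next
      case equal
      then have "h - r + i = e" using r eh by auto
      then show ?thesis using equal by simp
    next
      case greater
      then show ?thesis using low i by simp
    qed
  qed
  also have "\<dots> = (\<Sum>r\<le>h. \<Sum>i\<in>{..N}. if i = g + r then
      of_nat (h choose r) * poly ((euler ^^ r) (col (g + r))) (exp t) * (deriv ^^ e) F t else 0)"
    by (rule sum.swap)
  also have "\<dots> = (\<Sum>r\<le>h. if g + r \<le> N then
      of_nat (h choose r) * poly ((euler ^^ r) (col (g + r))) (exp t) * (deriv ^^ e) F t else 0)"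
    by (intro sum.cong refl) simp
  also have "\<dots> = (\<Sum>r\<le>h + N. if r \<le> N - g then
      of_nat (h choose r) * poly ((euler ^^ r) (col (g + r))) (exp t) * (deriv ^^ e) F t else 0)"
    using gN by (intro sum.mono_neutral_cong_left) (auto simp: binomial_eq_0)
  also have "\<dots> = (\<Sum>r\<le>N - g. of_nat (h choose r) * poly ((euler ^^ r) (col (g + r))) (exp t) * (deriv ^^ e) F t)"
    by (intro sum.mono_neutral_cong_right) auto
  also have "\<dots> = (deriv ^^ e) F t * (\<Sum>r\<le>N - g. poly ((euler ^^ r) (col (g + r))) (exp t) * of_nat (h choose r))"
    unfolding sum_distrib_left by (intro sum.cong refl) (simp only: mult_ac)
  finally show ?thesis using e(2) unfolding h_def by simp
qed

text \<open>
  The case \<open>g = N\<close>, in which the sum consists of \<open>p\<^sub>N(x) \<noteq> 0\<close> alone.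
\<close>

lemma multiplicity_regular:
  assumes F: "F holomorphic_on UNIV" "\<And>t. dual_op F t = 0"
    and e: "\<And>j. j < e \<Longrightarrow> (deriv ^^ j) F t = 0" "(deriv ^^ e) F t \<noteq> 0"
    and x: "exp t \<notin> z ` {1..m}"
  shows "e < N"
proof (rule ccontr)
  assume "\<not> e < N"
  then have "(\<Sum>r\<le>N - N. poly ((euler ^^ r) (col (N + r))) (exp t) * of_nat ((e - N) choose r)) = 0"
    by (intro indicial_relation[OF F e]) auto
  then have "poly top_poly (exp t) = 0" by (simp add: col_top)
  then show False using x by (auto simp: top_poly_def poly_prod)
qed

text \<open>
  The case \<open>g = N - M\<^sub>a\<close>: the sum is the indicial polynomial of \<open>D\<^sub>U\<close> at \<open>z\<^sub>a\<close>, and the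
  required vanishing of the \<open>p\<^sub>i\<close> is \<open>high_columns_vanish\<close>.
\<close>

lemma multiplicity_singular:
  assumes F: "F holomorphic_on UNIV" "\<And>t. dual_op F t = 0"
    and e: "\<And>j. j < e \<Longrightarrow> (deriv ^^ j) F t = 0" "(deriv ^^ e) F t \<noteq> 0"
    and a: "a \<in> {1..m}" and x: "exp t = z a"
  shows "e < N - Ms a \<or> e - (N - Ms a) \<in> ms a ` {1..Ms a} \<and> N - Ms a \<le> e"
proof (cases "e < N - Ms a")
  case False
  let ?g = "N - Ms a"
  have gM: "?g + Ms a = N" using Ms_le_N[OF a] by simp
  have "(\<Sum>r\<le>N - ?g. poly ((euler ^^ r) (col (?g + r))) (exp t) * of_nat ((e - ?g) choose r)) = 0"
  proof (rule indicial_relation[OF F e])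
    fix i r assume "i \<le> N" "i > ?g + r"
    then have low: "N + r - i < Ms a" "i + (N + r - i) = N + r" using gM by auto
    show "poly ((euler ^^ r) (col i)) (exp t) = 0" unfolding x by (rule high_columns_vanish[OF a degree_B low])
  qed (use False in auto)
  also have "N - ?g = Ms a" using gM by simp
  finally have "indicial a (e - ?g) = 0"
    unfolding indicial_def indicial_coeff_def x using gM Ms_le_N[OF a] by (simp add: add.commute)
  then show ?thesis using indicial_zero_iff[OF a] False by auto
qed simp

end

section \<open>Basis, exponents and regularized operator of the dual space\<close>

lemma gap_exponents_image:
  assumes "r \<le> d"
  shows "gap_exponents d r s ` {1..d} = {..<d - r} \<union> (\<lambda>j. d - r + s j) ` {1..r}"
proof (intro equalityI subsetI)
  fix e assume "e \<in> gap_exponents d r s ` {1..d}"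
  then obtain k where k: "k \<in> {1..d}" "e = gap_exponents d r s k" by blast
  show "e \<in> {..<d - r} \<union> (\<lambda>j. d - r + s j) ` {1..r}"
  proof (cases "k \<le> d - r")
    case True
    then show ?thesis using k by (auto simp: gap_exponents_def)
  next
    case False
    then have "k - (d - r) \<in> {1..r}" "e = d - r + s (k - (d - r))" using k assms by (auto simp: gap_exponents_def)
    then show ?thesis by blast
  qed
next
  fix e assume "e \<in> {..<d - r} \<union> (\<lambda>j. d - r + s j) ` {1..r}"
  then show "e \<in> gap_exponents d r s ` {1..d}"
  proof
    assume "e \<in> {..<d - r}"
    then have "Suc e \<in> {1..d}" "e = gap_exponents d r s (Suc e)" by (auto simp: gap_exponents_def)
    then show ?thesis by blast
  next
    assume "e \<in> (\<lambda>j. d - r + s j) ` {1..r}"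
    then obtain j where j: "j \<in> {1..r}" "e = d - r + s j" by blast
    then have "d - r + j \<in> {1..d}" "e = gap_exponents d r s (d - r + j)"
      using assms by (auto simp: gap_exponents_def)
    then show ?thesis by blast
  qed
qed

context bispectral_setup
begin

text \<open>
  The residue polynomials of the elements from \<open>dual_elements\<close>; they form the basis \<open>p\<^sub>i\<^sub>j\<close> of the
  \<open>i\<close>-th component.
\<close>

definition dual_poly :: "nat \<Rightarrow> nat \<Rightarrow> complex poly" where
  "dual_poly i = (SOME p. \<exists>F. \<forall>e\<in>{1..Ns i}. p e = residue_poly i (F e) \<and> F e \<in> conjugate_space \<and>
     (\<forall>j\<in>{1..Ns i}. coeff (residue_poly i (F e)) (ns i j) = (if j = e then 1 else 0)))"

lemma dual_poly:
  assumes i: "i \<in> {1..n}"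
  obtains F where "\<And>e. e \<in> {1..Ns i} \<Longrightarrow> dual_poly i e = residue_poly i (F e)"
    "\<And>e. e \<in> {1..Ns i} \<Longrightarrow> F e \<in> conjugate_space"
    "\<And>e j. e \<in> {1..Ns i} \<Longrightarrow> j \<in> {1..Ns i} \<Longrightarrow> coeff (residue_poly i (F e)) (ns i j) = (if j = e then 1 else 0)"
proof -
  let ?P = "\<lambda>p F. \<forall>e\<in>{1..Ns i}. p e = residue_poly i (F e) \<and> F e \<in> conjugate_space \<and>
     (\<forall>j\<in>{1..Ns i}. coeff (residue_poly i (F e)) (ns i j) = (if j = e then 1 else 0))"
  obtain F where "?P (\<lambda>e. residue_poly i (F e)) F" using dual_elements[OF i] by blast
  then have "\<exists>p F. ?P p F" by (intro exI[of _ "\<lambda>e. residue_poly i (F e)"] exI[of _ F])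
  then have "\<exists>F. ?P (dual_poly i) F" unfolding dual_poly_def by (rule someI_ex)
  then show thesis using that by blast
qed

lemma coeff_dual_poly:
  "i \<in> {1..n} \<Longrightarrow> e \<in> {1..Ns i} \<Longrightarrow> j \<in> {1..Ns i} \<Longrightarrow> coeff (dual_poly i e) (ns i j) = (if j = e then 1 else 0)"
  by (rule dual_poly[of i]) auto

lemma degree_dual_poly:
  assumes i: "i \<in> {1..n}" and e: "e \<in> {1..Ns i}"
  shows "degree (dual_poly i e) = ns i e"
proof (rule dual_poly[OF i])
  fix F assume F: "\<And>e. e \<in> {1..Ns i} \<Longrightarrow> dual_poly i e = residue_poly i (F e)"
    "\<And>e. e \<in> {1..Ns i} \<Longrightarrow> F e \<in> conjugate_space"
  have "coeff (dual_poly i e) (ns i e) = 1" using coeff_dual_poly[OF i e e] by simp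
  then have nz: "dual_poly i e \<noteq> 0" by auto
  then obtain j where j: "j \<in> {1..Ns i}" "degree (dual_poly i e) = ns i j"
    using degree_residue_poly[OF i F(2)[OF e]] F(1)[OF e] by auto
  have "coeff (dual_poly i e) (ns i j) \<noteq> 0" using nz by (simp flip: j(2))
  then have "j = e" using coeff_dual_poly[OF i e j(1)] by (simp split: if_splits)
  then show ?thesis using j by simp
qed

definition dual_basis :: "nat \<times> nat \<Rightarrow> complex \<Rightarrow> complex" where
  "dual_basis a t = exp (\<mu> (fst a) * t) * poly (dual_poly (fst a) (snd a)) (exp t)"

abbreviation dual_index :: "(nat \<times> nat) set" where
  "dual_index \<equiv> Sigma {1..n} (\<lambda>i. {1..Ns i})"

lemma residue_poly_in_dual:
  assumes i: "i \<in> {1..n}" and f: "f \<in> conjugate_space"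
  shows "residue_poly i f = (\<Sum>e=1..Ns i. Polynomial.smult (coeff (residue_poly i f) (ns i e)) (dual_poly i e))"
proof (rule dual_poly[OF i])
  fix F assume F: "\<And>e. e \<in> {1..Ns i} \<Longrightarrow> dual_poly i e = residue_poly i (F e)"
    "\<And>e. e \<in> {1..Ns i} \<Longrightarrow> F e \<in> conjugate_space"
    "\<And>e j. e \<in> {1..Ns i} \<Longrightarrow> j \<in> {1..Ns i} \<Longrightarrow> coeff (residue_poly i (F e)) (ns i j) = (if j = e then 1 else 0)"
  show ?thesis by (subst residue_poly_expand[OF i f F(2,3)]) (auto intro!: sum.cong simp: F(1))
qed

lemma bispectral_dual_span:
  assumes \<gamma>: "separating_contours n Ns ns l \<gamma>"
  shows "bispectral_dual U M B n \<gamma> = cfun.span (dual_basis ` dual_index)"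
proof -
  let ?G = "{\<lambda>t. contour_integral (\<gamma> i) (\<lambda>u. exp (u * t) * f u) | i f. i \<in> {1..n} \<and> f \<in> conjugate_space}"
  define K where "K = of_real (2 * pi) * \<i>"
  have K0: "K \<noteq> 0" by (simp add: K_def)
  have "?G \<subseteq> cfun.span (dual_basis ` dual_index)"
  proof
    fix F assume "F \<in> ?G"
    then obtain i f where i: "i \<in> {1..n}" and f: "f \<in> conjugate_space"
      and F: "F = (\<lambda>t. contour_integral (\<gamma> i) (\<lambda>u. exp (u * t) * f u))" by blast
    have "F = (\<Sum>e=1..Ns i. (\<lambda>t. (K * coeff (residue_poly i f) (ns i e)) * dual_basis (i, e) t))"
    proof
      fix t
      have "F t = K * (exp (\<mu> i * t) * poly (residue_poly i f) (exp t))"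
        unfolding F K_def by (rule contour_integral_conjugate[OF i f \<gamma>])
      also have "\<dots> = (\<Sum>e=1..Ns i. (K * coeff (residue_poly i f) (ns i e)) * dual_basis (i, e) t)"
        by (subst residue_poly_in_dual[OF i f]) (simp add: poly_sum sum_distrib_left dual_basis_def mult_ac)
      finally show "F t = (\<Sum>e=1..Ns i. (\<lambda>t. (K * coeff (residue_poly i f) (ns i e)) * dual_basis (i, e) t)) t"
        by (simp add: sum_functions_apply)
    qed
    also have "\<dots> \<in> cfun.span (dual_basis ` dual_index)"
      using i by (intro cfun.span_sum cfun.span_scale cfun.span_base) auto
    finally show "F \<in> cfun.span (dual_basis ` dual_index)" .
  qed
  moreover have "dual_basis ` dual_index \<subseteq> cfun.span ?G"
  proof
    fix v assume "v \<in> dual_basis ` dual_index"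
    then obtain i e where i: "i \<in> {1..n}" and e: "e \<in> {1..Ns i}" and v: "v = dual_basis (i, e)" by blast
    obtain f where f: "f \<in> conjugate_space" "dual_poly i e = residue_poly i f" by (rule dual_poly[OF i]) (use e in blast)
    have "contour_integral (\<gamma> i) (\<lambda>u. exp (u * t) * f u) = K * dual_basis (i, e) t" for t
      unfolding K_def dual_basis_def fst_conv snd_conv f(2) by (rule contour_integral_conjugate[OF i f(1) \<gamma>])
    then have "v = (\<lambda>t. (1 / K) * contour_integral (\<gamma> i) (\<lambda>u. exp (u * t) * f u))"
      using K0 by (simp add: fun_eq_iff v)
    also have "\<dots> \<in> cfun.span ?G"
      using i f(1) by (intro cfun.span_scale cfun.span_base) blast
    finally show "v \<in> cfun.span ?G" .
  qed
  ultimately have "cfun.span ?G = cfun.span (dual_basis ` dual_index)"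
    by (intro subset_antisym cfun.span_minimal cfun.subspace_span)
  then show ?thesis unfolding bispectral_dual_def .
qed

lemma dual_basis_properties:
  assumes a: "a \<in> dual_index"
  shows "dual_basis a holomorphic_on UNIV" "dual_op (dual_basis a) t = 0"
proof -
  obtain i e where ie: "a = (i, e)" "i \<in> {1..n}" "e \<in> {1..Ns i}" using a by blast
  show "dual_basis a holomorphic_on UNIV" unfolding dual_basis_def[abs_def] by (intro holomorphic_intros)
  obtain f where f: "f \<in> conjugate_space" "dual_poly i e = residue_poly i f" by (rule dual_poly[OF ie(2)]) (use ie(3) in blast)
  show "dual_op (dual_basis a) t = 0"
    unfolding dual_basis_def[abs_def] ie(1) fst_conv snd_conv f(2) by (rule dual_op_residue_poly[OF ie(2) f(1)])
qed

lemma dual_basis_independent: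
  assumes z: "\<And>t. (\<Sum>a\<in>dual_index. x a * dual_basis a t) = 0" and a: "a \<in> dual_index"
  shows "x a = 0"
proof -
  let ?A = "Sigma {1..n} (\<lambda>i. {..ns i (Ns i)})"
  let ?e = "\<lambda>b. \<mu> (fst b) + of_nat (snd b)"
  define c where "c b = (\<Sum>j=1..Ns (fst b). x (fst b, j) * coeff (dual_poly (fst b) j) (snd b))" for b :: "nat \<times> nat"
  have inj: "inj_on ?e ?A"
  proof (rule inj_onI)
    fix b b' assume bb: "b \<in> ?A" "b' \<in> ?A" "?e b = ?e b'"
    obtain i r j r' where "b = (i, r)" "b' = (j, r')" by (cases b, cases b')
    then show "b = b'" using string_inj[of i j r r'] bb by simp
  qed
  have "(\<Sum>b\<in>?A. c b * exp (?e b * t)) = 0" for t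
  proof -
    have "(\<Sum>a\<in>dual_index. x a * dual_basis a t) = (\<Sum>i=1..n. \<Sum>j=1..Ns i. x (i, j) * dual_basis (i, j) t)"
      by (subst sum.Sigma) auto
    also have "\<dots> = (\<Sum>i=1..n. \<Sum>r\<le>ns i (Ns i). c (i, r) * exp (?e (i, r) * t))"
    proof (rule sum.cong[OF refl])
      fix i assume i: "i \<in> {1..n}"
      have ex: "exp ((\<mu> i + of_nat r) * t) = exp (\<mu> i * t) * exp t ^ r" for r
        by (simp add: distrib_right exp_add exp_of_nat_mult)
      have "(\<Sum>j=1..Ns i. x (i, j) * dual_basis (i, j) t) =
          (\<Sum>j=1..Ns i. \<Sum>r\<le>ns i (Ns i). x (i, j) * coeff (dual_poly i j) r * exp ((\<mu> i + of_nat r) * t))"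
      proof (rule sum.cong[OF refl])
        fix j assume j: "j \<in> {1..Ns i}"
        have "degree (dual_poly i j) \<le> ns i (Ns i)" using degree_dual_poly[OF i j] ns_le_top[OF i j] by simp
        then have "x (i, j) * dual_basis (i, j) t =
            x (i, j) * (exp (\<mu> i * t) * (\<Sum>r\<le>ns i (Ns i). coeff (dual_poly i j) r * exp t ^ r))"
          by (simp only: dual_basis_def poly_altdef_le fst_conv snd_conv)
        then show "x (i, j) * dual_basis (i, j) t =
          (\<Sum>r\<le>ns i (Ns i). x (i, j) * coeff (dual_poly i j) r * exp ((\<mu> i + of_nat r) * t))"
          unfolding sum_distrib_left ex by (simp only: mult_ac)
      qed
      also have "\<dots> = (\<Sum>r\<le>ns i (Ns i). \<Sum>j=1..Ns i. x (i, j) * coeff (dual_poly i j) r * exp ((\<mu> i + of_nat r) * t))"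
        by (rule sum.swap)
      also have "\<dots> = (\<Sum>r\<le>ns i (Ns i). c (i, r) * exp (?e (i, r) * t))"
        by (simp add: c_def sum_distrib_right)
      finally show "(\<Sum>j=1..Ns i. x (i, j) * dual_basis (i, j) t) = (\<Sum>r\<le>ns i (Ns i). c (i, r) * exp (?e (i, r) * t))" .
    qed
    also have "\<dots> = (\<Sum>b\<in>?A. c b * exp (?e b * t))"
      by (subst sum.Sigma) (auto intro!: sum.cong)
    finally show ?thesis using z by simp
  qed
  from exponentials_independent_family[OF _ inj this] have c0: "c b = 0" if "b \<in> ?A" for b using that by auto
  obtain i e where ie: "a = (i, e)" "i \<in> {1..n}" "e \<in> {1..Ns i}" using a by blast
  have "0 = c (i, ns i e)" using c0 ie(2) ns_le_top[OF ie(2,3)] by simp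
  also have "\<dots> = (\<Sum>j=1..Ns i. if j = e then x (i, e) else 0)"
    unfolding c_def using coeff_dual_poly[OF ie(2) _ ie(3)] by (intro sum.cong) auto
  finally show ?thesis using ie by simp
qed

lemma card_dual_index: "card dual_index = N" "finite dual_index"
  by (simp_all add: N_sum rank_sum_def)

context
  fixes \<gamma> V
  assumes contours: "separating_contours n Ns ns l \<gamma>" and V: "V = bispectral_dual U M B n \<gamma>"
begin

lemma V_eq: "V = {F. \<exists>x. F = (\<lambda>t. \<Sum>a\<in>dual_index. x a * dual_basis a t)}"
  unfolding V bispectral_dual_span[OF contours] by (rule span_family[OF card_dual_index(2)])

lemma V_properties:
  assumes "F \<in> V"
  shows "F holomorphic_on UNIV" "dual_op F t = 0"
proof -
  obtain x where F: "F = (\<lambda>t. \<Sum>a\<in>dual_index. x a * dual_basis a t)" using assms V_eq by blast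
  show "F holomorphic_on UNIV" unfolding F by (intro holomorphic_intros dual_basis_properties)
  show "dual_op F t = 0" unfolding F
    by (subst dual_operator_sum) (use card_dual_index(2) dual_basis_properties in auto)
qed

text \<open>
  If all possible multiplicities lie in a set \<open>R\<close> of \<open>dim V\<close> elements, then the derivatives of orders in
  \<open>R\<close> determine an element of \<open>V\<close> and can be prescribed. Prescribing \<open>1\<close> at \<open>e0\<close> and \<open>0\<close>
  elsewhere gives the multiplicity \<open>e0\<close>.
\<close>

lemma exponents_eq:
  assumes x: "x \<noteq> 0" and R: "finite R" "card R = N"
    and root: "\<And>F t e. F \<in> V \<Longrightarrow> exp t = x \<Longrightarrow> (\<And>j. j < e \<Longrightarrow> (deriv ^^ j) F t = 0) \<Longrightarrow>
        (deriv ^^ e) F t \<noteq> 0 \<Longrightarrow> e \<in> R"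
  shows "exponents V x = R"
proof
  show "exponents V x \<subseteq> R"
    unfolding exponents_def using has_root_iff_deriv[OF V_properties(1)] root by blast
  show "R \<subseteq> exponents V x"
  proof
    fix e0 assume e0: "e0 \<in> R"
    define t where "t = Ln x"
    have t: "exp t = x" using x by (simp add: t_def)
    have least: "\<exists>e. (\<forall>j<e. (deriv ^^ j) F t = 0) \<and> (deriv ^^ e) F t \<noteq> 0" if "\<exists>e. (deriv ^^ e) F t \<noteq> 0" for F
      using exists_least_iff[of "\<lambda>e. (deriv ^^ e) F t \<noteq> 0"] that by blast
    have comb: "(deriv ^^ e) (\<lambda>t. \<Sum>a\<in>dual_index. y a * dual_basis a t) t =
        (\<Sum>a\<in>dual_index. (deriv ^^ e) (dual_basis a) t * y a)" for e y
      by (subst higher_deriv_sum_UNIV) (use card_dual_index(2) dual_basis_properties(1) in \<open>auto simp: mult.commute\<close>)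
    have inV: "(\<lambda>t. \<Sum>a\<in>dual_index. y a * dual_basis a t) \<in> V" for y using V_eq by blast
    have "\<exists>y. \<forall>e\<in>R. (\<Sum>a\<in>dual_index. (deriv ^^ e) (dual_basis a) t * y a) = (if e = e0 then 1 else 0)"
    proof (rule dual_solution[OF R(1) card_dual_index(2) _ e0])
      show "card R \<le> card dual_index" using R(2) card_dual_index(1) by simp
      fix y assume y: "\<And>e. e \<in> R \<Longrightarrow> (\<Sum>a\<in>dual_index. (deriv ^^ e) (dual_basis a) t * y a) = 0"
      let ?F = "\<lambda>t. \<Sum>a\<in>dual_index. y a * dual_basis a t"
      have zero: "(deriv ^^ e) ?F t = 0" for e
      proof (rule ccontr)
        assume "(deriv ^^ e) ?F t \<noteq> 0"
        then obtain e' where e': "\<And>j. j < e' \<Longrightarrow> (deriv ^^ j) ?F t = 0" "(deriv ^^ e') ?F t \<noteq> 0"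
          using least[of ?F] by blast
        then have "e' \<in> R" by (intro root[OF inV t])
        then show False using e'(2) y comb by simp
      qed
      have "?F w = 0" for w
        by (rule holomorphic_fun_eq_0_on_connected[OF V_properties(1)[OF inV] open_UNIV connected_UNIV _ UNIV_I UNIV_I])
           (rule zero)
      then show "\<forall>a\<in>dual_index. y a = 0" using dual_basis_independent by blast
    qed
    then obtain y where y: "\<And>e. e \<in> R \<Longrightarrow> (deriv ^^ e) (\<lambda>t. \<Sum>a\<in>dual_index. y a * dual_basis a t) t = (if e = e0 then 1 else 0)"
      unfolding comb by blast
    let ?F = "\<lambda>t. \<Sum>a\<in>dual_index. y a * dual_basis a t"
    have "(deriv ^^ e0) ?F t \<noteq> 0" using y[OF e0] by simp
    then obtain e' where e': "\<And>j. j < e' \<Longrightarrow> (deriv ^^ j) ?F t = 0" "(deriv ^^ e') ?F t \<noteq> 0"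
      using least[of ?F] by blast
    then have "e' \<in> R" by (intro root[OF inV t])
    then have "e' = e0" using y[of e'] e'(2) by (simp split: if_splits)
    then have "has_root_of_multiplicity ?F t e0"
      using e' has_root_iff_deriv[OF V_properties(1)[OF inV]] by blast
    then show "e0 \<in> exponents V x" unfolding exponents_def using inV t by blast
  qed
qed

lemma exponents_regular: "x \<noteq> 0 \<Longrightarrow> x \<notin> z ` {1..m} \<Longrightarrow> exponents V x = {..<N}"
proof (rule exponents_eq)
  fix F t e assume "x \<notin> z ` {1..m}" "F \<in> V" "exp t = x" "\<And>j. j < e \<Longrightarrow> (deriv ^^ j) F t = 0" "(deriv ^^ e) F t \<noteq> 0"
  then show "e \<in> {..<N}" using multiplicity_regular[OF V_properties, of F e t] by simp
qed auto

lemma exponents_singular: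
  assumes a: "a \<in> {1..m}"
  shows "exponents V (z a) = gap_exponents N (Ms a) (ms a) ` {1..N}"
  unfolding gap_exponents_image[OF Ms_le_N[OF a]]
proof (rule exponents_eq[OF z_nonzero[OF a]])
  let ?g = "N - Ms a"
  have "inj_on (\<lambda>j. ?g + ms a j) {1..Ms a}"
    by (rule inj_onI) (simp add: inj_on_eq_iff[OF strict_mono_on_imp_inj_on[OF ms_mono[OF a]]])
  then have "card ((\<lambda>j. ?g + ms a j) ` {1..Ms a}) = Ms a" by (simp add: card_image)
  then show "card ({..<?g} \<union> (\<lambda>j. ?g + ms a j) ` {1..Ms a}) = N"
    using Ms_le_N[OF a] by (subst card_Un_disjoint) auto
  fix F t e assume F: "F \<in> V" "exp t = z a" "\<And>j. j < e \<Longrightarrow> (deriv ^^ j) F t = 0" "(deriv ^^ e) F t \<noteq> 0"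
  then have "e < ?g \<or> e - ?g \<in> ms a ` {1..Ms a} \<and> ?g \<le> e"
    using multiplicity_singular[OF V_properties[OF F(1)] F(3,4) a F(2)] by blast
  then show "e \<in> {..<?g} \<union> (\<lambda>j. ?g + ms a j) ` {1..Ms a}"
  proof
    assume "e - ?g \<in> ms a ` {1..Ms a} \<and> ?g \<le> e"
    then obtain j where "j \<in> {1..Ms a}" "e = ?g + ms a j" by auto
    then show ?thesis by blast
  qed simp
qed simp

lemma singular_points_V: "singular_points V N = z ` {1..m}"
proof -
  have sing: "exponents V (z a) \<noteq> {..<N}" if a: "a \<in> {1..m}" for a
  proof -
    have "N - Ms a + ms a (Ms a) \<in> exponents V (z a)"
      unfolding exponents_singular[OF a] gap_exponents_image[OF Ms_le_N[OF a]] using Ms_pos[OF a] by auto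
    moreover have "Ms a \<le> ms a (Ms a)"
      using index_le_strict_mono[OF ms_mono[OF a], of "Ms a"] ms_pos[OF a] Ms_pos[OF a] by simp
    then have "N - Ms a + ms a (Ms a) \<notin> {..<N}" by simp
    ultimately show ?thesis by blast
  qed
  show ?thesis
  proof (intro equalityI subsetI)
    fix x assume "x \<in> singular_points V N"
    then have "x \<noteq> 0" "exponents V x \<noteq> {..<N}" by (simp_all add: singular_points_def)
    then show "x \<in> z ` {1..m}" using exponents_regular by blast
  next
    fix x assume "x \<in> z ` {1..m}"
    then obtain a where "a \<in> {1..m}" "x = z a" by blast
    then show "x \<in> singular_points V N" using sing z_nonzero by (simp add: singular_points_def)
  qed
qed

lemma V_quasi_polynomials_basis: "quasi_polynomials_basis n Ns ns \<mu> dual_poly V"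
proof -
  have "{\<lambda>t. exp (\<mu> i * t) * poly (dual_poly i j) (exp t) | i j. i \<in> {1..n} \<and> j \<in> {1..Ns i}} = dual_basis ` dual_index"
    unfolding dual_basis_def[abs_def] by force
  moreover have "\<mu> i - \<mu> j \<notin> \<int>" if "i \<in> {1..n}" "j \<in> {1..n}" "i \<noteq> j" for i j
  proof
    assume "\<mu> i - \<mu> j \<in> \<int>"
    then have "(\<mu> i - \<mu> j) + (of_nat (Ns i) - of_nat (Ns j)) \<in> \<int>"
      by (rule Ints_add) (rule Ints_diff[OF Ints_of_nat Ints_of_nat])
    then show False using l_distinct[OF that] by (simp add: algebra_simps)
  qed
  ultimately show ?thesis
    unfolding quasi_polynomials_basis_def V bispectral_dual_span[OF contours]
    using incr_n degree_dual_poly by simp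
qed

lemma V_data: "quasi_polynomials_data n Ns ns \<mu> m Ms ms z V"
  unfolding quasi_polynomials_data_def N_sum[symmetric] singular_points_V
  using V_quasi_polynomials_basis z_inj incr Ms_le_N exponents_singular by blast

lemma exp_not_in_V:
  assumes "(\<lambda>t. exp (c * t)) \<in> V" shows False
proof -
  have "(\<Sum>j\<le>M. poly (B (M - j)) c * exp ((c + of_nat j) * t)) = 0" for t
    using V_properties(2)[OF assms, of t] by (simp add: dual_op_exp)
  then have z: "poly (B (M - j)) c = 0" if "j \<le> M" for j
    using exponentials_independent_family[of "{..M}" "\<lambda>j. c + of_nat j" "\<lambda>j. poly (B (M - j)) c" j] that
    by (auto simp: inj_on_def)
  obtain k where "k \<le> M" "poly (B k) c \<noteq> 0" using no_common by blast
  then show False using z[of "M - k"] by simp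
qed

lemma V_nondegenerate: "nondegenerate_quasi_polynomials n Ns ns \<mu> V"
  unfolding nondegenerate_quasi_polynomials_def
proof (rule exI[of _ dual_poly], intro conjI ballI)
  show "quasi_polynomials_basis n Ns ns \<mu> dual_poly V" by (rule V_quasi_polynomials_basis)
  fix i j assume i: "i \<in> {1..n}" and j: "j \<in> {1..Ns i}"
  show "(\<lambda>t. exp ((\<mu> i + of_nat (ns i j)) * t)) \<notin> V" using exp_not_in_V by blast
  have "j - 1 < Ns i" using j by auto
  then obtain f where f: "f \<in> conjugate_space" "residue f (\<mu> i + of_nat (j - 1)) \<noteq> 0"
    "\<And>r. r < j - 1 \<Longrightarrow> residue f (\<mu> i + of_nat r) = 0"
    using triangular_element[OF i] by blast
  show "\<exists>c r. r = (\<Sum>k=1..Ns i. Polynomial.smult (c k) (dual_poly i k)) \<and> r \<noteq> 0 \<and> Polynomial.order 0 r = j - 1"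
  proof (intro exI conjI)
    show "residue_poly i f = (\<Sum>k=1..Ns i. Polynomial.smult (coeff (residue_poly i f) (ns i k)) (dual_poly i k))"
      by (rule residue_poly_in_dual[OF i f(1)])
    show "residue_poly i f \<noteq> 0" "Polynomial.order 0 (residue_poly i f) = j - 1"
      using order_0_eqI[of "j - 1" "residue_poly i f"] f(2,3) coeff_residue_poly[OF i f(1)] by auto
  qed
qed

text \<open>
  Coefficients of the monic operator. The Stirling numbers rewrite the powers of \<open>x d/dx\<close>; the case
  \<open>k = N\<close> is separate because there the quotient is \<open>1\<close> only away from the zeros of the denominator.
\<close>

definition monic_coeff :: "nat \<Rightarrow> complex \<Rightarrow> complex" where
  "monic_coeff k x = (if k = N then 1 else
     (\<Sum>i\<le>N. poly (col i) x * of_nat (Stirling i k)) * x ^ k / (x ^ N * poly top_poly x))"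

lemma dual_op_monic:
  assumes F: "F analytic_on {t}" and x: "poly top_poly (exp t) \<noteq> 0"
  shows "dual_op F t = exp t ^ N * poly top_poly (exp t) * differential_operator N monic_coeff F t"
proof -
  let ?x = "exp t"
  obtain S where S: "open S" "t \<in> S" "F holomorphic_on S" using F by (auto simp: analytic_at)
  have "dual_op F t = (\<Sum>i\<le>N. \<Sum>k\<le>N. poly (col i) ?x * (of_nat (Stirling i k) * ?x ^ k * (dx ^^ k) F t))"
    unfolding dual_op_col
  proof (rule sum.cong[OF refl])
    fix i assume i: "i \<in> {..N}"
    have "(deriv ^^ i) F t = (\<Sum>k\<le>i. of_nat (Stirling i k) * ?x ^ k * (dx ^^ k) F t)"
      by (rule higher_deriv_Stirling[OF S(3,1,2)])
    also have "\<dots> = (\<Sum>k\<le>N. of_nat (Stirling i k) * ?x ^ k * (dx ^^ k) F t)"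
      using i by (intro sum.mono_neutral_left) auto
    finally show "poly (col i) ?x * (deriv ^^ i) F t =
        (\<Sum>k\<le>N. poly (col i) ?x * (of_nat (Stirling i k) * ?x ^ k * (dx ^^ k) F t))"
      by (simp add: sum_distrib_left)
  qed
  also have "\<dots> = (\<Sum>k\<le>N. ((\<Sum>i\<le>N. poly (col i) ?x * of_nat (Stirling i k)) * ?x ^ k) * (dx ^^ k) F t)"
    by (subst sum.swap, simp only: sum_distrib_right, simp only: mult_ac)
  also have "\<dots> = (\<Sum>k\<le>N. (?x ^ N * poly top_poly ?x) * (monic_coeff k ?x * (dx ^^ k) F t))"
  proof (rule sum.cong[OF refl])
    fix k
    have "(\<Sum>i\<le>N. poly (col i) ?x * of_nat (Stirling i k)) * ?x ^ k = (?x ^ N * poly top_poly ?x) * monic_coeff k ?x"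
    proof (cases "k = N")
      case True
      have "(\<Sum>i\<le>N. poly (col i) ?x * of_nat (Stirling i N)) = (\<Sum>i\<le>N. if i = N then poly top_poly ?x else 0)"
        by (intro sum.cong) (auto simp: col_top)
      then show ?thesis using True by (simp add: monic_coeff_def)
    next
      case False
      then show ?thesis using x by (simp add: monic_coeff_def)
    qed
    then show "((\<Sum>i\<le>N. poly (col i) ?x * of_nat (Stirling i k)) * ?x ^ k) * (dx ^^ k) F t =
        (?x ^ N * poly top_poly ?x) * (monic_coeff k ?x * (dx ^^ k) F t)"
      by (simp only: mult.assoc)
  qed
  finally show ?thesis by (simp add: differential_operator_def sum_distrib_left)
qed

lemma V_regularized_operator: "regularized_differential_operator V N m Ms z dual_op"
  unfolding regularized_differential_operator_def
proof (intro exI conjI allI impI)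
  have top: "poly top_poly x = (\<Prod>a=1..m. (x - z a) ^ Ms a)" for x
    by (simp add: top_poly_def poly_prod)
  have nz: "poly top_poly x \<noteq> 0" if "x \<notin> z ` {1..m}" for x
    using that by (auto simp: top)
  show "fundamental_differential_operator V N monic_coeff"
    unfolding fundamental_differential_operator_def singular_points_V
  proof (intro conjI allI impI ballI)
    fix k show "monic_coeff k holomorphic_on - ({0} \<union> z ` {1..m})"
    proof (cases "k = N")
      case True
      then have "monic_coeff k = (\<lambda>x. 1)" by (simp add: monic_coeff_def fun_eq_iff)
      then show ?thesis by simp
    next
      case False
      then have "monic_coeff k = (\<lambda>x. (\<Sum>i\<le>N. poly (col i) x * of_nat (Stirling i k)) * x ^ k / (x ^ N * poly top_poly x))"
        by (simp add: monic_coeff_def fun_eq_iff)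
      then show ?thesis using nz by (auto intro!: holomorphic_intros)
    qed
  next
    show "monic_coeff N = (\<lambda>x. 1)" by (simp add: monic_coeff_def fun_eq_iff)
  next
    fix F t assume F: "F \<in> V" and t: "exp t \<notin> z ` {1..m}"
    have "F analytic_on {t}" using V_properties(1)[OF F] holomorphic_on_imp_analytic_at by blast
    from dual_op_monic[OF this nz[OF t]] V_properties(2)[OF F, of t]
    show "differential_operator N monic_coeff F t = 0" using nz[OF t] by simp
  qed
  fix F t assume "exp t \<notin> singular_points V N \<and> F analytic_on {t}"
  then show "dual_op F t = exp t ^ N * (\<Prod>a=1..m. (exp t - z a) ^ Ms a) * differential_operator N monic_coeff F t"
    using dual_op_monic[of F t] nz[of "exp t"] unfolding singular_points_V top by blast
qed

end

end

lemma span_holomorphic: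
  assumes "F \<in> cfun.span S" "\<And>G. G \<in> S \<Longrightarrow> G holomorphic_on UNIV"
  shows "F holomorphic_on UNIV"
  using assms(1)
proof (induction rule: cfun.span_induct_alt)
  case base
  show ?case by (simp add: zero_fun_def)
next
  case (step c F G)
  then have "(\<lambda>u. c * F u + G u) holomorphic_on UNIV" using assms(2) by (intro holomorphic_intros) auto
  then show ?case by (simp add: plus_fun_def)
qed

text \<open>
  A common root \<open>s\<close> would allow dividing the operator by \<open>u - s\<close>, against the minimality of \<open>deg B\<^sub>0\<close>;
  that the quotient annihilates \<open>U\<close> at \<open>u = s\<close> as well follows by continuity.
\<close>

lemma regularized_no_common_root:
  assumes B: "regularized_difference_operator U M B" and U: "\<And>f. f \<in> U \<Longrightarrow> f holomorphic_on UNIV"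
  shows "\<exists>k\<le>M. poly (B k) s \<noteq> 0"
proof (rule ccontr)
  assume "\<not> ?thesis"
  then have "\<forall>k. \<exists>C. k \<le> M \<longrightarrow> B k = [:- s, 1:] * C" by (auto simp: poly_eq_0_iff_dvd dvd_def)
  then obtain C where C: "\<And>k. k \<le> M \<Longrightarrow> B k = [:- s, 1:] * C k" by metis
  have ann: "annihilating_difference_operator U M B" and mon: "lead_coeff (B 0) = 1"
    using B unfolding regularized_difference_operator_def by auto
  have Bp: "poly (B k) u = (u - s) * poly (C k) u" if "k \<le> M" for k u
    unfolding C[OF that] poly_mult by simp
  have C0: "C 0 \<noteq> 0" using C[of 0] mon by auto
  have "difference_operator M C f u = 0" if f: "f \<in> U" for f u
  proof -
    have eq: "(v - s) * difference_operator M C f v = 0" for v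
    proof -
      have "(v - s) * difference_operator M C f v = difference_operator M B f v"
        unfolding difference_operator_def sum_distrib_left using Bp by (intro sum.cong) auto
      then show ?thesis using ann f by (simp add: annihilating_difference_operator_def)
    qed
    have hol: "difference_operator M C f holomorphic_on UNIV"
      unfolding difference_operator_def[abs_def] by (intro holomorphic_intros holomorphic_shift[OF U[OF f]])
    show ?thesis
    proof (cases "u = s")
      case True
      have "difference_operator M C f s = (\<lambda>_. 0) s"
        by (rule holomorphic_eq_at[OF hol]) (use eq in auto)
      then show ?thesis using True by simp
    qed (use eq[of u] in simp)
  qed
  then have "annihilating_difference_operator U M C"
    using C0 by (simp add: annihilating_difference_operator_def)
  then have "degree (B 0) \<le> degree (C 0)" using B unfolding regularized_difference_operator_def by blast
  moreover have "degree (B 0) = Suc (degree (C 0))"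
    using C[of 0] C0 degree_mult_eq[of "[:- s, 1:]" "C 0"] by (simp del: mult_pCons_left)
  ultimately show False by simp
qed

theorem theorem4p2:
  fixes m n M N :: nat
    and Ms Ns :: "nat \<Rightarrow> nat"
    and ms ns :: "nat \<Rightarrow> nat \<Rightarrow> nat"
    and z l :: "nat \<Rightarrow> complex"
    and \<theta> :: "nat \<Rightarrow> real"
    and U V :: "(complex \<Rightarrow> complex) set"
    and B :: "nat \<Rightarrow> complex poly"
    and \<gamma> :: "nat \<Rightarrow> real \<Rightarrow> complex"
  assumes M: "M = rank_sum m Ms"
    and N: "N = rank_sum n Ns"
    and U: "nondegenerate_quasi_exponentials m Ms ms z \<theta> n Ns ns l U"
    and D_U: "regularized_difference_operator U M B"
    and contours: "separating_contours n Ns ns l \<gamma>"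
    and V: "V = bispectral_dual U M B n \<gamma>"
  shows
    "(quasi_polynomials_data n Ns ns (\<lambda>i. l i - of_nat (Ns i)) m Ms ms z V \<and>
      nondegenerate_quasi_polynomials n Ns ns (\<lambda>i. l i - of_nat (Ns i)) V) \<and>
     (\<forall>A :: nat \<Rightarrow> nat \<Rightarrow> complex.
        (\<forall>j\<le>M. \<forall>i\<le>N. A i j = coeff (B (M - j)) i) \<longrightarrow>
        regularized_differential_operator V N m Ms z (dual_differential_operator N M A))"
proof -
  have data: "quasi_exponentials_data m Ms ms z \<theta> n Ns ns l U"
    and num: "numerically_nondegenerate m Ms ms n Ns ns"
    using U unfolding nondegenerate_quasi_exponentials_def by auto
  obtain B' where B': "regularized_difference_operator U M B'" "degree (B' 0) = N"
    using U unfolding nondegenerate_quasi_exponentials_def M N by blast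
  have degB: "N = degree (B 0)"
    using B' D_U unfolding regularized_difference_operator_def by (metis le_antisym)
  have qe: "quasi_exponentials m Ms ms z \<theta> U" using data unfolding quasi_exponentials_data_def by blast
  obtain q where q: "\<And>a b. a \<in> {1..m} \<Longrightarrow> b \<in> {1..Ms a} \<Longrightarrow> degree (q a b) = ms a b"
    and Us: "U = cfun.span {\<lambda>u. zpow (z a) (\<theta> a) u * poly (q a b) u | a b. a \<in> {1..m} \<and> b \<in> {1..Ms a}}"
    using qe unfolding quasi_exponentials_def by blast
  have zp: "\<And>a. a \<in> {1..m} \<Longrightarrow> z a \<noteq> 0" "\<And>a. a \<in> {1..m} \<Longrightarrow> z a = rcis (cmod (z a)) (\<theta> a)"
    and zi: "inj_on z {1..m}" and inc: "increasing_positive m Ms ms"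
    using qe unfolding quasi_exponentials_def by blast+
  have U_hol: "f holomorphic_on UNIV" if "f \<in> U" for f
    using that unfolding Us by (rule span_holomorphic) (auto simp: zpow_def intro!: holomorphic_intros)
  have annU: "(\<Sum>j\<le>M. poly (B (M - j)) u * f (u + of_nat j)) = 0" if "f \<in> U" for f u
  proof -
    have "(\<Sum>j\<le>M. poly (B (M - j)) u * f (u + of_nat j)) = difference_operator M B f u"
      unfolding difference_operator_def
      by (rule sum.reindex_bij_witness[of _ "\<lambda>k. M - k" "\<lambda>k. M - k"]) auto
    then show ?thesis using D_U that
      by (simp add: regularized_difference_operator_def annihilating_difference_operator_def)
  qed
  have ann: "(\<Sum>j\<le>M. z a ^ j * poly (B (M - j)) u * poly (q a b) (u + of_nat j)) = 0"
    if ab: "a \<in> {1..m}" "b \<in> {1..Ms a}" for a b u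
  proof -
    have "(\<lambda>u. zpow (z a) (\<theta> a) u * poly (q a b) u) \<in> U"
      unfolding Us using ab by (intro cfun.span_base) blast
    from annU[OF this, of u]
    have "zpow (z a) (\<theta> a) u * (\<Sum>j\<le>M. z a ^ j * poly (B (M - j)) u * poly (q a b) (u + of_nat j)) = 0"
      unfolding sum_distrib_left zpow_shift[OF zp[OF ab(1)]] by (simp add: mult_ac)
    then show ?thesis by (simp add: zpow_def)
  qed
  have strings: "\<And>i j. i \<in> {1..n} \<Longrightarrow> j \<in> {1..n} \<Longrightarrow> i \<noteq> j \<Longrightarrow> l i - l j \<notin> \<int>"
    "increasing_positive n Ns ns" "\<And>i. i \<in> {1..n} \<Longrightarrow> Ns i \<le> M"
    "\<And>i. i \<in> {1..n} \<Longrightarrow> discrete_exponents U M (l i) (gap_exponents M (Ns i) (ns i))"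
    using data unfolding quasi_exponentials_data_def M by simp_all
  have mon: "lead_coeff (B 0) = 1" using D_U unfolding regularized_difference_operator_def by blast
  interpret bispectral_setup m M N Ms ms z B q n Ns ns l \<theta> U
  proof
    show "\<exists>k\<le>M. poly (B k) s \<noteq> 0" for s by (rule regularized_no_common_root[OF D_U U_hol])
  qed (fact zp zi inc M mon degB q ann Us strings N num annU)+
  have op: "dual_differential_operator N M A = dual_op" if "\<forall>j\<le>M. \<forall>i\<le>N. A i j = coeff (B (M - j)) i" for A
    unfolding dual_differential_operator_def fun_eq_iff using that by (intro allI sum.cong refl) simp
  show ?thesis
  proof (intro conjI allI impI)
    show "quasi_polynomials_data n Ns ns (\<lambda>i. l i - of_nat (Ns i)) m Ms ms z V"
      by (rule V_data[OF contours V])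
    show "nondegenerate_quasi_polynomials n Ns ns (\<lambda>i. l i - of_nat (Ns i)) V"
      by (rule V_nondegenerate[OF contours V])
    fix A :: "nat \<Rightarrow> nat \<Rightarrow> complex"
    assume A: "\<forall>j\<le>M. \<forall>i\<le>N. A i j = coeff (B (M - j)) i"
    show "regularized_differential_operator V N m Ms z (dual_differential_operator N M A)"
      unfolding op[OF A] by (rule V_regularized_operator[OF contours V])
  qed
qed

end
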